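(* (a) There is a $46$-state automaton accepting the base-$2$ expansions of those $n$ for which the Thue-Morse sequence has a privileged factor of length $n$. (b) There is an $84$-state automaton accepting the base-$2$ expansions of those $n$ for which the Rudin-Shapiro sequence has a privileged factor of length $n$. (c) There is a $47$-state automaton accepting the base-$2$ expansions of those $n$ for which the ordinary paperfolding sequence has a privileged factor of length $n$. (d) The set of $n$ for which the period-doubling sequence has a privileged factor of length $n$ is $\{0,2\}\cup\{2n+1 : n\ge 0\}$. There is a $4$-state automaton accepting the base-$2$ expansions of those $n$ for which the period-doubling sequence has a privileged factor of length $n$. (e) Let $\mathbf{f}$ be the Fibonacci sequence. There is a $20$-state automaton accepting the Zeckendorf representations of those pairs $(i,n)$ for which $\mathbf{f}[i..i+n-1]$ is privileged. The Fibonacci sequence has privileged factors of every length. If $n$ is even, there is exactly one privileged factor of length $n$. If $n$ is odd, there are exactly two privileged factors of length $n$.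
   Context: $|x|_w$ is the number of (possibly overlapping) occurrences of $w$ as a factor of $x$. A nonempty word $w$ is a border of $x$ if it is both a prefix and a suffix of $x$. A word $x$ is privileged (recursive definition) if $|x|\le 1$, or $x$ has a border $w$ with $|x|_w=2$ that is itself privileged. Infinite words are indexed from $0$, and $\mathbf{f}[i..j]=f_if_{i+1}\cdots f_j$ (empty if $j=i-1$). Sequences: - Thue-Morse: the fixed point starting with $0$ of the morphism $0\to01$, $1\to10$. - Rudin-Shapiro ($00010010\cdots$): the image under the coding $n\mapsto\lfloor n/2\rfloor$ of the fixed point starting with $0$ of $0\to01$, $1\to02$, $2\to31$, $3\to32$. - Ordinary paperfolding ($00100110\cdots$): $p_{2n+1}=p_n$, $p_{4n}=0$, $p_{4n+2}=1$ for all $n\ge0$. - Period-doubling ($10111010\cdots$): the fixed point starting with $1$ of $1\to10$, $0\to11$. - Fibonacci ($01001010\cdots$): the fixed point starting with $0$ of $0\to01$, $1\to0$. Automata are deterministic finite automata reading representations most significant digit first (missing transitions, if any, reject). "Accepting the representations of those $n$ (or pairs) with a property" means: the automaton accepts the representation of $n$ (or the pair) if and only if the property holds. The Zeckendorf representation of $n$ is its unique representation as a sum of distinct non-consecutive Fibonacci numbers $1,2,3,5,8,\ldots$, written as a binary word with no two consecutive $1$s; a pair $(i,n)$ is represented by a word over $\{0,1\}^2$ whose components are the two Zeckendorf representations, the shorter one padded on the left with zeros. *)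

theory Defs
  imports "HOL-Library.Stream" "HOL-Library.Sublist" "HOL-Number_Theory.Fib"
begin

section \<open>Privileged words\<close>

definition occurrences :: "'a list \<Rightarrow> 'a list \<Rightarrow> nat" where
  "occurrences x w = card {i. i + length w \<le> length x \<and> take (length w) (drop i x) = w}"

definition border :: "'a list \<Rightarrow> 'a list \<Rightarrow> bool" where
  "border w x \<longleftrightarrow> w \<noteq> [] \<and> prefix w x \<and> suffix w x"

text \<open>The trivial border \<open>w = x\<close> occurs only once in \<open>x\<close>, so the border in the second
  rule is automatically proper.\<close>

inductive privileged :: "'a list \<Rightarrow> bool" where
  short: "length x \<le> 1 \<Longrightarrow> privileged x"
| border: "border w x \<Longrightarrow> occurrences x w = 2 \<Longrightarrow> privileged w \<Longrightarrow> privileged x"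

text \<open>\<open>factor_at s i n\<close> is the length-\<open>n\<close> factor of \<open>s\<close> starting at position \<open>i\<close>, positions counted from 0.\<close>

definition factor_at :: "'a stream \<Rightarrow> nat \<Rightarrow> nat \<Rightarrow> 'a list" where
  "factor_at s i n = stake n (sdrop i s)"

definition privileged_factors :: "'a stream \<Rightarrow> nat \<Rightarrow> 'a list set" where
  "privileged_factors s n = {x. (\<exists>i. x = factor_at s i n) \<and> privileged x}"

definition has_privileged_factor :: "'a stream \<Rightarrow> nat \<Rightarrow> bool" where
  "has_privileged_factor s n \<longleftrightarrow> privileged_factors s n \<noteq> {}"


section \<open>Fixed points of morphisms\<close>

text \<open>A nonerasing morphism is given by its values on letters; its extension to infinite words
  maps \<open>x\<close> to \<open>flat (smap h x)\<close>.\<close>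

definition fixed_point :: "('a \<Rightarrow> 'a list) \<Rightarrow> 'a \<Rightarrow> 'a stream" where
  "fixed_point h a = (THE x. shd x = a \<and> flat (smap h x) = x)"

lemma stream_eqI:
  assumes "\<And>n. x !! n = y !! n"
  shows "x = y"
  using smap_alt[of id x y] assms by (simp add: stream.map_id)

lemma flat_smap_stake_sdrop:
  assumes "\<And>b. h b \<noteq> []"
  shows "flat (smap h x) = concat (map h (stake n x)) @- flat (smap h (sdrop n x))"
proof (induction n arbitrary: x)
  case (Suc n)
  have "flat (smap h x) = h (shd x) @- flat (smap h (stl x))"
    using assms by (subst flat_unfold) auto
  then show ?case
    using Suc[of "stl x"] by simp
qed simp

lemma length_concat_map_ge:
  assumes "\<And>b. h b \<noteq> []"
  shows "length w \<le> length (concat (map h w))"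
proof (induction w)
  case (Cons b w)
  have "length (h b) \<ge> 1" using assms[of b] by (simp add: Suc_le_eq)
  then show ?case using Cons by simp
qed simp

text \<open>The definite description in \<open>fixed_point\<close> is well defined for nonerasing morphisms that
  are prolongable on the initial letter.\<close>

lemma fixed_point_ex1:
  fixes h :: "'a \<Rightarrow> 'a list"
  assumes ne: "\<And>b. h b \<noteq> []" and ha: "h a = a # u" and u: "u \<noteq> []"
  shows "\<exists>!x. shd x = a \<and> flat (smap h x) = x"
proof (rule ex_ex1I)
  define H where "H w = concat (map h w)" for w
  define it where "it n = (H ^^ n) [a]" for n
  have H_append: "H (v @ w) = H v @ H w" for v w by (simp add: H_def)
  have it_Suc: "it (Suc n) = H (it n)" for n by (simp add: it_def)
  have step: "\<exists>v. v \<noteq> [] \<and> it (Suc n) = it n @ v" for n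
  proof (induction n)
    case 0
    then show ?case using ha u by (auto simp: it_def H_def)
  next
    case (Suc n)
    then obtain v where v: "v \<noteq> []" "it (Suc n) = it n @ v" by blast
    have "it (Suc (Suc n)) = it (Suc n) @ H v"
      by (subst it_Suc, subst v(2), subst H_append) (simp add: it_Suc)
    moreover have "H v \<noteq> []" using v(1) ne by (cases v) (auto simp: H_def)
    ultimately show ?case by blast
  qed
  have len: "n < length (it n)" for n
  proof (induction n)
    case 0
    show ?case by (simp add: it_def)
  next
    case (Suc n)
    obtain v where "v \<noteq> []" "it (Suc n) = it n @ v" using step by blast
    then show ?case using Suc by (cases v) auto
  qed
  have nth: "it (n + k) ! i = it n ! i" if "i < length (it n)" for n k i
    using that
  proof (induction k)
    case (Suc k)
    obtain v where v: "it (Suc (n + k)) = it (n + k) @ v" using step by blast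
    have "length (it n) \<le> length (it (n + k))"
    proof (induction k)
      case (Suc k)
      obtain w where "it (Suc (n + k)) = it (n + k) @ w" using step by blast
      then show ?case using Suc by simp
    qed simp
    then show ?case using v Suc by (simp add: nth_append)
  qed simp
  define x where "x = smap (\<lambda>n. it n ! n) nats"
  have x_nth: "x !! i = it n ! i" if "i < length (it n)" for n i
  proof -
    have "it (n + i) ! i = it n ! i" using nth that by blast
    moreover have "it (i + n) ! i = it i ! i" using nth len by blast
    ultimately show ?thesis by (simp add: x_def add.commute)
  qed
  have stake_x: "stake (length (it n)) x = it n" for n
    by (rule nth_equalityI) (simp_all add: x_nth[of _ n])
  have "flat (smap h x) !! i = x !! i" for i
  proof -
    have "flat (smap h x) = it (Suc i) @- flat (smap h (sdrop (length (it i)) x))"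
      using flat_smap_stake_sdrop[of h x "length (it i)", OF ne]
      by (simp add: stake_x it_Suc H_def)
    moreover have "i < length (it (Suc i))" using len[of "Suc i"] by simp
    moreover from this have "x !! i = it (Suc i) ! i" by (rule x_nth)
    ultimately show ?thesis by (simp only: shift_snth_less)
  qed
  then have "flat (smap h x) = x" by (rule stream_eqI)
  moreover have "shd x = a" by (simp add: x_def it_def)
  ultimately show "\<exists>x. shd x = a \<and> flat (smap h x) = x" by blast
next
  fix x y
  assume x: "shd x = a \<and> flat (smap h x) = x" and y: "shd y = a \<and> flat (smap h y) = y"
  have eq: "stake (Suc n) x = stake (Suc n) y" for n
  proof (induction n)
    case 0
    show ?case using x y by simp
  next
    case (Suc n)
    define p where "p = concat (map h (stake (Suc n) x))"
    have px: "x = p @- flat (smap h (sdrop (Suc n) x))"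
    proof -
      have "x = flat (smap h x)" using x by simp
      also have "\<dots> = p @- flat (smap h (sdrop (Suc n) x))"
        unfolding p_def by (rule flat_smap_stake_sdrop[OF ne])
      finally show ?thesis .
    qed
    have py: "y = p @- flat (smap h (sdrop (Suc n) y))"
    proof -
      have "y = flat (smap h y)" using y by simp
      also have "\<dots> = p @- flat (smap h (sdrop (Suc n) y))"
        unfolding p_def Suc by (rule flat_smap_stake_sdrop[OF ne])
      finally show ?thesis .
    qed
    have "p = h a @ concat (map h (stake n (stl x)))" using x by (simp add: p_def)
    moreover have "length (h a) \<ge> 2" using ha u by (cases u) auto
    moreover have "length (concat (map h (stake n (stl x)))) \<ge> n"
      using length_concat_map_ge[of h "stake n (stl x)"] ne by simp
    ultimately have "length p \<ge> Suc (Suc n)" by simp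
    then show ?case
      by (subst px, subst py) (simp only: stake_shift min_absorb1, simp)
  qed
  have "x !! n = y !! n" for n
    using eq[of n] by (metis lessI stake_nth)
  then show "x = y" by (rule stream_eqI)
qed


section \<open>The sequences\<close>

text \<open>Letters are natural numbers. In each morphism the last branch is meant for the last letter
  of the alphabet; no further letters are reachable from the initial one.\<close>

definition thue_morse :: "nat stream" where
  "thue_morse = fixed_point (\<lambda>a. if a = 0 then [0, 1] else [1, 0]) 0"

definition rudin_shapiro :: "nat stream" where
  "rudin_shapiro = smap (\<lambda>n. n div 2)
     (fixed_point (\<lambda>a. if a = 0 then [0, 1] else if a = 1 then [0, 2]
                       else if a = 2 then [3, 1] else [3, 2]) 0)"

function paperfolding_nth :: "nat \<Rightarrow> nat" where
  "paperfolding_nth (2 * n + 1) = paperfolding_nth n"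
| "paperfolding_nth (4 * n) = 0"
| "paperfolding_nth (4 * n + 2) = 1"
proof -
  fix P and x :: nat
  assume 1: "\<And>n. x = 2 * n + 1 \<Longrightarrow> P" and 2: "\<And>n. x = 4 * n \<Longrightarrow> P"
    and 3: "\<And>n. x = 4 * n + 2 \<Longrightarrow> P"
  have "(\<exists>n. x = 2 * n + 1) \<or> (\<exists>n. x = 4 * n) \<or> (\<exists>n. x = 4 * n + 2)" by presburger
  then show P using 1 2 3 by blast
qed ((rule FalseE, presburger) | simp)+
termination by (relation "measure id") auto

definition paperfolding :: "nat stream" where
  "paperfolding = smap paperfolding_nth nats"

definition period_doubling :: "nat stream" where
  "period_doubling = fixed_point (\<lambda>a. if a = 1 then [1, 0] else [1, 1]) 1"

definition fibonacci_word :: "nat stream" where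
  "fibonacci_word = fixed_point (\<lambda>a. if a = 0 then [0, 1] else [0]) 0"

section \<open>Automata\<close>

text \<open>Deterministic finite automata whose transition function may be partial.\<close>

record ('q, 'a) dfa =
  states :: "'q set"
  initial :: 'q
  accepting :: "'q set"
  step :: "'q \<Rightarrow> 'a \<Rightarrow> 'q option"

definition is_dfa :: "'a set \<Rightarrow> ('q, 'a) dfa \<Rightarrow> bool" where
  "is_dfa \<Sigma> A \<longleftrightarrow> finite (states A) \<and> initial A \<in> states A \<and> accepting A \<subseteq> states A \<and>
     (\<forall>q\<in>states A. \<forall>a\<in>\<Sigma>. \<forall>q'. step A q a = Some q' \<longrightarrow> q' \<in> states A)"

fun run :: "('q, 'a) dfa \<Rightarrow> 'q \<Rightarrow> 'a list \<Rightarrow> 'q option" where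
  "run A q [] = Some q"
| "run A q (a # w) = (case step A q a of None \<Rightarrow> None | Some q' \<Rightarrow> run A q' w)"

definition accepts :: "('q, 'a) dfa \<Rightarrow> 'a list \<Rightarrow> bool" where
  "accepts A w \<longleftrightarrow> (\<exists>q\<in>accepting A. run A (initial A) w = Some q)"


section \<open>Representations, most significant digit first\<close>

text \<open>In both numeration systems 0 is represented by the empty word.\<close>

fun base2 :: "nat \<Rightarrow> nat list" where
  "base2 n = (if n = 0 then [] else base2 (n div 2) @ [n mod 2])"

declare base2.simps [simp del]

text \<open>The digit in position \<open>j\<close> (counted from the right, from 0) has weight \<open>fib (j + 2)\<close>, i.e.
  1, 2, 3, 5, 8 and so on.\<close>

definition is_zeckendorf :: "nat list \<Rightarrow> nat \<Rightarrow> bool" where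
  "is_zeckendorf w n \<longleftrightarrow> set w \<subseteq> {0, 1} \<and> (w \<noteq> [] \<longrightarrow> hd w = 1) \<and>
     successively (\<lambda>a b. \<not> (a = 1 \<and> b = 1)) w \<and>
     n = (\<Sum>j<length w. rev w ! j * fib (j + 2))"

lemma zeckendorf_sum_Cons:
  "(\<Sum>j<length (a # w). rev (a # w) ! j * fib (j + 2)) =
     a * fib (length w + 2) + (\<Sum>j<length w. rev w ! j * fib (j + 2))"
proof -
  have "(\<Sum>j<length w. rev (a # w) ! j * fib (j + 2)) = (\<Sum>j<length w. rev w ! j * fib (j + 2))"
    by (rule sum.cong) (auto simp: nth_append)
  then show ?thesis by (simp add: nth_append)
qed

lemma zeckendorf_ex1: "\<exists>!w. is_zeckendorf w n"
proof -
  define val where "val w = (\<Sum>j<length w. rev w ! j * fib (j + 2))" for w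
  define ok where "ok w \<longleftrightarrow> set w \<subseteq> {0, 1} \<and> successively (\<lambda>a b. \<not> (a = 1 \<and> b = 1)) w" for w :: "nat list"
  have Z: "is_zeckendorf w n \<longleftrightarrow> ok w \<and> (w \<noteq> [] \<longrightarrow> hd w = 1) \<and> n = val w" for w n
    by (auto simp: is_zeckendorf_def val_def ok_def)
  have val_Nil: "val [] = 0" by (simp add: val_def)
  have val_Cons: "val (a # w) = a * fib (length w + 2) + val w" for a w
    unfolding val_def by (rule zeckendorf_sum_Cons)
  have ok_tl: "ok w" if "ok (a # w)" for a w
    using that by (auto simp: ok_def successively_Cons)
  have bound: "val w < fib (length w + 2)" if "ok w" for w
    using that
  proof (induction w rule: length_induct)
    case (1 w)
    show ?case
    proof (cases w)
      case Nil
      then show ?thesis by (simp add: val_Nil)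
    next
      case (Cons a v)
      have v: "val v < fib (length v + 2)" using 1 Cons ok_tl by auto
      have "a = 0 \<or> a = 1" using 1(2) Cons by (auto simp: ok_def)
      then show ?thesis
      proof
        assume "a = 0"
        then show ?thesis using v Cons fib_mono[of "length v + 2" "length w + 2"]
          by (simp add: val_Cons)
      next
        assume a: "a = 1"
        show ?thesis
        proof (cases v)
          case Nil
          then show ?thesis using Cons a by (simp add: val_Cons val_Nil)
        next
          case (Cons b u)
          have "b = 0" using 1(2) a Cons \<open>w = a # v\<close> by (auto simp: ok_def successively_Cons)
          moreover have "val u < fib (length u + 2)"
            using 1 Cons \<open>w = a # v\<close> ok_tl by (metis length_Cons less_Suc_eq)
          ultimately show ?thesis using a Cons \<open>w = a # v\<close> by (simp add: val_Cons)
        qed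
      qed
    qed
  qed
  have uniq: "v = w" if "length v = length w" "ok v" "ok w" "val v = val w" for v w
    using that
  proof (induction v w rule: list_induct2)
    case (Cons a v b w)
    have "a = 0 \<or> a = 1" "b = 0 \<or> b = 1" using Cons.prems by (auto simp: ok_def)
    moreover have "val v < fib (length v + 2)" "val w < fib (length w + 2)"
      using bound ok_tl Cons.prems by blast+
    ultimately have "a = b" using Cons.prems(3) Cons.hyps by (auto simp: val_Cons)
    moreover have "v = w"
      using Cons.IH Cons.prems Cons.hyps \<open>a = b\<close> ok_tl by (auto simp: val_Cons)
    ultimately show ?case by simp
  qed simp
  have ex: "\<exists>w. length w = l \<and> ok w \<and> val w = n" if "n < fib (l + 2)" for l n
    using that
  proof (induction l arbitrary: n rule: less_induct)
    case (less l)
    show ?case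
    proof (cases l)
      case 0
      then show ?thesis using less.prems by (auto simp: val_Nil ok_def)
    next
      case (Suc k)
      show ?thesis
      proof (cases "n < fib (k + 2)")
        case True
        then obtain w where "length w = k" "ok w" "val w = n" using less.IH[of k] Suc by auto
        then have "length (0 # w) = l \<and> ok (0 # w) \<and> val (0 # w) = n"
          using Suc by (auto simp: ok_def successively_Cons val_Cons)
        then show ?thesis by blast
      next
        case False
        show ?thesis
        proof (cases k)
          case 0
          then have "n = 1" using False less.prems Suc by (simp add: numeral_eq_Suc)
          then have "length [1::nat] = l \<and> ok [1] \<and> val [1] = n"
            using Suc 0 by (auto simp: ok_def val_Cons val_Nil)
          then show ?thesis by blast
        next
          case (Suc m)
          have "n - fib (k + 2) < fib (m + 2)" using less.prems False Suc \<open>l = Suc k\<close> by simp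
          then obtain w where "length w = m" "ok w" "val w = n - fib (k + 2)"
            using less.IH[of m "n - fib (k + 2)"] Suc \<open>l = Suc k\<close> by auto
          then have "length (1 # 0 # w) = l \<and> ok (1 # 0 # w) \<and> val (1 # 0 # w) = n"
            using Suc \<open>l = Suc k\<close> False by (auto simp: ok_def successively_Cons val_Cons)
          then show ?thesis by blast
        qed
      qed
    qed
  qed
  have strip: "\<exists>v. ok v \<and> (v \<noteq> [] \<longrightarrow> hd v = 1) \<and> val v = val w" if "ok w" for w
    using that
  proof (induction w)
    case (Cons a w)
    have "a = 0 \<or> a = 1" using Cons.prems by (auto simp: ok_def)
    then show ?case
    proof
      assume "a = 0"
      then show ?thesis using Cons ok_tl by (simp add: val_Cons)
    next
      assume "a = 1"
      then show ?thesis using Cons.prems by (intro exI[of _ "a # w"]) simp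
    qed
  qed auto
  show ?thesis
  proof (rule ex_ex1I)
    have "n < fib (n + 2)"
    proof (induction n)
      case (Suc n)
      moreover have "fib (n + 1) > 0" by (rule fib_neq_0_nat) simp
      ultimately show ?case by simp
    qed simp
    then obtain w where "ok w" "val w = n" using ex by blast
    then show "\<exists>w. is_zeckendorf w n" using strip unfolding Z by metis
  next
    fix v w assume vw: "is_zeckendorf v n" "is_zeckendorf w n"
    have lower: "fib (length w + 1) \<le> n" if "is_zeckendorf w n" "w \<noteq> []" for w
      using that unfolding Z by (cases w) (auto simp: val_Cons)
    have le: "length v \<le> length w" if "is_zeckendorf v n" "is_zeckendorf w n" for v w
    proof (rule ccontr)
      assume "\<not> ?thesis"
      then have "fib (length w + 2) \<le> fib (length v + 1)" by (intro fib_mono) simp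
      also have "\<dots> \<le> n"
      proof (rule lower[OF that(1)])
        show "v \<noteq> []" using \<open>\<not> length v \<le> length w\<close> by (metis list.size(3) zero_le)
      qed
      also have "n < fib (length w + 2)" using that(2) bound[of w] unfolding Z by simp
      finally show False by simp
    qed
    have "length v = length w" using le vw by (simp add: le_antisym)
    then show "v = w" using vw unfolding Z by (intro uniq) auto
  qed
qed

definition zeckendorf :: "nat \<Rightarrow> nat list" where
  "zeckendorf n = (THE w. is_zeckendorf w n)"

definition pad :: "nat \<Rightarrow> nat list \<Rightarrow> nat list" where
  "pad l w = replicate (l - length w) 0 @ w"

definition zeckendorf_pair :: "nat \<Rightarrow> nat \<Rightarrow> (nat \<times> nat) list" where
  "zeckendorf_pair i n =
     (let u = zeckendorf i; v = zeckendorf n; l = max (length u) (length v)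
      in zip (pad l u) (pad l v))"

end

theory Submission
  imports Defs
begin

text \<open>Following the nested privileged prefixes of the factors at a fixed position \<open>p\<close>, the length \<open>m\<close>
  jumps to the end of the next occurrence of the factor of length \<open>m\<close> at \<open>p\<close>; a factor is privileged iff
  its length lies on this chain. In the four 2-automatic words long factors determine the parity of
  their position, so the chain of a long factor at \<open>p\<close> is the image of a chain at \<open>p div 2\<close>, with the
  lengths related by \<open>n + e + off = 2 y + 1\<close>. Hence the sets of lengths of privileged factors that
  extend a short base word satisfy a finite system of equations, which an automaton
  reading the least significant digit first solves with finitely many sets of equations as states;
  its reversal is the required automaton. The search for the states is not verified: only the closure
  of its result under transitions is checked, by evaluation in the kernel.

  The privileged factors of the Fibonacci word are likewise the words \<open>h(y)0\<close> and \<open>0\<^sup>-\<^sup>1h(y)\<close> with \<open>y\<close>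
  privileged. Every privileged word \<open>v\<close> extends to \<open>ava\<close> for exactly one letter \<open>a\<close>, which gives the
  numbers of privileged factors. Appending a digit to Zeckendorf representations amounts to applying \<open>h\<close>,
  so a finite window of lengths around \<open>n\<close> suffices to follow privilegedness along the digits.\<close>

section \<open>Privileged factors as chains of occurrences\<close>

text \<open>Privilegedness is defined by recursion on words, while the sequences are known through
  recurrences on positions; a walk through the lengths at one fixed position makes passing to an
  image a mere relabelling of positions and lengths. The obstacle is that a letter of the
  Rudin--Shapiro or paperfolding word may depend on the parity of half its index, not only on the
  letter above it. There a class is a word together with the parity of its position, and plain words
  are related to classes only from the length on at which a factor determines its parity. Sets of
  lengths are formed over all positions of a class at once, so finitely many base classes suffice;
  as each equation refers to shorter lengths, induction on the length shows that its least solution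
  misses nothing. Halving a length removes its lowest binary digit, which is why the direct
  construction reads that digit first. The finite data are generated from blocks of eight letters,
  three rounds of doubling, which a letter and the parity of its index determine.\<close>

definition fac :: "(nat \<Rightarrow> 'a) \<Rightarrow> nat \<Rightarrow> nat \<Rightarrow> 'a list" where
  "fac s p m = map (\<lambda>i. s (p + i)) [0..<m]"

lemma length_fac [simp]: "length (fac s p m) = m"
  by (simp add: fac_def)

lemma nth_fac [simp]: "i < m \<Longrightarrow> fac s p m ! i = s (p + i)"
  by (simp add: fac_def)

lemma fac_0 [simp]: "fac s p 0 = []"
  by (simp add: fac_def)

lemma fac_Suc: "fac s p (Suc m) = s p # fac s (Suc p) m"
  by (rule nth_equalityI) (auto simp: nth_Cons split: nat.split)

lemma fac_add: "fac s p (m + n) = fac s p m @ fac s (p + m) n"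
  by (rule nth_equalityI) (auto simp: nth_append)

lemma take_fac: "take k (fac s p m) = fac s p (min k m)"
  by (rule nth_equalityI) auto

lemma drop_fac: "drop k (fac s p m) = fac s (p + k) (m - k)"
  by (rule nth_equalityI) (auto simp: add.assoc)

lemma fac_eq_iff: "fac s p m = fac t q m \<longleftrightarrow> (\<forall>i<m. s (p + i) = t (q + i))"
  by (auto simp: list_eq_iff_nth_eq)

lemma prefix_fac_iff: "prefix u (fac s p n) \<longleftrightarrow> length u \<le> n \<and> u = fac s p (length u)"
  by (metis length_fac min.absorb1 prefix_def prefix_length_le take_fac take_is_prefix append_eq_conv_conj)

lemma factor_at_eq_fac: "factor_at S i n = fac (\<lambda>j. S !! j) i n"
  unfolding factor_at_def by (rule nth_equalityI) (auto simp: sdrop_snth add.commute)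

text \<open>\<open>c\<close> maps a position and a length to a class; leaving it abstract covers
  plain factors as well as factors paired with the parity of their position.\<close>

definition nxt :: "(nat \<Rightarrow> nat \<Rightarrow> 'c) \<Rightarrow> nat \<Rightarrow> nat \<Rightarrow> nat \<Rightarrow> bool" where
  "nxt c p m q \<longleftrightarrow> p < q \<and> c q m = c p m \<and> (\<forall>r. p < r \<and> r < q \<longrightarrow> c r m \<noteq> c p m)"

inductive chain :: "(nat \<Rightarrow> nat \<Rightarrow> 'c) \<Rightarrow> nat \<Rightarrow> nat \<Rightarrow> nat \<Rightarrow> bool" for c p where
  refl: "chain c p m m"
| step: "nxt c p m q \<Longrightarrow> chain c p (q - p + m) n \<Longrightarrow> chain c p m n"

lemma nxt_unique: "nxt c p m q \<Longrightarrow> nxt c p m q' \<Longrightarrow> q = q'"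
  unfolding nxt_def by (metis linorder_neqE_nat)

lemma chain_le: "chain c p m n \<Longrightarrow> m \<le> n"
  by (induction rule: chain.induct) auto

lemma chain_trans: "chain c p l m \<Longrightarrow> chain c p m n \<Longrightarrow> chain c p l n"
  by (induction rule: chain.induct) (auto intro: chain.step)

text \<open>The next occurrence is unique, so the first step of a chain is forced.\<close>

lemma chain_unfold:
  assumes "nxt c p m q"
  shows "chain c p m n \<longleftrightarrow> n = m \<or> chain c p (q - p + m) n"
  using assms nxt_unique by (metis chain.simps)

text \<open>Since \<open>g\<close> preserves order, a correspondence of occurrences
  (\<open>occ\<close>) is one of next occurrences, and \<open>len\<close> matches the two length
  increments. \<open>Q\<close> is an invariant of the lengths along the chain.\<close>

lemma chain_transport_on:
  assumes g: "strict_mono g" and p: "p = g p'"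
    and occ: "\<And>m q. Q m \<Longrightarrow> c q (l m) = c p (l m) \<longleftrightarrow> (\<exists>q'. q = g q' \<and> c' q' m = c' p' m)"
    and len: "\<And>m q'. Q m \<Longrightarrow> p' < q' \<Longrightarrow> c' q' m = c' p' m \<Longrightarrow> g q' - p + l m = l (q' - p' + m)"
    and Q: "\<And>m q'. Q m \<Longrightarrow> p' < q' \<Longrightarrow> c' q' m = c' p' m \<Longrightarrow> Q (q' - p' + m)"
    and m: "Q m"
  shows "chain c p (l m) n \<longleftrightarrow> (\<exists>m'. n = l m' \<and> chain c' p' m m')"
proof -
  have nxt: "nxt c p (l m) q \<longleftrightarrow> (\<exists>q'. q = g q' \<and> nxt c' p' m q')" if "Q m" for m q
  proof
    assume q: "nxt c p (l m) q"
    then obtain q' where q': "q = g q'" "c' q' m = c' p' m"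
      using occ[OF \<open>Q m\<close>] by (auto simp: nxt_def)
    have "c' r m \<noteq> c' p' m" if "p' < r" "r < q'" for r
    proof
      assume "c' r m = c' p' m"
      then have "c (g r) (l m) = c p (l m)" using occ[OF \<open>Q m\<close>] by blast
      moreover have "p < g r" "g r < q"
        using that g strict_monoD unfolding p q'(1) by blast+
      ultimately show False using q by (auto simp: nxt_def)
    qed
    moreover have "p' < q'" using q g unfolding p q'(1) nxt_def by (simp add: strict_mono_less)
    ultimately show "\<exists>q'. q = g q' \<and> nxt c' p' m q'" using q' by (auto simp: nxt_def)
  next
    assume "\<exists>q'. q = g q' \<and> nxt c' p' m q'"
    then obtain q' where q': "q = g q'" "nxt c' p' m q'" by blast
    have "c r (l m) \<noteq> c p (l m)" if r: "p < r" "r < q" for r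
    proof
      assume "c r (l m) = c p (l m)"
      then obtain r' where r': "r = g r'" "c' r' m = c' p' m" using occ[OF \<open>Q m\<close>] by blast
      have "p' < r'" "r' < q'" using r g unfolding p q'(1) r'(1) by (simp_all add: strict_mono_less)
      then show False using q'(2) r'(2) by (auto simp: nxt_def)
    qed
    moreover have "c q (l m) = c p (l m)" using occ[OF \<open>Q m\<close>] q' by (auto simp: nxt_def)
    moreover have "p < q" using q' g unfolding p by (auto simp: nxt_def strict_mono_less)
    ultimately show "nxt c p (l m) q" by (auto simp: nxt_def)
  qed
  show ?thesis
  proof
    assume "chain c p (l m) n"
    then show "\<exists>m'. n = l m' \<and> chain c' p' m m'" using m
    proof (induction "l m" n arbitrary: m rule: chain.induct)
      case refl
      then show ?case using chain.refl by blast
    next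
      case (step q n)
      then obtain q' where q': "q = g q'" "nxt c' p' m q'" using nxt by blast
      then have "q - p + l m = l (q' - p' + m)"
        using len step.prems unfolding nxt_def by blast
      moreover have "Q (q' - p' + m)" using Q step.prems q'(2) unfolding nxt_def by blast
      ultimately show ?case using step.hyps(3) q'(2) by (metis chain.step)
    qed
  next
    assume "\<exists>m'. n = l m' \<and> chain c' p' m m'"
    then obtain m' where "n = l m'" "chain c' p' m m'" by blast
    from this(2) m have "chain c p (l m) (l m')"
    proof (induction rule: chain.induct)
      case (refl m)
      then show ?case by (simp add: chain.refl)
    next
      case (step m q' n)
      have "g q' - p + l m = l (q' - p' + m)"
        using len step unfolding nxt_def by blast
      moreover have "Q (q' - p' + m)" using Q step unfolding nxt_def by blast
      moreover have "nxt c p (l m) (g q')" using nxt step.prems step.hyps(1) by blast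
      ultimately show ?case using step.IH chain.step[of c p "l m" "g q'"] by (simp add: p)
    qed
    then show "chain c p (l m) n" using \<open>n = l m'\<close> by simp
  qed
qed

lemma chain_transport:
  assumes "strict_mono g" "p = g p'"
    and "\<And>m q. m0 \<le> m \<Longrightarrow> c q (l m) = c p (l m) \<longleftrightarrow> (\<exists>q'. q = g q' \<and> c' q' m = c' p' m)"
    and "\<And>m q'. m0 \<le> m \<Longrightarrow> p' < q' \<Longrightarrow> c' q' m = c' p' m \<Longrightarrow> g q' - p + l m = l (q' - p' + m)"
    and "m0 \<le> m"
  shows "chain c p (l m) n \<longleftrightarrow> (\<exists>m'. n = l m' \<and> chain c' p' m m')"
  by (rule chain_transport_on[where g = g and Q = "\<lambda>m. m0 \<le> m"]) (use assms in auto)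

text \<open>A chain up to \<open>n\<close> inspects only occurrences that end within the first
  \<open>n\<close> letters, so it depends on \<open>p\<close> only through the class of length
  \<open>n\<close> there.\<close>

lemma chain_transfer:
  assumes loc: "\<And>m n i. c p n = c p' n \<Longrightarrow> i + m \<le> n \<Longrightarrow>
      c (p + i) m = c p m \<longleftrightarrow> c (p' + i) m = c p' m"
    and "chain c p m n" and "c p n = c p' n"
  shows "chain c p' m n"
  using assms(2,3)
proof (induction rule: chain.induct)
  case (step m q n)
  have le: "q - p + m \<le> n" using step.hyps(2) by (rule chain_le)
  have "nxt c p' m (p' + (q - p))"
    unfolding nxt_def
  proof (intro conjI allI impI)
    have q: "p < q" "c q m = c p m" "\<And>r. p < r \<Longrightarrow> r < q \<Longrightarrow> c r m \<noteq> c p m"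
      using step.hyps(1) by (auto simp: nxt_def)
    show "p' < p' + (q - p)" using q(1) by simp
    show "c (p' + (q - p)) m = c p' m"
      using loc[OF step.prems, of "q - p" m] q le by simp
    fix r assume r: "p' < r \<and> r < p' + (q - p)"
    define i where "i = r - p'"
    have i: "r = p' + i" "0 < i" "i < q - p" using r by (auto simp: i_def)
    have "c (p + i) m \<noteq> c p m" using i q(3)[of "p + i"] by simp
    then show "c r m \<noteq> c p' m"
      using loc[OF step.prems, of i m] i le by simp
  qed
  then show ?case using step.IH[OF step.prems] chain.step[of c p' m] by auto
qed (rule chain.refl)

lemma privileged_fac_step:
  assumes "nxt (fac s) p m q" and "privileged (fac s p m)"
  shows "privileged (fac s p (q - p + m))"
proof (cases "m = 0")
  \<comment> \<open>Borders are nonempty, so the step from the empty word to a letter falls under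
    the rule for short words.\<close>
  case True
  have "q = Suc p"
  proof (rule ccontr)
    assume "q \<noteq> Suc p"
    then have "p < Suc p \<and> Suc p < q" using assms(1) by (auto simp: nxt_def)
    then show False using assms(1) True by (auto simp: nxt_def)
  qed
  then show ?thesis using True by (intro privileged.short) simp
next
  case False
  let ?w = "fac s p m" and ?n = "q - p + m"
  have q: "p < q" "fac s q m = fac s p m" "\<And>r. p < r \<Longrightarrow> r < q \<Longrightarrow> fac s r m \<noteq> fac s p m"
    using assms(1) by (auto simp: nxt_def)
  have "border ?w (fac s p ?n)"
    unfolding border_def
  proof (intro conjI)
    show "?w \<noteq> []" using False by (metis length_fac list.size(3))
    show "prefix ?w (fac s p ?n)" by (simp add: prefix_fac_iff)
    have "fac s p ?n = fac s p (q - p) @ fac s q m" using q(1) fac_add[of s p "q - p" m] by simp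
    then show "suffix ?w (fac s p ?n)" using q(2) by (simp add: suffix_def)
  qed
  \<comment> \<open>As \<open>q\<close> is the next occurrence, the old factor occurs in the new one
    exactly at the two ends.\<close>
  moreover have "{i. i + m \<le> ?n \<and> take m (drop i (fac s p ?n)) = ?w} = {0, q - p}"
  proof (intro set_eqI)
    fix i
    have "take m (drop i (fac s p ?n)) = fac s (p + i) m" if "i \<le> q - p"
      using that by (auto simp: drop_fac take_fac intro!: arg_cong[where f = "fac s (p + i)"])
    then have "i \<in> {i. i + m \<le> ?n \<and> take m (drop i (fac s p ?n)) = ?w}
        \<longleftrightarrow> i \<le> q - p \<and> fac s (p + i) m = fac s p m" by auto
    also have "\<dots> \<longleftrightarrow> i \<in> {0, q - p}"
    proof (cases "0 < i \<and> i < q - p")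
      case True
      then have "p < p + i" "p + i < q" by linarith+
      then show ?thesis using q(3)[of "p + i"] True by simp
    next
      case False
      then show ?thesis using q(1,2) by auto
    qed
    finally show "i \<in> {i. i + m \<le> ?n \<and> take m (drop i (fac s p ?n)) = ?w} \<longleftrightarrow> i \<in> {0, q - p}" .
  qed
  then have "occurrences (fac s p ?n) ?w = 2"
    using q(1) by (simp add: occurrences_def)
  ultimately show ?thesis using assms(2) by (rule privileged.border)
qed

lemma chain_append:
  assumes "chain c p l m" "nxt c p m q"
  shows "chain c p l (q - p + m)"
  using assms chain_trans chain.step chain.refl by metis

text \<open>A border with exactly two occurrences is a prefix whose next occurrence is the final
  one, so the nested privileged borders are the members of the chain. Conversely each step of the
  chain is a complete return.\<close>

lemma privileged_iff_chain: "privileged (fac s p n) \<longleftrightarrow> chain (fac s) p 0 n"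
proof
  show "chain (fac s) p 0 n" if "privileged (fac s p n)"
    using that
  proof (induction "fac s p n" arbitrary: n rule: privileged.induct)
    case short
    have "nxt (fac s) p 0 (Suc p)" by (simp add: nxt_def)
    from chain_append[OF chain.refl this] have "chain (fac s) p 0 1" by simp
    moreover have "n = 0 \<or> n = 1" using short by auto
    ultimately show ?case using chain.refl by auto
  next
    case (border w)
    define m where "m = length w"
    define occ where "occ = {i. i + m \<le> n \<and> fac s (p + i) m = w}"
    have pre: "m \<le> n" "w = fac s p m"
      using border.hyps(1) by (auto simp: border_def m_def prefix_fac_iff)
    have "take m (drop i (fac s p n)) = fac s (p + i) m" if "i + m \<le> n" for i
    proof -
      have "min m (n - i) = m" using that by simp
      then show ?thesis by (simp add: drop_fac take_fac)
    qed
    then have "{i. i + length w \<le> length (fac s p n) \<and> take (length w) (drop i (fac s p n)) = w} = occ"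
      by (auto simp: occ_def m_def)
    then have card: "card occ = 2" using border.hyps(2) by (simp add: occurrences_def)
    have suf: "fac s (p + (n - m)) m = w"
    proof -
      obtain zs where zs: "fac s p n = zs @ w"
        using border.hyps(1) by (auto simp: border_def suffix_def)
      then have "length zs = n - m" using length_fac[of s p n] by (simp add: m_def)
      then have "w = drop (n - m) (fac s p n)" using zs by simp
      then show ?thesis using pre by (simp add: drop_fac)
    qed
    have "0 \<in> occ" "n - m \<in> occ" using pre suf by (auto simp: occ_def)
    \<comment> \<open>The trivial border would occur only once.\<close>
    have "n - m \<noteq> 0"
    proof
      assume "n - m = 0"
      then have "occ \<subseteq> {0}" by (auto simp: occ_def)
      then have "card occ \<le> card {0::nat}" by (intro card_mono) auto
      then show False using card by simp
    qed
    have occ: "occ = {0, n - m}"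
    proof (rule card_subset_eq[symmetric])
      show "finite occ" using card by (intro card_ge_0_finite) simp
      show "{0, n - m} \<subseteq> occ" using \<open>0 \<in> occ\<close> \<open>n - m \<in> occ\<close> by simp
      show "card {0, n - m} = card occ" using card \<open>n - m \<noteq> 0\<close> by simp
    qed
    have "nxt (fac s) p m (p + (n - m))"
      unfolding nxt_def
    proof (intro conjI allI impI)
      show "p < p + (n - m)" using \<open>n - m \<noteq> 0\<close> by simp
      show "fac s (p + (n - m)) m = fac s p m" using suf pre(2) by simp
      fix r assume r: "p < r \<and> r < p + (n - m)"
      define i where "i = r - p"
      have i: "r = p + i" "0 < i" "i < n - m" using r by (auto simp: i_def)
      then have "i \<notin> occ" unfolding occ by simp
      then show "fac s r m \<noteq> fac s p m" using i pre(2) by (simp add: occ_def)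
    qed
    from chain_append[OF border.hyps(4)[OF pre(2)] this] show ?case using pre(1) by simp
  qed
next
  have "privileged (fac s p n)" if "chain (fac s) p m n" "privileged (fac s p m)" for m
    using that
  proof (induction rule: chain.induct)
    case (step m q n)
    then show ?case using privileged_fac_step by blast
  qed
  moreover have "privileged (fac s p 0)" by (rule privileged.short) simp
  moreover assume "chain (fac s) p 0 n"
  ultimately show "privileged (fac s p n)" by blast
qed

section \<open>Computing complete returns\<close>

type_synonym cls = "bool \<times> bool list"

text \<open>A right-hand side of the system of equations: a path is the list of the offsets \<open>e \<in> {0, 1, 2}\<close> met
  while a class is desubstituted to a base class, and the flags at its end tell which colours of base
  classes are reached; base classes of the same colour have the same set of lengths.\<close>

datatype trie = Leaf | Node "bool list" trie trie trie

fun orl :: "bool list \<Rightarrow> bool list \<Rightarrow> bool list" where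
  "orl (x # xs) (y # ys) = (x \<or> y) # orl xs ys"
| "orl [] ys = ys"
| "orl xs [] = xs"

fun unt :: "trie \<Rightarrow> trie \<Rightarrow> trie" where
  "unt (Node f t u v) (Node g t' u' v') = Node (orl f g) (unt t t') (unt u u') (unt v v')"
| "unt Leaf t = t"
| "unt t Leaf = t"

type_synonym sys = "bool list \<times> trie"

text \<open>\<open>None\<close> is failure of the search and is propagated, so a computed
  \<open>Some\<close> certifies that every branch succeeded.\<close>

fun uno :: "sys option \<Rightarrow> sys option \<Rightarrow> sys option" where
  "uno (Some (a, t)) (Some (b, u)) = Some (orl a b, unt t u)"
| "uno _ _ = None"

text \<open>The characteristic list of the one-element set containing the length of
  \<open>w\<close>.\<close>

definition unary :: "'a list \<Rightarrow> bool list" where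
  "unary w = map (\<lambda>_. False) w @ [True]"

fun evens :: "'a list \<Rightarrow> 'a list" where
  "evens (x # y # w) = x # evens w"
| "evens [x] = [x]"
| "evens [] = []"

fun even_length :: "'a list \<Rightarrow> bool" where
  "even_length [] = True"
| "even_length (x # xs) = (\<not> even_length xs)"

definition branch :: "nat \<Rightarrow> trie \<Rightarrow> trie" where
  "branch e t = (if e = 0 then Node [] t Leaf Leaf else if e = 1 then Node [] Leaf t Leaf else Node [] Leaf Leaf t)"

text \<open>The solution \<open>e\<close> of \<open>m + e + of_bool off = 2 * m' + 1\<close>, where
  \<open>m\<close> is the length of \<open>w\<close> and \<open>m'\<close> that of its
  preimage.\<close>

definition shift :: "bool \<Rightarrow> bool \<Rightarrow> 'a list \<Rightarrow> nat" where
  "shift off a w = of_bool a + of_bool (even_length w = (a = off))"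

text \<open>Classes shorter than \<open>K\<close> are base classes and end the path with their
  colour. An uncoloured base class or exhausted fuel gives \<open>None\<close>.\<close>

fun desc :: "nat \<Rightarrow> bool \<Rightarrow> nat \<Rightarrow> (cls \<Rightarrow> bool \<times> cls) \<Rightarrow> (cls \<times> nat) list \<Rightarrow> cls \<Rightarrow> trie option" where
  "desc 0 off K con col c = None"
| "desc (Suc k) off K con col c =
    (if length (snd c) < K
     then map_option (\<lambda>i. Node (replicate i False @ [True]) Leaf Leaf Leaf) (map_of col c)
     else case con c of (a, c') \<Rightarrow> map_option (branch (shift off a (snd c))) (desc k off K con col c'))"

datatype wtree = Empty | End | Branch wtree wtree

fun nonempty :: "wtree \<Rightarrow> bool" where
  "nonempty Empty = False"
| "nonempty End = True"
| "nonempty (Branch t u) = (nonempty t \<or> nonempty u)"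

fun ins :: "bool list \<Rightarrow> wtree \<Rightarrow> wtree" where
  "ins [] t = End"
| "ins (x # w) (Branch t u) = (if x then Branch t (ins w u) else Branch (ins w t) u)"
| "ins (x # w) t = (if x then Branch Empty (ins w Empty) else Branch (ins w Empty) Empty)"

fun pre :: "bool list \<Rightarrow> bool list \<Rightarrow> bool" where
  "pre [] ys = True"
| "pre (x # xs) [] = False"
| "pre (x # xs) (y # ys) = (if x = y then pre xs ys else False)"

text \<open>The components of \<open>Scan\<close>: the letters of the start word still to be read, the reversed current member
  of the chain, the reversed text read so far, whether an even number of letters was read since the last
  occurrence, and the lengths found so far.\<close>

datatype scan_state = Dead | Scan "bool list" "bool list" "bool list" bool "bool list"

fun final :: "nat \<Rightarrow> scan_state \<Rightarrow> bool" where
  "final th Dead = True"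
| "final th (Scan need ru rP c cs) = (need = [] \<and> th \<le> length ru)"

text \<open>With both lists reversed, testing for a suffix of the text becomes testing for a prefix.
  If \<open>c\<close> holds, the occurrence that would end with the new letter starts at odd
  distance from the start, which \<open>par\<close> forbids. Only members shorter than
  \<open>th\<close> are recorded; a longer one ends the scan.\<close>

fun adv :: "bool \<Rightarrow> nat \<Rightarrow> scan_state \<Rightarrow> bool \<Rightarrow> scan_state" where
  "adv par th Dead x = Dead"
| "adv par th (Scan (y # ys) ru rP c cs) x = (if x = y then Scan ys ru (x # rP) c cs else Dead)"
| "adv par th (Scan [] ru rP c cs) x =
    (if if par \<and> c then False else pre ru (x # rP)
     then Scan [] (x # rP) (x # rP) True (if length (x # rP) < th then orl cs (unary (x # rP)) else cs)
     else Scan [] ru (x # rP) (\<not> c) cs)"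

fun eat :: "bool \<Rightarrow> nat \<Rightarrow> scan_state \<Rightarrow> bool list \<Rightarrow> scan_state" where
  "eat par th st [] = st"
| "eat par th st (x # xs) = (if final th st then st else eat par th (adv par th st x) xs)"

fun result :: "(bool list \<Rightarrow> trie option) \<Rightarrow> scan_state \<Rightarrow> sys option" where
  "result fin Dead = Some ([], Leaf)"
| "result fin (Scan need ru rP c cs) = map_option (Pair cs) (fin (rev ru))"

text \<open>Common prefixes of the windows are scanned once. A scan that becomes final early gives
  its result for all windows below, provided there are any; a window that ends too early is a
  failure.\<close>

fun walk :: "bool \<Rightarrow> nat \<Rightarrow> (bool \<Rightarrow> bool \<Rightarrow> bool list) \<Rightarrow> (bool list \<Rightarrow> trie option) \<Rightarrow>
    scan_state \<Rightarrow> bool \<Rightarrow> wtree \<Rightarrow> sys option" where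
  "walk par th blk fin st a Empty = Some ([], Leaf)"
| "walk par th blk fin st a End = (if final th st then result fin st else None)"
| "walk par th blk fin st a (Branch t u) =
    (if final th st then if nonempty t \<or> nonempty u then result fin st else Some ([], Leaf)
     else uno (walk par th blk fin (eat par th st (blk a False)) (\<not> a) t)
              (walk par th blk fin (eat par th st (blk a True)) (\<not> a) u))"

text \<open>A position is a block index together with a residue \<open>r\<close> modulo 8, hence the
  first \<open>r\<close> letters of the first block are dropped.\<close>

fun walk_from :: "nat \<Rightarrow> bool \<Rightarrow> nat \<Rightarrow> (bool \<Rightarrow> bool \<Rightarrow> bool list) \<Rightarrow> (bool list \<Rightarrow> trie option) \<Rightarrow>
    bool list \<Rightarrow> bool \<Rightarrow> wtree \<Rightarrow> sys option" where
  "walk_from r par th blk fin k a Empty = Some ([], Leaf)"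
| "walk_from r par th blk fin k a End = None"
| "walk_from r par th blk fin k a (Branch t u) =
     uno (walk par th blk fin (eat par th (Scan k (rev k) [] True (unary k)) (drop r (blk a False))) (\<not> a) t)
         (walk par th blk fin (eat par th (Scan k (rev k) [] True (unary k)) (drop r (blk a True))) (\<not> a) u)"

text \<open>\<open>par0\<close> says whether the chain compares parities, \<open>par\<close> whether
  the class passed to \<open>fin\<close> records one. They may differ only in the initial scan from
  the empty word.\<close>

definition scan :: "bool \<Rightarrow> nat \<Rightarrow> (bool \<Rightarrow> bool \<Rightarrow> bool list) \<Rightarrow> (cls \<Rightarrow> trie option) \<Rightarrow>
    (bool \<Rightarrow> wtree) \<Rightarrow> bool \<Rightarrow> cls \<Rightarrow> sys option" where
  "scan par0 th blk fin T par k =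
    foldr (\<lambda>r. if par0 \<and> odd r \<noteq> fst k then id else
       uno (uno (walk_from r par0 th blk (\<lambda>v. fin (par \<and> odd r, v)) (snd k) False (T False))
                (walk_from r par0 th blk (\<lambda>v. fin (par \<and> odd r, v)) (snd k) True (T True))))
      [0..<8] (Some ([], Leaf))"

fun blocks :: "(bool \<Rightarrow> bool \<Rightarrow> bool list) \<Rightarrow> bool \<Rightarrow> bool list \<Rightarrow> bool list" where
  "blocks blk a [] = []"
| "blocks blk a (x # xs) = blk a x @ blocks blk (\<not> a) xs"

text \<open>The position \<open>8 * P + r\<close> has the parity of \<open>r\<close>, and its factor
  is read off the block image of the factor at \<open>P\<close>.\<close>

definition up :: "(bool \<Rightarrow> bool \<Rightarrow> bool list) \<Rightarrow> nat \<Rightarrow> bool \<Rightarrow> (bool \<Rightarrow> bool list list) \<Rightarrow> bool list list" where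
  "up blk n b L = concat (map (\<lambda>a. concat (map (\<lambda>xs. map (\<lambda>r. take n (drop r (blocks blk a xs)))
      (if b then [1, 3, 5, 7] else [0, 2, 4, 6])) (L a))) [False, True])"

definition tree :: "bool list list \<Rightarrow> wtree" where
  "tree ws = foldr ins ws Empty"

section \<open>Semantics of characteristic lists, tries and word trees\<close>

lemma pre_iff_prefix: "pre xs ys \<longleftrightarrow> prefix xs ys"
  by (induction xs ys rule: pre.induct) auto

lemma even_length_iff: "even_length xs \<longleftrightarrow> even (length xs)"
  by (induction xs) auto

definition cmem :: "bool list \<Rightarrow> nat \<Rightarrow> bool" where
  "cmem cs n \<longleftrightarrow> n < length cs \<and> cs ! n"

lemma cmem_Nil [simp]: "\<not> cmem [] n"
  by (simp add: cmem_def)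

lemma cmem_Cons: "cmem (x # xs) n \<longleftrightarrow> (case n of 0 \<Rightarrow> x | Suc m \<Rightarrow> cmem xs m)"
  by (auto simp: cmem_def split: nat.split)

lemma cmem_orl [simp]: "cmem (orl a b) n \<longleftrightarrow> cmem a n \<or> cmem b n"
  by (induction a b arbitrary: n rule: orl.induct) (auto simp: cmem_Cons split: nat.split)

lemma cmem_unary [simp]: "cmem (unary w) n \<longleftrightarrow> n = length w"
  by (auto simp: cmem_def unary_def nth_append less_Suc_eq)

lemma cmem_replicate [simp]: "cmem (replicate i False @ [True]) n \<longleftrightarrow> n = i"
  by (auto simp: cmem_def nth_append less_Suc_eq)

text \<open>The lengths whose counterpart \<open>y\<close> one level of desubstitution up lies in
  \<open>A\<close>.\<close>

definition halves :: "bool \<Rightarrow> nat \<Rightarrow> (nat \<Rightarrow> bool) \<Rightarrow> nat \<Rightarrow> bool" where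
  "halves off e A n \<longleftrightarrow> (\<exists>y. n + e + of_bool off = 2 * y + 1 \<and> A y)"

primrec tsem :: "bool \<Rightarrow> (nat \<Rightarrow> nat \<Rightarrow> bool) \<Rightarrow> trie \<Rightarrow> nat \<Rightarrow> bool" where
  "tsem off M Leaf = (\<lambda>n. False)"
| "tsem off M (Node f t u v) = (\<lambda>n. (\<exists>c. cmem f c \<and> M c n) \<or> halves off 0 (tsem off M t) n \<or>
     halves off 1 (tsem off M u) n \<or> halves off 2 (tsem off M v) n)"

lemma halves_False [simp]: "\<not> halves off e (\<lambda>n. False) n"
  by (simp add: halves_def)

lemma halves_disj: "halves off e (\<lambda>n. A n \<or> B n) n \<longleftrightarrow> halves off e A n \<or> halves off e B n"
  by (auto simp: halves_def)

lemma tsem_unt [simp]: "tsem off M (unt t u) = (\<lambda>n. tsem off M t n \<or> tsem off M u n)"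
  by (induction t u rule: unt.induct) (auto simp: halves_disj intro!: ext)

lemma tsem_branch: "e \<le> 2 \<Longrightarrow> tsem off M (branch e t) = halves off e (tsem off M t)"
  by (auto simp: branch_def fun_eq_iff le_Suc_eq numeral_2_eq_2)

lemma tsem_mono: "(\<And>c n. M c n \<Longrightarrow> M' c n) \<Longrightarrow> tsem off M t n \<Longrightarrow> tsem off M' t n"
  by (induction t arbitrary: n) (auto simp: halves_def)

definition ssem :: "bool \<Rightarrow> (nat \<Rightarrow> nat \<Rightarrow> bool) \<Rightarrow> sys \<Rightarrow> nat \<Rightarrow> bool" where
  "ssem off M s n \<longleftrightarrow> cmem (fst s) n \<or> tsem off M (snd s) n"

lemma ssem_empty [simp]: "\<not> ssem off M ([], Leaf) n"
  by (simp add: ssem_def)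

definition osem :: "bool \<Rightarrow> (nat \<Rightarrow> nat \<Rightarrow> bool) \<Rightarrow> sys option \<Rightarrow> nat \<Rightarrow> bool" where
  "osem off M s n \<longleftrightarrow> (\<exists>x. s = Some x \<and> ssem off M x n)"

lemma osem_Some [simp]: "osem off M (Some x) n \<longleftrightarrow> ssem off M x n"
  by (simp add: osem_def)

lemma uno_eq_Some:
  "uno a b = Some r \<Longrightarrow> a \<noteq> None \<and> b \<noteq> None \<and> (\<forall>n. ssem off M r n \<longleftrightarrow> osem off M a n \<or> osem off M b n)"
  by (cases "(a, b)" rule: uno.cases) (auto simp: ssem_def)

lemma uno_SomeE:
  assumes "uno a b = Some r"
  obtains x y where "a = Some x" "b = Some y" "\<forall>n. ssem off M r n \<longleftrightarrow> ssem off M x n \<or> ssem off M y n"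
  using uno_eq_Some[OF assms, of off M] by force

primrec words :: "wtree \<Rightarrow> bool list set" where
  "words Empty = {}"
| "words End = {[]}"
| "words (Branch t u) = (#) False ` words t \<union> (#) True ` words u"

lemma nonempty_iff: "nonempty t \<longleftrightarrow> words t \<noteq> {}"
  by (induction t) auto

text \<open>Insertion overwrites stored proper prefixes and extensions of \<open>w\<close>, hence
  the common length.\<close>

lemma words_ins: "\<forall>v\<in>words t. length v = length w \<Longrightarrow> words (ins w t) = insert w (words t)"
proof (induction w t rule: ins.induct)
  case (1 t)
  then show ?case by auto
next
  case (2 x w t u)
  have len: "\<forall>v\<in>words t. length v = length w" "\<forall>v\<in>words u. length v = length w"
    using "2.prems" by (simp_all add: ball_Un)
  show ?case
  proof (cases x)
    case True
    have "words (ins w u) = insert w (words u)" by (rule "2.IH"(1)[OF True len(2)])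
    then show ?thesis using True by auto
  next
    case False
    have "words (ins w t) = insert w (words t)" by (rule "2.IH"(2)[OF False len(1)])
    then show ?thesis using False by auto
  qed
next
  case ("3_1" x w)
  have "words (ins w Empty) = {w}" using "3_1.IH" by (cases x) simp_all
  then show ?case by simp
next
  case ("3_2" x w)
  then show ?case by simp
qed

lemma words_tree: "(\<And>w. w \<in> set ws \<Longrightarrow> length w = n) \<Longrightarrow> words (tree ws) = set ws"
  unfolding tree_def by (induction ws) (auto simp: words_ins)

lemma eat_final: "final th st \<Longrightarrow> eat par th st xs = st"
  by (cases xs) auto

lemma eat_append: "eat par th st (xs @ ys) = eat par th (eat par th st xs) ys"
  by (induction xs arbitrary: st) (auto simp: eat_final)

text \<open>\<open>eat\<close> ignores letters once the state is final, so a result taken at an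
  inner node is the result for each word below it.\<close>

lemma walk_correct:
  "walk par th blk fin st a T = Some r \<Longrightarrow>
    (\<forall>xs\<in>words T. final th (eat par th st (blocks blk a xs)) \<and> result fin (eat par th st (blocks blk a xs)) \<noteq> None) \<and>
    (\<forall>n. ssem off M r n \<longleftrightarrow> (\<exists>xs\<in>words T. osem off M (result fin (eat par th st (blocks blk a xs))) n))"
proof (induction T arbitrary: st a r)
  case Empty
  then show ?case by auto
next
  case End
  then show ?case by (auto split: if_splits)
next
  case (Branch t u)
  show ?case
  proof (cases "final th st")
    case True
    then show ?thesis using Branch.prems
      by (auto simp: eat_final nonempty_iff split: if_splits)
  next
    case False
    then have "uno (walk par th blk fin (eat par th st (blk a False)) (\<not> a) t)
        (walk par th blk fin (eat par th st (blk a True)) (\<not> a) u) = Some r"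
      using Branch.prems by simp
    then obtain r1 r2 where
      r: "walk par th blk fin (eat par th st (blk a False)) (\<not> a) t = Some r1"
         "walk par th blk fin (eat par th st (blk a True)) (\<not> a) u = Some r2"
         "\<forall>n. ssem off M r n \<longleftrightarrow> ssem off M r1 n \<or> ssem off M r2 n"
      by (rule uno_SomeE)
    have st: "eat par th st (blocks blk a (x # xs)) = eat par th (eat par th st (blk a x)) (blocks blk (\<not> a) xs)"
      for x xs by (simp add: eat_append)
    show ?thesis
      unfolding words.simps ball_Un bex_Un ball_simps bex_simps st
      using Branch.IH(1)[OF r(1)] Branch.IH(2)[OF r(2)] r(3) by blast
  qed
qed

lemma walk_from_correct:
  assumes "walk_from r par th blk fin k a T = Some s" "\<And>x. r \<le> length (blk a x)"
  defines "st \<equiv> \<lambda>xs. eat par th (Scan k (rev k) [] True (unary k)) (drop r (blocks blk a xs))"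
  shows "(\<forall>xs\<in>words T. final th (st xs) \<and> result fin (st xs) \<noteq> None) \<and>
    (\<forall>n. ssem off M s n \<longleftrightarrow> (\<exists>xs\<in>words T. osem off M (result fin (st xs)) n))"
proof (cases T)
  case (Branch t u)
  have st: "st (x # xs) = eat par th (eat par th (Scan k (rev k) [] True (unary k)) (drop r (blk a x)))
      (blocks blk (\<not> a) xs)" for x xs
    using assms(2)[of x] by (simp add: st_def eat_append)
  from assms(1)[unfolded Branch walk_from.simps] obtain r1 r2 where
    r: "walk par th blk fin (eat par th (Scan k (rev k) [] True (unary k)) (drop r (blk a False))) (\<not> a) t = Some r1"
       "walk par th blk fin (eat par th (Scan k (rev k) [] True (unary k)) (drop r (blk a True))) (\<not> a) u = Some r2"
       "\<forall>n. ssem off M s n \<longleftrightarrow> ssem off M r1 n \<or> ssem off M r2 n"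
    by (rule uno_SomeE)
  show ?thesis
    unfolding Branch words.simps ball_Un bex_Un ball_simps bex_simps st
    using walk_correct[OF r(1), of off M] walk_correct[OF r(2), of off M] r(3) by blast
qed (use assms(1) in auto)

lemma foldr_uno_correct:
  assumes "foldr (\<lambda>r. if skip r then id else uno (g r)) rs (Some ([], Leaf)) = Some s"
  shows "(\<forall>r\<in>set rs. \<not> skip r \<longrightarrow> g r \<noteq> None) \<and>
    (\<forall>n. ssem off M s n \<longleftrightarrow> (\<exists>r\<in>set rs. \<not> skip r \<and> osem off M (g r) n))"
  using assms
proof (induction rs arbitrary: s)
  case (Cons r rs)
  show ?case
  proof (cases "skip r")
    case True
    then show ?thesis using Cons by auto
  next
    case False
    then have "uno (g r) (foldr (\<lambda>r. if skip r then id else uno (g r)) rs (Some ([], Leaf))) = Some s"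
      using Cons.prems by simp
    then obtain x s' where "g r = Some x"
      and s': "foldr (\<lambda>r. if skip r then id else uno (g r)) rs (Some ([], Leaf)) = Some s'"
      and "\<forall>n. ssem off M s n \<longleftrightarrow> ssem off M x n \<or> ssem off M s' n"
      by (rule uno_SomeE)
    then show ?thesis using Cons.IH[OF s'] False by auto
  qed
qed simp

section \<open>Classes of factors\<close>

definition cl :: "bool \<Rightarrow> (nat \<Rightarrow> bool) \<Rightarrow> nat \<Rightarrow> nat \<Rightarrow> cls" where
  "cl par s p m = (par \<and> odd p, fac s p m)"

lemma cl_eq_iff: "cl par s p m = cl par s q n \<longleftrightarrow> fac s p m = fac s q n \<and> (par \<longrightarrow> odd p = odd q)"
  by (auto simp: cl_def)

lemma snd_cl [simp]: "snd (cl par s p m) = fac s p m"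
  by (simp add: cl_def)

text \<open>\<open>j\<close> letters are read and \<open>m\<close> is the current member. The chain
  from \<open>k\<close> splits into the recorded lengths and the chain from \<open>m\<close>; a
  member below \<open>th\<close> is already recorded, so moving past it loses nothing.\<close>

fun scan_inv :: "bool \<Rightarrow> nat \<Rightarrow> (nat \<Rightarrow> bool) \<Rightarrow> nat \<Rightarrow> bool list \<Rightarrow> scan_state \<Rightarrow> nat \<Rightarrow> bool" where
  "scan_inv par th s p k Dead j \<longleftrightarrow> fac s p (length k) \<noteq> k"
| "scan_inv par th s p k (Scan need ru rP c cs) j \<longleftrightarrow> rP = rev (fac s p j) \<and>
    (if need \<noteq> [] then k = fac s p j @ need \<and> ru = rev k \<and> c \<and> cs = unary k
     else fac s p (length k) = k \<and> (\<exists>m\<le>j. ru = rev (fac s p m) \<and> c = even (j - m) \<and>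
       (\<forall>q. p < q \<and> q + m \<le> p + j \<longrightarrow> cl par s q m \<noteq> cl par s p m) \<and>
       (\<forall>n. chain (cl par s) p (length k) n \<longleftrightarrow> cmem cs n \<or> chain (cl par s) p m n) \<and>
       (m < th \<longrightarrow> cmem cs m)))"

lemma scan_inv_init: "scan_inv par th s p k (Scan k (rev k) [] True (unary k)) 0"
  by (auto intro: chain.refl)

lemma fac_snoc: "fac s p (Suc j) = fac s p j @ [s (p + j)]"
  by (simp add: fac_def)

lemma pre_rev_fac:
  assumes "m \<le> j"
  shows "pre (rev (fac s p m)) (rev (fac s p j)) \<longleftrightarrow> fac s (p + (j - m)) m = fac s p m"
proof -
  have "fac s p j = fac s p (j - m) @ fac s (p + (j - m)) m"
    using fac_add[of s p "j - m" m] assms by simp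
  then have "pre (rev (fac s p m)) (rev (fac s p j)) \<longleftrightarrow>
      prefix (rev (fac s p m)) (rev (fac s (p + (j - m)) m) @ rev (fac s p (j - m)))"
    by (simp add: pre_iff_prefix)
  also have "\<dots> \<longleftrightarrow> rev (fac s p m) = rev (fac s (p + (j - m)) m)"
    by (auto simp: prefix_def append_eq_append_conv)
  finally show ?thesis by auto
qed

lemma scan_inv_adv:
  assumes "scan_inv par th s p k st j" "\<not> final th st"
  shows "scan_inv par th s p k (adv par th st (s (p + j))) (Suc j)"
proof (cases st)
  case Dead
  then show ?thesis using assms by simp
next
  case st: (Scan need ru rP c cs)
  have rP: "rP = rev (fac s p j)" using assms st by simp
  then have rP': "s (p + j) # rP = rev (fac s p (Suc j))" by (simp add: fac_snoc)
  show ?thesis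
  proof (cases need)
    case need: (Cons y ys)
    then have k: "k = fac s p j @ y # ys" "ru = rev k" c "cs = unary k"
      using assms st by (auto split: if_splits)
    show ?thesis
    proof (cases "s (p + j) = y")
      case True
      show ?thesis
      proof (cases ys)
        case Nil
        then have "k = fac s p (Suc j)" using k(1) True by (simp add: fac_snoc)
        then show ?thesis using st need Nil True k rP' by (auto intro: chain.refl)
      next
        case (Cons z zs)
        then show ?thesis using st need True k rP' by (simp add: fac_snoc)
      qed
    next
      case False
      have "fac s p (length k) \<noteq> k"
      proof
        assume "fac s p (length k) = k"
        then have "fac s p (length k) ! j = k ! j" by simp
        moreover have "j < length k" "k ! j = y" using k(1) by (simp_all add: nth_append)
        ultimately show False using False by simp
      qed
      then show ?thesis using st need False by simp
    qed
  next
    case need: Nil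
    from assms(1) obtain m where m: "m \<le> j" "ru = rev (fac s p m)" "c = even (j - m)"
      "\<And>q. p < q \<Longrightarrow> q + m \<le> p + j \<Longrightarrow> cl par s q m \<noteq> cl par s p m"
      "\<And>n. chain (cl par s) p (length k) n \<longleftrightarrow> cmem cs n \<or> chain (cl par s) p m n"
      "m < th \<longrightarrow> cmem cs m" "fac s p (length k) = k"
      unfolding st need scan_inv.simps by (simp only: list.simps if_False not_True_eq_False simp_thms) blast
    have "m < th" using assms(2) st need m(2) by simp
    \<comment> \<open>The only position at which an occurrence of length \<open>m\<close> would end
      with the letter just read.\<close>
    define q where "q = p + (Suc j - m)"
    have q: "p < q" "q - p + m = Suc j" using m(1) by (auto simp: q_def)
    have before: "cl par s r m \<noteq> cl par s p m" if "p < r" "r < q" for r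
      using m(4)[of r] that m(1) by (auto simp: q_def)
    have hit: "(if par \<and> c then False else pre ru (s (p + j) # rP)) \<longleftrightarrow> cl par s q m = cl par s p m"
    proof -
      have "odd q = odd p \<longleftrightarrow> \<not> c"
        using m(1,3) by (auto simp: q_def Suc_diff_le)
      moreover have "pre ru (s (p + j) # rP) \<longleftrightarrow> fac s q m = fac s p m"
        unfolding rP' m(2) q_def using m(1) by (intro pre_rev_fac) simp
      ultimately show ?thesis by (auto simp: cl_eq_iff)
    qed
    show ?thesis
    proof (cases "cl par s q m = cl par s p m")
      case True
      then have "nxt (cl par s) p m q" using q before by (auto simp: nxt_def)
      from chain_unfold[OF this] have ch: "chain (cl par s) p m n \<longleftrightarrow> n = m \<or> chain (cl par s) p (Suc j) n" for n
        by (simp add: q(2))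
      have ch': "chain (cl par s) p (length k) n \<longleftrightarrow> cmem cs n \<or> chain (cl par s) p (Suc j) n" for n
        using m(5,6) ch \<open>m < th\<close> by auto
      have adv: "adv par th st (s (p + j)) = Scan [] (rev (fac s p (Suc j))) (rev (fac s p (Suc j))) True
          (if Suc j < th then orl cs (unary (rev (fac s p (Suc j)))) else cs)"
      proof -
        have C: "if par \<and> c then False else pre ru (s (p + j) # rP)" using hit True by blast
        show ?thesis
          unfolding st need adv.simps rP' if_P[OF C[unfolded rP']] length_rev length_fac by simp
      qed
      show ?thesis
        unfolding adv using m(7) ch'
        by (auto intro!: exI[of _ "Suc j"] chain.refl)
    next
      case False
      have adv: "adv par th st (s (p + j)) = Scan [] ru (rev (fac s p (Suc j))) (\<not> c) cs"
      proof -
        have C: "\<not> (if par \<and> c then False else pre ru (s (p + j) # rP))" using hit False by blast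
        show ?thesis
          unfolding st need adv.simps rP' if_not_P[OF C[unfolded rP']] by simp
      qed
      have "cl par s r m \<noteq> cl par s p m" if "p < r" "r + m \<le> p + Suc j" for r
        using before[of r] False that m(1) by (cases "r = q") (auto simp: q_def)
      then show ?thesis
        unfolding adv using m by (auto intro!: exI[of _ m] simp: Suc_diff_le)
    qed
  qed
qed

lemma scan_inv_eat:
  "scan_inv par th s p k st j \<Longrightarrow> \<exists>j'. scan_inv par th s p k (eat par th st (fac s (p + j) m)) j'"
proof (induction m arbitrary: st j)
  case (Suc m)
  show ?case
  proof (cases "final th st")
    case False
    then show ?thesis using Suc.IH[OF scan_inv_adv[OF Suc.prems False]] by (simp add: fac_Suc)
  qed (use Suc.prems in \<open>auto simp: eat_final\<close>)
qed auto


text \<open>A chain at \<open>p\<close> only asks which positions have the class of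
  \<open>p\<close>.\<close>

lemma chain_cong_class:
  assumes "\<And>q m. m0 \<le> m \<Longrightarrow> c q m = c p m \<longleftrightarrow> c' q m = c' p m" and "m0 \<le> m"
  shows "chain c p m n \<longleftrightarrow> chain c' p m n"
  using chain_transport[of "\<lambda>q. q" p p m0 c "\<lambda>m. m" c' m n] assms by (auto simp: strict_mono_def)

lemma chain_cl_transfer:
  assumes "chain (cl par s) p m n" and "cl par s p n = cl par s q n"
  shows "chain (cl par s) q m n"
proof (rule chain_transfer[OF _ assms])
  fix m n i
  assume eq: "cl par s p n = cl par s q n" and le: "i + m \<le> n"
  have "fac s p n = fac s q n" using eq by (simp add: cl_eq_iff)
  then have f: "s (p + j) = s (q + j)" if "j < n" for j using that by (simp add: fac_eq_iff)
  have "fac s (p + i) m = fac s (q + i) m" "fac s p m = fac s q m"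
    using f le by (auto simp: fac_eq_iff add.assoc)
  then show "cl par s (p + i) m = cl par s p m \<longleftrightarrow> cl par s (q + i) m = cl par s q m"
    by (auto simp: cl_eq_iff)
qed

lemma cl_eq_mono: "cl par s p n = cl par s q n \<Longrightarrow> m \<le> n \<Longrightarrow> cl par s p m = cl par s q m"
  by (auto simp: cl_eq_iff fac_eq_iff)

lemma blocks_fac:
  assumes "\<And>P. blk (odd P) (s P) = fac s (8 * P) 8"
  shows "blocks blk (odd P) (fac s P D) = fac s (8 * P) (8 * D)"
proof (induction D arbitrary: P)
  case (Suc D)
  have "blocks blk (odd P) (fac s P (Suc D)) = fac s (8 * P) 8 @ blocks blk (odd (Suc P)) (fac s (Suc P) D)"
    by (simp add: fac_Suc assms)
  also have "\<dots> = fac s (8 * P) (8 + 8 * D)"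
    unfolding Suc.IH fac_add by (simp add: algebra_simps)
  finally show ?case by simp
qed simp

definition scan_data :: "(nat \<Rightarrow> bool) \<Rightarrow> bool \<Rightarrow> nat \<Rightarrow> (cls \<Rightarrow> trie option) \<Rightarrow> bool \<Rightarrow> nat \<Rightarrow> nat \<Rightarrow> nat \<Rightarrow> bool list \<Rightarrow> trie \<Rightarrow> bool" where
  "scan_data s par0 th fin par l p m cs t \<longleftrightarrow> th \<le> m \<and> fin (cl par s p m) = Some t \<and>
     (\<forall>n. chain (cl par0 s) p l n \<longleftrightarrow> cmem cs n \<or> chain (cl par0 s) p m n)"

text \<open>The word trees contain the windows of \<open>D\<close> blocks for all positions, so
  success means that at every position with the start word the chain was followed to a member of
  length at least \<open>th\<close>. The first claim says that the result covers each such position,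
  the second that each length in the result comes from one.\<close>

lemma scan_correct:
  assumes scan: "scan par0 th blk fin T par k = Some r"
    and blk: "\<And>P. blk (odd P) (s P) = fac s (8 * P) 8"
    and blk_len: "\<And>a x. length (blk a x) = 8"
    and T: "\<And>a. words (T a) = {fac s P D | P. odd P = a}"
  defines "ok \<equiv> \<lambda>p. (par0 \<longrightarrow> odd p = fst k) \<and> fac s p (length (snd k)) = snd k"
  defines "data \<equiv> scan_data s par0 th fin par (length (snd k))"
  shows "\<And>p. ok p \<Longrightarrow> \<exists>m cs t. data p m cs t \<and> (\<forall>n. cmem cs n \<or> tsem off M t n \<longrightarrow> ssem off M r n)"
    and "\<And>n. ssem off M r n \<Longrightarrow> \<exists>p m cs t. ok p \<and> data p m cs t \<and> (cmem cs n \<or> tsem off M t n)"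
proof -
  define ini where "ini = Scan (snd k) (rev (snd k)) [] True (unary (snd k))"
  define wf where "wf r a = walk_from r par0 th blk (\<lambda>v. fin (par \<and> odd r, v)) (snd k) a (T a)" for r a
  define st where "st p = eat par0 th ini (fac s p (8 * D - p mod 8))" for p
  define res where "res p = result (\<lambda>v. fin (par \<and> odd p, v)) (st p)" for p
  have window: "drop r (blocks blk (odd P) (fac s P D)) = fac s (8 * P + r) (8 * D - r)" if "r < 8" for r P
    using that by (simp add: blocks_fac[OF blk] drop_fac)
  have st_eq: "st (8 * P + r) = eat par0 th ini (drop r (blocks blk (odd P) (fac s P D)))" if "r < 8" for P r
    using that by (simp add: st_def window)
  from scan have "foldr (\<lambda>r. if par0 \<and> odd r \<noteq> fst k then id else uno (uno (wf r False) (wf r True)))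
      [0..<8] (Some ([], Leaf)) = Some r"
    by (simp only: scan_def wf_def)
  from foldr_uno_correct[OF this, of off M]
  have all: "\<forall>r\<in>{0..<8}. \<not> (par0 \<and> odd r \<noteq> fst k) \<longrightarrow> uno (wf r False) (wf r True) \<noteq> None"
    and sem: "\<forall>n. ssem off M r n \<longleftrightarrow> (\<exists>r\<in>{0..<8}. \<not> (par0 \<and> odd r \<noteq> fst k) \<and>
        osem off M (uno (wf r False) (wf r True)) n)"
    unfolding set_upt by blast+
  have octal: "r \<in> {0..<8} \<longleftrightarrow> r < 8" for r :: nat
    by simp
  have wfc: "\<exists>x y. wf r False = Some x \<and> wf r True = Some y \<and>
      (\<forall>n. osem off M (uno (wf r False) (wf r True)) n \<longleftrightarrow> ssem off M x n \<or> ssem off M y n)"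
    if "r < 8" "\<not> (par0 \<and> odd r \<noteq> fst k)" for r
  proof -
    have "uno (wf r False) (wf r True) \<noteq> None" using all that by simp
    then obtain z where z: "uno (wf r False) (wf r True) = Some z" by auto
    then obtain x y where "wf r False = Some x" "wf r True = Some y"
      "\<forall>n. ssem off M z n \<longleftrightarrow> ssem off M x n \<or> ssem off M y n"
      by (rule uno_SomeE)
    then show ?thesis unfolding z osem_Some by blast
  qed
  have wf: "final th (st (8 * P + r)) \<and> res (8 * P + r) \<noteq> None"
    "osem off M (uno (wf r False) (wf r True)) n \<longleftrightarrow> (\<exists>P. osem off M (res (8 * P + r)) n)"
    if r: "r < 8" "\<not> (par0 \<and> odd r \<noteq> fst k)" for r P n
  proof -
    obtain x where x: "\<And>a. wf r a = Some (x a)"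
      and u: "\<And>n. osem off M (uno (wf r False) (wf r True)) n \<longleftrightarrow> ssem off M (x False) n \<or> ssem off M (x True) n"
    proof -
      obtain x y where "wf r False = Some x" "wf r True = Some y"
        "\<forall>n. osem off M (uno (wf r False) (wf r True)) n \<longleftrightarrow> ssem off M x n \<or> ssem off M y n"
        using wfc[OF r] by blast
      then show ?thesis by (intro that[of "\<lambda>a. if a then y else x"]) auto
    qed
    have W: "(\<forall>xs\<in>words (T a). final th (eat par0 th ini (drop r (blocks blk a xs))) \<and>
          result (\<lambda>v. fin (par \<and> odd r, v)) (eat par0 th ini (drop r (blocks blk a xs))) \<noteq> None) \<and>
        (\<forall>n. ssem off M (x a) n \<longleftrightarrow> (\<exists>xs\<in>words (T a).
          osem off M (result (\<lambda>v. fin (par \<and> odd r, v)) (eat par0 th ini (drop r (blocks blk a xs)))) n))" for a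
      unfolding ini_def using x[of a] r(1)
      by (intro walk_from_correct) (simp_all add: wf_def blk_len)
    have res_eq: "res (8 * P + r) = result (\<lambda>v. fin (par \<and> odd r, v))
        (eat par0 th ini (drop r (blocks blk (odd P) (fac s P D))))" for P
      by (simp add: res_def st_eq[OF r(1)])
    have "fac s P D \<in> words (T (odd P))" by (auto simp: T)
    then show "final th (st (8 * P + r)) \<and> res (8 * P + r) \<noteq> None"
      using W[of "odd P"] by (simp add: res_eq st_eq[OF r(1)])
    have "ssem off M (x a) n \<longleftrightarrow> (\<exists>P. odd P = a \<and> osem off M (res (8 * P + r)) n)" for a
    proof -
      have "ssem off M (x a) n \<longleftrightarrow> (\<exists>xs\<in>words (T a).
          osem off M (result (\<lambda>v. fin (par \<and> odd r, v)) (eat par0 th ini (drop r (blocks blk a xs)))) n)"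
        using W[of a] by blast
      then show ?thesis by (auto simp: T res_eq)
    qed
    then show "osem off M (uno (wf r False) (wf r True)) n \<longleftrightarrow> (\<exists>P. osem off M (res (8 * P + r)) n)"
      unfolding u by blast
  qed
  have mod8: "8 * (p div 8) + p mod 8 = p" "p mod 8 < 8" "odd (p mod 8) = odd p" for p :: nat
    by (simp_all add: mod_mod_cancel even_iff_mod_2_eq_zero)
  have cases: "(\<not> ok p \<and> res p = Some ([], Leaf)) \<or> (\<exists>m cs t. ok p \<and> data p m cs t \<and> res p = Some (cs, t))"
    if "\<not> (par0 \<and> odd p \<noteq> fst k)" for p
  proof -
    have fin: "final th (st p)" "res p \<noteq> None"
      using wf(1)[of "p mod 8" "p div 8"] that mod8[of p] by simp_all
    obtain j where inv: "scan_inv par0 th s p (snd k) (st p) j"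
      using scan_inv_eat[OF scan_inv_init, of par0 th s p "snd k" "8 * D - p mod 8"]
      unfolding st_def ini_def by auto
    show ?thesis
    proof (cases "st p")
      case Dead
      then show ?thesis using inv that by (auto simp: res_def ok_def)
    next
      case (Scan need ru rP c cs)
      then have "need = []" "th \<le> length ru" using fin by simp_all
      then obtain m where m: "ru = rev (fac s p m)" "fac s p (length (snd k)) = snd k"
        "\<forall>n. chain (cl par0 s) p (length (snd k)) n \<longleftrightarrow> cmem cs n \<or> chain (cl par0 s) p m n"
        using inv Scan by auto
      obtain t where t: "fin (par \<and> odd p, fac s p m) = Some t"
        using fin(2) Scan m(1) by (auto simp: res_def)
      have "res p = Some (cs, t)" using Scan m(1) t by (simp add: res_def)
      moreover have "data p m cs t"
        using m t \<open>th \<le> length ru\<close> by (simp add: data_def scan_data_def cl_def)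
      ultimately show ?thesis using m(2) that by (auto simp: ok_def)
    qed
  qed
  show "\<exists>m cs t. data p m cs t \<and> (\<forall>n. cmem cs n \<or> tsem off M t n \<longrightarrow> ssem off M r n)" if "ok p" for p
  proof -
    have ns: "\<not> (par0 \<and> odd p \<noteq> fst k)" using that unfolding ok_def by blast
    from cases[OF ns] \<open>ok p\<close> obtain m cs t where d: "data p m cs t" "res p = Some (cs, t)" by auto
    have "ssem off M r n" if "cmem cs n \<or> tsem off M t n" for n
    proof -
      have "osem off M (res (8 * (p div 8) + p mod 8)) n" using d(2) that by (simp add: ssem_def)
      moreover have ns': "\<not> (par0 \<and> odd (p mod 8) \<noteq> fst k)" using ns mod8(3)[of p] by blast
      ultimately have "osem off M (uno (wf (p mod 8) False) (wf (p mod 8) True)) n"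
        unfolding wf(2)[OF mod8(2) ns'] by blast
      then show ?thesis using sem ns' mod8(2)[of p] octal by blast
    qed
    then show ?thesis using d(1) by blast
  qed
  show "\<exists>p m cs t. ok p \<and> data p m cs t \<and> (cmem cs n \<or> tsem off M t n)" if "ssem off M r n" for n
  proof -
    have "\<exists>r\<in>{0..<8}. \<not> (par0 \<and> odd r \<noteq> fst k) \<and> osem off M (uno (wf r False) (wf r True)) n"
      using sem that by blast
    then obtain i where "i \<in> {0..<8}" and i: "\<not> (par0 \<and> odd i \<noteq> fst k)"
      and o: "osem off M (uno (wf i False) (wf i True)) n" by blast
    then have "i < 8" by simp
    from o obtain P where P: "osem off M (res (8 * P + i)) n"
      unfolding wf(2)[OF \<open>i < 8\<close> i] by blast
    have "\<not> (par0 \<and> odd (8 * P + i) \<noteq> fst k)" using i by simp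
    from cases[OF this] show ?thesis
    proof (elim disjE exE conjE)
      assume "res (8 * P + i) = Some ([], Leaf)"
      then show ?thesis using P by simp
    next
      fix m cs t
      assume r: "ok (8 * P + i)" "data (8 * P + i) m cs t" "res (8 * P + i) = Some (cs, t)"
      then have "cmem cs n \<or> tsem off M t n" using P by (simp add: ssem_def)
      then show ?thesis using r(1,2) by blast
    qed
  qed
qed

section \<open>Desubstitution of classes and the system of equations\<close>

lemma double_add_div_2: "(n + 2 * k) div 2 = n div 2 + (k::nat)"
  by simp

lemma shift_le: "shift off a w \<le> 2"
  by (simp add: shift_def)

lemma shift_eq:
  "m + shift off a (fac s p m) + of_bool off = 2 * ((of_bool a + m + of_bool off) div 2) + 1"
proof (cases "even m")
  case True
  then obtain k where "m = 2 * k" by blast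
  then show ?thesis by (cases a; cases off) (simp_all add: shift_def even_length_iff)
next
  case False
  then obtain k where "m = 2 * k + 1" by (rule oddE)
  then show ?thesis by (cases a; cases off) (simp_all add: shift_def even_length_iff)
qed

text \<open>\<open>con\<close> recovers from a long class the parity of its position and the class
  of its preimage; \<open>lift\<close> is the converse. The preimage consists of the letters that
  the window determines: with \<open>off\<close> each letter fixes the one above it, without
  \<open>off\<close> only a letter at an odd position does. The bound on \<open>K\<close> makes
  lengths decrease strictly.\<close>

locale desubstitution =
  fixes s :: "nat \<Rightarrow> bool" and par off :: bool and K :: nat and con :: "cls \<Rightarrow> bool \<times> cls"
  assumes K: "2 + of_bool off \<le> K"
    and con: "K \<le> m \<Longrightarrow> con (cl par s p m) =
      (odd p, cl par s (p div 2) ((of_bool (odd p) + m + of_bool off) div 2))"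
    and lift: "K \<le> m \<Longrightarrow> odd p = odd q \<Longrightarrow>
      cl par s (p div 2) ((of_bool (odd p) + m + of_bool off) div 2) =
      cl par s (q div 2) ((of_bool (odd p) + m + of_bool off) div 2) \<Longrightarrow>
      cl par s p m = cl par s q m"
begin

abbreviation "c \<equiv> cl par s"

text \<open>The position is quantified inside, so an equation relates whole sets of lengths and
  mentions classes only.\<close>

definition L :: "cls \<Rightarrow> nat \<Rightarrow> bool" where
  "L k n \<longleftrightarrow> (\<exists>p. c p (length (snd k)) = k \<and> chain c p (length (snd k)) n)"

text \<open>Occurrences of a long class have positions of one parity and correspond to those of the
  preimage by \<open>con\<close> and \<open>lift\<close>. An advance by \<open>d\<close> above is
  one by \<open>2 * d\<close> below, which gives the map \<open>l\<close> of lengths.\<close>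

lemma chain_halve:
  assumes m: "K \<le> m"
  shows "chain c p m n \<longleftrightarrow>
    halves off (shift off (odd p) (fac s p m)) (chain c (p div 2) ((of_bool (odd p) + m + of_bool off) div 2)) n"
proof -
  define a m' where "a = odd p" and "m' = (of_bool a + m + of_bool off) div 2"
  define l where "l x = m + 2 * (x - m')" for x
  have p: "p = 2 * (p div 2) + of_bool a" by (simp add: a_def)
  have l: "(of_bool a + l x + of_bool off) div 2 = x" if "m' \<le> x" for x
  proof -
    have eq: "of_bool a + l x + of_bool off = (of_bool a + m + of_bool off) + 2 * (x - m')"
      unfolding l_def by linarith
    have "(of_bool a + l x + of_bool off) div 2 = (of_bool a + m + of_bool off) div 2 + (x - m')"
      unfolding eq by (rule double_add_div_2)
    then show ?thesis using that unfolding m'_def by linarith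
  qed
  have *: "chain c p (l m') n \<longleftrightarrow> (\<exists>y. n = l y \<and> chain c (p div 2) m' y)"
  proof (rule chain_transport[where g = "\<lambda>q. 2 * q + of_bool a" and m0 = m'])
    show "strict_mono (\<lambda>q::nat. 2 * q + of_bool a)" by (auto simp: strict_mono_def)
    show "p = 2 * (p div 2) + of_bool a" by (rule p)
    fix x q assume x: "m' \<le> x"
    have lK: "K \<le> l x" using m by (simp add: l_def)
    show "c q (l x) = c p (l x) \<longleftrightarrow> (\<exists>q'. q = 2 * q' + of_bool a \<and> c q' x = c (p div 2) x)"
    proof
      assume eq: "c q (l x) = c p (l x)"
      then have "con (c q (l x)) = con (c p (l x))" by simp
      then have "odd q = a \<and> c (q div 2) x = c (p div 2) x"
        using con[OF lK, of q] con[OF lK, of p] l[OF x] by (auto simp: a_def)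
      then show "\<exists>q'. q = 2 * q' + of_bool a \<and> c q' x = c (p div 2) x"
        by (intro exI[of _ "q div 2"]) auto
    next
      assume "\<exists>q'. q = 2 * q' + of_bool a \<and> c q' x = c (p div 2) x"
      then obtain q' where q': "q = 2 * q' + of_bool a" "c q' x = c (p div 2) x" by blast
      have q: "odd q = odd p" "q div 2 = q'" using q'(1) by (simp_all add: a_def)
      show "c q (l x) = c p (l x)"
        using l[OF x] q'(2) q by (intro lift[OF lK]) (simp_all add: a_def)
    qed
  next
    fix x q' assume "m' \<le> x" "p div 2 < q'"
    then show "2 * q' + of_bool a - p + l x = l (q' - p div 2 + x)"
      using p by (simp add: l_def)
  qed simp
  have "l m' = m" by (simp add: l_def)
  moreover have "n = l y \<longleftrightarrow> n + shift off a (fac s p m) + of_bool off = 2 * y + 1"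
    if "chain c (p div 2) m' y" for y
    using chain_le[OF that] shift_eq[of m off a s p] unfolding l_def m'_def by linarith
  ultimately have "chain c p m n \<longleftrightarrow> halves off (shift off a (fac s p m)) (chain c (p div 2) m') n"
    using * unfolding halves_def by metis
  then show ?thesis by (simp add: a_def m'_def)
qed

lemma L_halve:
  assumes m: "K \<le> m" and con_eq: "con (c p m) = (a, k')"
  shows "L (c p m) n \<longleftrightarrow> halves off (shift off a (fac s p m)) (L k') n"
proof -
  define m' where "m' = (of_bool a + m + of_bool off) div 2"
  have a: "a = odd p" "k' = c (p div 2) m'" using con_eq con[OF m] by (auto simp: m'_def)
  show ?thesis
  proof
    assume "L (c p m) n"
    then obtain q where q: "c q m = c p m" "chain c q m n" by (auto simp: L_def)
    have "con (c q m) = (a, k')" using q(1) con_eq by simp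
    then have "odd q = a" "c (q div 2) m' = k'" using con[OF m, of q] by (auto simp: m'_def)
    moreover have "fac s q m = fac s p m" using q(1) by (simp add: cl_eq_iff)
    ultimately have "halves off (shift off a (fac s p m)) (chain c (q div 2) m') n"
      using chain_halve[OF m, of q n] q(2) by (simp add: m'_def)
    then show "halves off (shift off a (fac s p m)) (L k') n"
      using \<open>c (q div 2) m' = k'\<close> by (auto simp: halves_def L_def a(2))
  next
    assume "halves off (shift off a (fac s p m)) (L k') n"
    then obtain y q' where y: "n + shift off a (fac s p m) + of_bool off = 2 * y + 1"
      "c q' m' = k'" "chain c q' m' y"
      by (auto simp: halves_def L_def a(2))
    define q where "q = 2 * q' + of_bool a"
    have q: "odd q = a" "q div 2 = q'" by (simp_all add: q_def)
    have eq: "c q m = c p m"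
      using y(2) q by (intro lift[OF m]) (simp_all add: a m'_def)
    then have "fac s q m = fac s p m" by (simp add: cl_eq_iff)
    then have "chain c q m n"
      using chain_halve[OF m, of q n] y q by (auto simp: halves_def m'_def)
    then show "L (c p m) n" using eq by (auto simp: L_def)
  qed
qed

lemma L_ge: "L k n \<Longrightarrow> length (snd k) \<le> n"
  using chain_le by (auto simp: L_def)

lemma desc_sound:
  assumes "desc fuel off K con col (c p m) = Some t" "tsem off M t n"
    and "\<And>k i y. map_of col k = Some i \<Longrightarrow> M i y \<Longrightarrow> L k y"
  shows "L (c p m) n"
  using assms(1,2)
proof (induction fuel arbitrary: p m t n)
  case (Suc fuel)
  show ?case
  proof (cases "m < K")
    case True
    then obtain i where "map_of col (c p m) = Some i" "t = Node (replicate i False @ [True]) Leaf Leaf Leaf"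
      using Suc.prems(1) by auto
    then show ?thesis using Suc.prems(2) assms(3) by auto
  next
    case False
    define m' where "m' = (of_bool (odd p) + m + of_bool off) div 2"
    have con': "con (c p m) = (odd p, c (p div 2) m')" using con False by (simp add: m'_def)
    obtain t' where t': "desc fuel off K con col (c (p div 2) m') = Some t'"
      "t = branch (shift off (odd p) (fac s p m)) t'"
      using Suc.prems(1) False con' by auto
    have "halves off (shift off (odd p) (fac s p m)) (tsem off M t') n"
      using Suc.prems(2) t'(2) by (simp add: tsem_branch shift_le)
    then have "halves off (shift off (odd p) (fac s p m)) (L (c (p div 2) m')) n"
      using Suc.IH[OF t'(1)] by (auto simp: halves_def)
    then show ?thesis using L_halve[OF _ con'] False by simp
  qed
qed simp

text \<open>For an induction over lengths the equations may be used only below \<open>N\<close>. At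
  \<open>N\<close> itself a desubstitution (\<open>K \<le> m\<close>) has to come first; it leads to
  some \<open>y < n\<close>, because \<open>e \<le> 2\<close> and
  \<open>2 + of_bool off \<le> K \<le> n\<close>.\<close>

lemma desc_complete:
  assumes "desc fuel off K con col (c p m) = Some t" "L (c p m) n"
    and "\<And>k i y. y < N \<Longrightarrow> map_of col k = Some i \<Longrightarrow> L k y \<Longrightarrow> M i y"
    and "n < N \<or> n = N \<and> K \<le> m"
  shows "tsem off M t n"
  using assms(1,2,4)
proof (induction fuel arbitrary: p m t n)
  case (Suc fuel)
  show ?case
  proof (cases "m < K")
    case True
    then obtain i where "map_of col (c p m) = Some i" "t = Node (replicate i False @ [True]) Leaf Leaf Leaf"
      using Suc.prems(1) by auto
    then show ?thesis using Suc.prems(2,3) assms(3) True by auto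
  next
    case False
    define m' where "m' = (of_bool (odd p) + m + of_bool off) div 2"
    have con': "con (c p m) = (odd p, c (p div 2) m')" using con False by (simp add: m'_def)
    obtain t' where t': "desc fuel off K con col (c (p div 2) m') = Some t'"
      "t = branch (shift off (odd p) (fac s p m)) t'"
      using Suc.prems(1) False con' by auto
    obtain y where y: "n + shift off (odd p) (fac s p m) + of_bool off = 2 * y + 1" "L (c (p div 2) m') y"
      using Suc.prems(2) L_halve[OF _ con', of n] False by (auto simp: halves_def)
    have "K \<le> n" using L_ge[OF Suc.prems(2)] False by simp
    then have "y < n" using y(1) K shift_le[of off "odd p" "fac s p m"] by linarith
    then have "y < N" using Suc.prems(3) by auto
    then have "tsem off M t' y" using Suc.IH[OF t'(1) y(2)] by blast
    then have "halves off (shift off (odd p) (fac s p m)) (tsem off M t') n" using y(1) by (auto simp: halves_def)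
    then show ?thesis using t'(2) by (simp add: tsem_branch shift_le)
  qed
qed simp

end

text \<open>Admits recursion through \<open>ssem\<close> in the inductive predicate
  \<open>memb\<close>.\<close>

lemma ssem_mono [mono]:
  "(\<And>i n. M i n \<longrightarrow> M' i n) \<Longrightarrow> ssem off M r n \<longrightarrow> ssem off M' r n"
  unfolding ssem_def using tsem_mono[of M M'] by blast

text \<open>The least solution of the system \<open>tabs\<close>; its unknowns are the colours
  \<open>i\<close>.\<close>

inductive memb :: "bool \<Rightarrow> sys list \<Rightarrow> nat \<Rightarrow> nat \<Rightarrow> bool" for off tabs where
  memb: "i < length tabs \<Longrightarrow> ssem off (memb off tabs) (tabs ! i) n \<Longrightarrow> memb off tabs i n"

context desubstitution
begin

text \<open>Soundness is rule induction on the least solution, completeness is induction on the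
  length, which desubstitution decreases. By \<open>tabs\<close>, classes of one colour have the
  same equation and are interchangeable.\<close>

lemma L_iff_memb:
  assumes tabs: "\<And>k i. (k, i) \<in> set col \<Longrightarrow> i < length tabs \<and> (fst k \<longrightarrow> par) \<and>
      scan par K blk (desc fuel off K con col) T par k = Some (tabs ! i)"
    and blk: "\<And>P. blk (odd P) (s P) = fac s (8 * P) 8" "\<And>a x. length (blk a x) = 8"
    and T: "\<And>a. words (T a) = {fac s P D | P. odd P = a}"
    and k: "map_of col k = Some i"
  shows "L k n \<longleftrightarrow> memb off tabs i n"
proof
  note scan = scan_correct[OF conjunct2[OF conjunct2[OF tabs[OF map_of_SomeD]]] blk T, where off = off]
  have cl: "c p (length (snd k)) = k"
    if "(par \<longrightarrow> odd p = fst k) \<and> fac s p (length (snd k)) = snd k" "map_of col k = Some i" for p k i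
    using that tabs[OF map_of_SomeD[OF that(2)]] by (cases k) (auto simp: cl_def)
  show "L k n" if "memb off tabs i n"
    using that k
  proof (induction arbitrary: k rule: memb.induct)
    case (memb i n)
    \<comment> \<open>The equations mention colours only, so the induction hypothesis must cover
      every class of a colour.\<close>
    let ?M = "\<lambda>i n. memb off tabs i n \<and> (\<forall>k. map_of col k = Some i \<longrightarrow> L k n)"
    from scan(2)[OF memb.prems, of ?M n] memb.IH
    obtain p m cs t where p: "(par \<longrightarrow> odd p = fst k) \<and> fac s p (length (snd k)) = snd k"
      and d: "scan_data s par K (desc fuel off K con col) par (length (snd k)) p m cs t"
      and n: "cmem cs n \<or> tsem off ?M t n" by blast
    note cl = cl[OF p memb.prems]
    have ch: "chain c p (length (snd k)) n \<longleftrightarrow> cmem cs n \<or> chain c p m n" for n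
      using d by (simp add: scan_data_def)
    from n show ?case
    proof
      assume "cmem cs n"
      then show ?thesis using ch cl by (auto simp: L_def)
    next
      assume t: "tsem off ?M t n"
      have "L (c p m) n"
      proof (rule desc_sound[OF _ t])
        show "desc fuel off K con col (c p m) = Some t" using d by (simp add: scan_data_def)
      qed blast
      then obtain q where q: "c q m = c p m" "chain c q m n" by (auto simp: L_def)
      \<comment> \<open>The length \<open>n\<close> is reached at a possibly different position
        \<open>q\<close> with the same class of length \<open>m\<close>; the initial piece of the
        chain depends on that class only and is moved from \<open>p\<close> to
        \<open>q\<close>.\<close>
      have pm: "chain c p (length (snd k)) m" using ch chain.refl by blast
      then have "chain c q (length (snd k)) m" using q(1) by (intro chain_cl_transfer[OF pm]) simp
      then have "chain c q (length (snd k)) n" using q(2) by (rule chain_trans)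
      moreover have "c q (length (snd k)) = k"
        using cl_eq_mono[OF q(1) chain_le[OF pm]] cl by simp
      ultimately show ?thesis by (auto simp: L_def)
    qed
  qed
  show "memb off tabs i n" if "L k n"
    using that k
  proof (induction n arbitrary: k i rule: less_induct)
    case (less n)
    from less.prems(1) obtain p where p: "c p (length (snd k)) = k" "chain c p (length (snd k)) n"
      by (auto simp: L_def)
    have "(par \<longrightarrow> odd p = fst k) \<and> fac s p (length (snd k)) = snd k"
      using p(1) by (metis cl_def fst_conv snd_cl)
    from scan(1)[OF less.prems(2) this, of "memb off tabs"]
    obtain m cs t where d: "scan_data s par K (desc fuel off K con col) par (length (snd k)) p m cs t"
      and r: "\<And>n. cmem cs n \<or> tsem off (memb off tabs) t n \<Longrightarrow> ssem off (memb off tabs) (tabs ! i) n" by blast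
    have "cmem cs n \<or> tsem off (memb off tabs) t n"
    proof (cases "cmem cs n")
      case False
      then have "L (c p m) n" using d p by (auto simp: scan_data_def L_def)
      then have "tsem off (memb off tabs) t n"
      proof (rule desc_complete[rotated])
        show "desc fuel off K con col (c p m) = Some t" "n < n \<or> n = n \<and> K \<le> m"
          using d by (simp_all add: scan_data_def)
      qed (rule less.IH)
      then show ?thesis ..
    qed simp
    then show ?case using r tabs[OF map_of_SomeD[OF less.prems(2)]] by (intro memb.intros) auto
  qed
qed

text \<open>The initial scan compares words only. From length \<open>K0\<close> on a word determines
  the parity of its position, so the rest of the chain is a chain of classes, to which the system
  applies.\<close>

lemma privileged_length_iff:
  assumes tabs: "\<And>k i. (k, i) \<in> set col \<Longrightarrow> i < length tabs \<and> (fst k \<longrightarrow> par) \<and>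
      scan par K blk (desc fuel off K con col) T par k = Some (tabs ! i)"
    and tot: "scan False K0 blk (desc fuel off K con col) T par (False, []) = Some tot"
    and blk: "\<And>P. blk (odd P) (s P) = fac s (8 * P) 8" "\<And>a x. length (blk a x) = 8"
    and T: "\<And>a. words (T a) = {fac s P D | P. odd P = a}"
    and sync: "\<And>p q. par \<Longrightarrow> fac s p K0 = fac s q K0 \<Longrightarrow> odd p = odd q" and "K \<le> K0"
  shows "(\<exists>p. privileged (fac s p n)) \<longleftrightarrow> ssem off (memb off tabs) tot n"
proof -
  note scan = scan_correct[OF tot blk T, where off = off, simplified]
  have memb: "L k n \<longleftrightarrow> memb off tabs i n" if "map_of col k = Some i" for k i n
    using tabs blk T that by (rule L_iff_memb)
  have priv: "privileged (fac s p n) \<longleftrightarrow> chain (cl False s) p 0 n" for p n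
    unfolding privileged_iff_chain
    by (rule chain_cong_class[where m0 = 0]) (auto simp: cl_eq_iff)
  have sync': "chain (cl False s) p m n \<longleftrightarrow> chain c p m n" if "K0 \<le> m" for p m n
  proof (rule chain_cong_class[OF _ that])
    fix q m assume "K0 \<le> m"
    have "odd q = odd p" if par "fac s q m = fac s p m"
    proof (rule sync[OF \<open>par\<close>])
      show "fac s q K0 = fac s p K0" using that(2) \<open>K0 \<le> m\<close> by (auto simp: fac_eq_iff)
    qed
    then show "cl False s q m = cl False s p m \<longleftrightarrow> c q m = c p m" by (auto simp: cl_eq_iff)
  qed
  show ?thesis
  proof
    assume "\<exists>p. privileged (fac s p n)"
    then obtain p where p: "chain (cl False s) p 0 n" using priv by blast
    obtain m cs t where d: "scan_data s False K0 (desc fuel off K con col) par 0 p m cs t"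
      and r: "cmem cs n \<or> tsem off (memb off tabs) t n \<longrightarrow> ssem off (memb off tabs) tot n"
      using scan(1)[of p "memb off tabs"] by blast
    have "cmem cs n \<or> tsem off (memb off tabs) t n"
    proof (cases "cmem cs n")
      case False
      then have "L (c p m) n" using d p sync' by (auto simp: scan_data_def L_def)
      then have "tsem off (memb off tabs) t n"
      proof (rule desc_complete[rotated])
        show "desc fuel off K con col (c p m) = Some t" "n < n \<or> n = n \<and> K \<le> m"
          using d \<open>K \<le> K0\<close> by (simp_all add: scan_data_def)
      qed (use memb in blast)
      then show ?thesis ..
    qed simp
    then show "ssem off (memb off tabs) tot n" using r by blast
  next
    assume "ssem off (memb off tabs) tot n"
    then obtain p m cs t where d: "scan_data s False K0 (desc fuel off K con col) par 0 p m cs t"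
      and n: "cmem cs n \<or> tsem off (memb off tabs) t n"
      using scan(2) by blast
    have ch: "chain (cl False s) p 0 n \<longleftrightarrow> cmem cs n \<or> chain (cl False s) p m n" for n
      using d by (simp add: scan_data_def)
    from n show "\<exists>p. privileged (fac s p n)"
    proof
      assume "cmem cs n"
      then show ?thesis using ch priv by blast
    next
      assume t: "tsem off (memb off tabs) t n"
      have "L (c p m) n"
      proof (rule desc_sound[OF _ t])
        show "desc fuel off K con col (c p m) = Some t" using d by (simp add: scan_data_def)
      qed (use memb in blast)
      then obtain q where q: "c q m = c p m" "chain c q m n" by (auto simp: L_def)
      have "K0 \<le> m" using d by (simp add: scan_data_def)
      have "chain (cl False s) p 0 m" using ch chain.refl by blast
      then have "chain (cl False s) q 0 m" by (rule chain_cl_transfer) (use q(1) in \<open>auto simp: cl_eq_iff\<close>)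
      moreover have "chain (cl False s) q m n" using q(2) sync'[OF \<open>K0 \<le> m\<close>] by blast
      ultimately show ?thesis using priv chain_trans by blast
    qed
  qed
qed

end
section \<open>From the equations to automata\<close>

text \<open>\<open>(cs, t\<^sub>0, t\<^sub>1, t\<^sub>2)\<close> describes the set of all \<open>n\<close> that are listed in \<open>cs\<close> or for which \<open>n + d\<close> is a length of \<open>t\<^sub>d\<close>
  for some \<open>d\<close>. Offsets up to 2 suffice because an equation relates \<open>n + e + off\<close> to \<open>2 y + 1\<close>.\<close>

type_synonym lstate = "bool list \<times> trie \<times> trie \<times> trie"

fun kid :: "nat \<Rightarrow> trie \<Rightarrow> trie" where
  "kid e Leaf = Leaf"
| "kid e (Node f t u v) = (if e = 0 then t else if e = 1 then u else v)"

fun flags :: "trie \<Rightarrow> bool list" where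
  "flags Leaf = []"
| "flags (Node f t u v) = f"

fun strip :: "trie \<Rightarrow> trie" where
  "strip Leaf = Leaf"
| "strip (Node f t u v) = (if t = Leaf \<and> u = Leaf \<and> v = Leaf then Leaf else Node [] t u v)"

text \<open>Drops trailing \<open>False\<close> entries, so that the search meets fewer copies of
  one set.\<close>

fun tcons :: "bool \<Rightarrow> bool list \<Rightarrow> bool list" where
  "tcons False [] = []"
| "tcons x ys = x # ys"

fun sel :: "bool \<Rightarrow> bool list \<Rightarrow> bool list" where
  "sel b [] = []"
| "sel b (x # xs) = (if b then sel False xs else tcons x (sel True xs))"

text \<open>Colours at the root are replaced by their equations; \<open>drop d\<close> accounts for
  the shift of component \<open>d\<close>.\<close>

fun expand1 :: "nat \<Rightarrow> bool list \<Rightarrow> sys list \<Rightarrow> sys \<Rightarrow> sys" where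
  "expand1 d (f # fs) ((cs, t) # tabs) (cs0, t0) =
     expand1 d fs tabs (if f then (orl (drop d cs) cs0, unt t t0) else (cs0, t0))"
| "expand1 d _ _ s = s"

fun expand :: "sys list \<Rightarrow> lstate \<Rightarrow> lstate" where
  "expand tabs (cs, t0, t1, t2) =
    (case expand1 0 (flags t0) tabs (cs, strip t0) of (cs, t0) \<Rightarrow>
     case expand1 1 (flags t1) tabs (cs, strip t1) of (cs, t1) \<Rightarrow>
     case expand1 2 (flags t2) tabs (cs, strip t2) of (cs, t2) \<Rightarrow> (cs, t0, t1, t2))"

text \<open>The cases solve \<open>2 * n + b + d + e + off = 2 * y + 1\<close> by
  \<open>y = n + d'\<close>: parity decides which child \<open>e\<close> of component
  \<open>d\<close> survives, and \<open>d'\<close> is its new component.\<close>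

fun kids :: "bool \<Rightarrow> bool \<Rightarrow> lstate \<Rightarrow> lstate" where
  "kids off b (cs, t0, t1, t2) =
    (if off \<noteq> b then (sel b cs, kid 0 t0, unt (kid 2 t0) (unt (kid 1 t1) (kid 0 t2)), kid 2 t2)
     else if b then (sel b cs, Leaf, unt (kid 1 t0) (kid 0 t1), unt (kid 2 t1) (kid 1 t2))
     else (sel b cs, unt (kid 1 t0) (kid 0 t1), unt (kid 2 t1) (kid 1 t2), Leaf))"

text \<open>The default 3 exceeds the values 0, 1, 2 that \<open>zero_ok\<close> has to
  exclude.\<close>

fun lead :: "bool list \<Rightarrow> nat" where
  "lead [] = 3"
| "lead (x # xs) = (if x then 0 else Suc (lead xs))"

fun lowest :: "nat list \<Rightarrow> bool list \<Rightarrow> nat" where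
  "lowest (l # ls) (f # fs) = (if f then min l (lowest ls fs) else lowest ls fs)"
| "lowest _ _ = 3"

text \<open>A lower bound for the lengths of a trie, from \<open>n = 2 * y + 1 - e - off\<close> and
  the bounds \<open>ls\<close> of the colours.\<close>

fun lb :: "bool \<Rightarrow> nat list \<Rightarrow> trie \<Rightarrow> nat" where
  "lb off ls Leaf = 3"
| "lb off ls (Node f t u v) = min (lowest ls f) (min (2 * lb off ls t + 1 - of_bool off)
     (min (2 * lb off ls u - of_bool off) (2 * lb off ls v - 1 - of_bool off)))"

fun beq :: "bool list \<Rightarrow> bool list \<Rightarrow> bool" where
  "beq [] [] = True"
| "beq (x # xs) (y # ys) = (if x = y then beq xs ys else False)"
| "beq _ _ = False"

fun teq :: "trie \<Rightarrow> trie \<Rightarrow> bool" where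
  "teq Leaf Leaf = True"
| "teq (Node f t u v) (Node f' t' u' v') =
    (if beq f f' then if teq t t' then if teq u u' then teq v v' else False else False else False)"
| "teq _ _ = False"

fun leq :: "lstate \<Rightarrow> lstate \<Rightarrow> bool" where
  "leq (cs, t, u, v) (cs', t', u', v') =
    (if beq cs cs' then if teq t t' then if teq u u' then teq v v' else False else False else False)"

fun elem :: "('s \<Rightarrow> 's \<Rightarrow> bool) \<Rightarrow> 's \<Rightarrow> 's list \<Rightarrow> bool" where
  "elem eq x [] = False"
| "elem eq x (y # ys) = (if eq x y then True else elem eq x ys)"

fun explore :: "('s \<Rightarrow> 's \<Rightarrow> bool) \<Rightarrow> (bool \<Rightarrow> 's \<Rightarrow> 's) \<Rightarrow> nat \<Rightarrow> 's list \<Rightarrow> 's list \<Rightarrow> 's list" where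
  "explore eq f 0 todo seen = seen"
| "explore eq f (Suc n) [] seen = seen"
| "explore eq f (Suc n) (x # xs) seen =
    (if elem eq x seen then explore eq f n xs seen
     else explore eq f n (f False x # f True x # xs) (seen @ [x]))"

datatype 'a tree = Tip 'a | Bin "'a tree" "'a tree"

text \<open>Paths serve as names of states. Each path reaches a leaf: a short one continues to the
  left, a long one is cut off.\<close>

fun look :: "'a tree \<Rightarrow> bool list \<Rightarrow> 'a" where
  "look (Tip x) p = x"
| "look (Bin t u) [] = look t []"
| "look (Bin t u) (b # p) = look (if b then u else t) p"

fun mk_tree :: "nat \<Rightarrow> 'a list \<Rightarrow> 'a tree" where
  "mk_tree 0 xs = Tip (hd xs)"
| "mk_tree (Suc n) xs = (case tl xs of [] \<Rightarrow> Tip (hd xs) | ys \<Rightarrow> Bin (mk_tree n (evens xs)) (mk_tree n (evens ys)))"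

fun path :: "('a \<Rightarrow> 'a \<Rightarrow> bool) \<Rightarrow> 'a \<Rightarrow> 'a tree \<Rightarrow> bool list option" where
  "path eq x (Tip y) = (if eq x y then Some [] else None)"
| "path eq x (Bin t u) = (case path eq x t of Some p \<Rightarrow> Some (False # p)
     | None \<Rightarrow> map_option ((#) True) (path eq x u))"

fun all_some :: "'a option tree \<Rightarrow> 'a tree option" where
  "all_some (Tip x) = map_option Tip x"
| "all_some (Bin t u) = (case all_some t of None \<Rightarrow> None | Some t' \<Rightarrow> map_option (Bin t') (all_some u))"

text \<open>For each state: acceptance of 0 and the names of its successors under the digits 0 and
  1.\<close>

type_synonym table = "(bool \<times> bool list \<times> bool list) tree"

text \<open>Membership of 0 cannot be decided by reading a digit, since half of 0 is 0 again. The
  bounds ensure that no trie contributes, which leaves the explicit list.\<close>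

fun zero_ok :: "bool \<Rightarrow> nat list \<Rightarrow> lstate \<Rightarrow> bool" where
  "zero_ok off ls (cs, t0, t1, t2) = (0 < lb off ls t0 \<and> 1 < lb off ls t1 \<and> 2 < lb off ls t2)"

fun accepts_zero :: "lstate \<Rightarrow> bool" where
  "accepts_zero (cs, _) = (cs \<noteq> [] \<and> hd cs)"

definition lsd_entry :: "(bool \<Rightarrow> lstate \<Rightarrow> lstate) \<Rightarrow> bool \<Rightarrow> nat list \<Rightarrow> lstate tree \<Rightarrow> lstate \<Rightarrow>
    (bool \<times> bool list \<times> bool list) option" where
  "lsd_entry f off ls X x = (if zero_ok off ls x
     then case path leq (f False x) X of None \<Rightarrow> None | Some p \<Rightarrow>
       map_option (\<lambda>q. (accepts_zero x, p, q)) (path leq (f True x) X) else None)"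

text \<open>300 and 10 are fuel: were they too small, some successor would have no path and
  \<open>lsd_check\<close> would fail.\<close>

definition lsd_search :: "(bool \<Rightarrow> lstate \<Rightarrow> lstate) \<Rightarrow> lstate \<Rightarrow> lstate tree" where
  "lsd_search f x = mk_tree 10 (explore leq f 300 [x] [])"

definition lsd_check :: "(bool \<Rightarrow> lstate \<Rightarrow> lstate) \<Rightarrow> bool \<Rightarrow> nat list \<Rightarrow> lstate \<Rightarrow> lstate tree \<Rightarrow>
    (bool list \<times> table) option" where
  "lsd_check f off ls x X = (case path leq x X of None \<Rightarrow> None
     | Some p \<Rightarrow> map_option (Pair p) (all_some (map_tree (lsd_entry f off ls X) X)))"

definition lsd_step :: "bool \<Rightarrow> sys list \<Rightarrow> bool \<Rightarrow> lstate \<Rightarrow> lstate" where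
  "lsd_step off tabs b S = expand tabs (kids off b S)"

definition lsd_start :: "bool \<Rightarrow> sys list \<Rightarrow> nat list \<Rightarrow> lstate \<Rightarrow> (bool list \<times> table) option" where
  "lsd_start off tabs ls x =
    (if list_all (\<lambda>t. flags (snd t) = [] \<and> lead (fst t) \<le> lb off ls (snd t)) tabs
     then lsd_check (lsd_step off tabs) off ls x
            (lsd_search (lsd_step off tabs) x)
     else None)"

definition lsd_table :: "bool \<Rightarrow> sys list \<Rightarrow> sys \<Rightarrow> (bool list \<times> table) option" where
  "lsd_table off tabs tot = lsd_start off tabs (map (\<lambda>t. lead (fst t)) tabs)
     (expand tabs (fst tot, snd tot, Leaf, Leaf))"

text \<open>A state of the reversed automaton is the family of the truth values \<open>lsd D p n\<close>, where \<open>n\<close> is the number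
  read so far and \<open>p\<close> runs over the states of \<open>D\<close>.\<close>

fun vec_step :: "table \<Rightarrow> bool \<Rightarrow> bool tree \<Rightarrow> bool tree" where
  "vec_step (Tip x) b v = Tip (look v (if b then snd (snd x) else fst (snd x)))"
| "vec_step (Bin t u) b v = Bin (vec_step t b v) (vec_step u b v)"

text \<open>A vector without \<open>True\<close> stays so under every digit and is replaced by a
  missing transition.\<close>

fun alive :: "bool tree \<Rightarrow> bool" where
  "alive (Tip x) = x"
| "alive (Bin t u) = (if alive t then True else alive u)"

fun leaves :: "'a tree \<Rightarrow> 'a list \<Rightarrow> 'a list" where
  "leaves (Tip x) xs = x # xs"
| "leaves (Bin t u) xs = leaves t (leaves u xs)"

fun has :: "bool list \<Rightarrow> wtree \<Rightarrow> bool" where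
  "has [] End = True"
| "has (x # xs) (Branch t u) = has xs (if x then u else t)"
| "has _ _ = False"

fun msd_search :: "table \<Rightarrow> nat \<Rightarrow> bool tree list \<Rightarrow> bool tree list \<Rightarrow> wtree \<Rightarrow> bool tree list" where
  "msd_search D 0 todo seen keys = seen"
| "msd_search D (Suc n) [] seen keys = seen"
| "msd_search D (Suc n) (v # vs) seen keys =
    (if has (leaves v []) keys then msd_search D n vs seen keys
     else msd_search D n (vec_step D False v # vec_step D True v # vs) (v # seen) (ins (leaves v []) keys))"

definition msd_entry :: "wtree \<Rightarrow> bool tree \<Rightarrow> bool" where
  "msd_entry keys w = (if alive w then has (leaves w []) keys else True)"

fun msd_closed :: "table \<Rightarrow> wtree \<Rightarrow> bool tree list \<Rightarrow> bool" where
  "msd_closed D keys [] = True"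
| "msd_closed D keys (w # ws) = (if msd_entry keys (vec_step D False w)
     then if msd_entry keys (vec_step D True w) then msd_closed D keys ws else False else False)"

definition msd_check :: "table \<Rightarrow> bool tree \<Rightarrow> bool tree list \<Rightarrow> wtree \<Rightarrow> bool tree list option" where
  "msd_check D v V keys = (if has (leaves v []) keys \<and> msd_closed D keys V then Some V else None)"

fun keys_of :: "bool tree list \<Rightarrow> wtree" where
  "keys_of [] = Empty"
| "keys_of (v # vs) = ins (leaves v []) (keys_of vs)"

definition msd_start :: "table \<Rightarrow> bool tree \<Rightarrow> bool tree list \<Rightarrow> bool tree list option" where
  "msd_start D v V = msd_check D v V (keys_of V)"

definition msd_states :: "table \<Rightarrow> bool tree list option" where
  "msd_states D = msd_start D (map_tree fst D) (filter alive (msd_search D 300 [map_tree fst D] [] Empty))"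

section \<open>Correctness of the table read from the least significant digit\<close>

lemma beq_iff: "beq xs ys \<longleftrightarrow> xs = ys"
  by (induction xs ys rule: beq.induct) auto

lemma teq_iff: "teq t u \<longleftrightarrow> t = u"
  by (induction t u rule: teq.induct) (auto simp: beq_iff)

lemma leq_iff: "leq S S' \<longleftrightarrow> S = S'"
  by (induction S S' rule: leq.induct) (auto simp: beq_iff teq_iff)

lemma orl_Nil2 [simp]: "orl xs [] = xs"
  by (cases xs) auto

lemma flags_unt: "flags (unt t u) = orl (flags t) (flags u)"
  by (cases "(t, u)" rule: unt.cases) auto

lemma flags_strip [simp]: "flags (strip t) = []"
  by (cases t) auto

lemma tsem_strip: "tsem off M t n \<longleftrightarrow> (\<exists>c. cmem (flags t) c \<and> M c n) \<or> tsem off M (strip t) n"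
  by (cases t) auto

lemma tsem_kid:
  "flags t = [] \<Longrightarrow> tsem off M t n \<longleftrightarrow> halves off 0 (tsem off M (kid 0 t)) n \<or>
     halves off 1 (tsem off M (kid 1 t)) n \<or> halves off 2 (tsem off M (kid 2 t)) n"
  by (cases t) auto

lemma tcons_cmem: "cmem (tcons x ys) n \<longleftrightarrow> cmem (x # ys) n"
  by (cases x; cases ys) (auto simp: cmem_Cons split: nat.splits)

lemma sel_cmem: "cmem (sel b cs) n \<longleftrightarrow> cmem cs (2 * n + of_bool b)"
  by (induction b cs arbitrary: n rule: sel.induct) (auto simp: tcons_cmem cmem_Cons split: nat.splits)

lemma drop_cmem: "cmem (drop d cs) n \<longleftrightarrow> cmem cs (n + d)"
  by (auto simp: cmem_def add.commute)

definition noflags :: "lstate \<Rightarrow> bool" where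
  "noflags S \<longleftrightarrow> (case S of (cs, t0, t1, t2) \<Rightarrow> flags t0 = [] \<and> flags t1 = [] \<and> flags t2 = [])"

definition lsem :: "bool \<Rightarrow> (nat \<Rightarrow> nat \<Rightarrow> bool) \<Rightarrow> lstate \<Rightarrow> nat \<Rightarrow> bool" where
  "lsem off M S n \<longleftrightarrow> (case S of (cs, t0, t1, t2) \<Rightarrow>
     cmem cs n \<or> tsem off M t0 n \<or> tsem off M t1 (n + 1) \<or> tsem off M t2 (n + 2))"

lemma expand1_flags:
  "\<forall>t\<in>set tabs. flags (snd t) = [] \<Longrightarrow> flags (snd (expand1 d fs tabs s)) = flags (snd s)"
  by (induction d fs tabs s rule: expand1.induct) (auto simp: flags_unt)

lemma expand1_sem:
  assumes "expand1 d fs tabs (cs, t) = (cs', t')"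
  shows "cmem cs' n \<or> tsem off M t' (n + d) \<longleftrightarrow> cmem cs n \<or> tsem off M t (n + d) \<or>
    (\<exists>c<length tabs. cmem fs c \<and> ssem off M (tabs ! c) (n + d))"
  using assms
proof (induction fs arbitrary: tabs cs t)
  case (Cons f fs)
  show ?case
  proof (cases tabs)
    case (Cons tab tabs')
    obtain cs1 t1 where tab: "tab = (cs1, t1)" by (cases tab)
    define cs2 t2 where "cs2 = (if f then orl (drop d cs1) cs else cs)" and "t2 = (if f then unt t1 t else t)"
    have "expand1 d fs tabs' (cs2, t2) = (cs', t')"
      using Cons.prems unfolding Cons tab by (simp add: cs2_def t2_def split: if_splits)
    from Cons.IH[OF this] have "cmem cs' n \<or> tsem off M t' (n + d) \<longleftrightarrow> cmem cs2 n \<or> tsem off M t2 (n + d) \<or>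
        (\<exists>c<length tabs'. cmem fs c \<and> ssem off M (tabs' ! c) (n + d))" .
    moreover have "cmem cs2 n \<or> tsem off M t2 (n + d) \<longleftrightarrow>
        cmem cs n \<or> tsem off M t (n + d) \<or> f \<and> ssem off M tab (n + d)"
      by (auto simp: cs2_def t2_def tab ssem_def drop_cmem)
    moreover have "(\<exists>c<length tabs. cmem (f # fs) c \<and> ssem off M (tabs ! c) (n + d)) \<longleftrightarrow>
        f \<and> ssem off M tab (n + d) \<or> (\<exists>c<length tabs'. cmem fs c \<and> ssem off M (tabs' ! c) (n + d))"
      unfolding Cons by (auto simp: cmem_Cons less_Suc_eq_0_disj)
    ultimately show ?thesis by blast
  qed (use Cons.prems in auto)
qed auto

lemma memb_iff: "memb off tabs i n \<longleftrightarrow> i < length tabs \<and> ssem off (memb off tabs) (tabs ! i) n"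
  by (subst memb.simps) auto

text \<open>Colours may be unfolded because \<open>memb\<close> satisfies the equations.\<close>

lemma expand_sem: "lsem off (memb off tabs) (expand tabs S) n \<longleftrightarrow> lsem off (memb off tabs) S n"
proof -
  let ?M = "memb off tabs"
  obtain cs t0 t1 t2 where S: "S = (cs, t0, t1, t2)" by (cases S)
  obtain cs0 u0 where e0: "expand1 0 (flags t0) tabs (cs, strip t0) = (cs0, u0)" by fastforce
  obtain cs1 u1 where e1: "expand1 1 (flags t1) tabs (cs0, strip t1) = (cs1, u1)" by fastforce
  obtain cs2 u2 where e2: "expand1 2 (flags t2) tabs (cs1, strip t2) = (cs2, u2)" by fastforce
  have ex: "expand tabs S = (cs2, u0, u1, u2)" by (simp add: S e0 e1[unfolded One_nat_def] e2)
  have fl: "(\<exists>c<length tabs. cmem (flags t) c \<and> ssem off ?M (tabs ! c) n) \<longleftrightarrow> (\<exists>c. cmem (flags t) c \<and> ?M c n)" for t n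
    using memb_iff[of off tabs] by blast
  show ?thesis
    unfolding S ex[unfolded S] lsem_def prod.case tsem_strip[of off ?M t0] tsem_strip[of off ?M t1] tsem_strip[of off ?M t2]
    using expand1_sem[OF e0, of n off ?M] expand1_sem[OF e1, of n off ?M] expand1_sem[OF e2, of n off ?M]
    unfolding fl add_0_right by blast
qed

lemma expand_noflags:
  assumes "\<forall>t\<in>set tabs. flags (snd t) = []"
  shows "noflags (expand tabs S)"
proof -
  obtain cs t0 t1 t2 where S: "S = (cs, t0, t1, t2)" by (cases S)
  obtain cs0 u0 where e0: "expand1 0 (flags t0) tabs (cs, strip t0) = (cs0, u0)" by fastforce
  obtain cs1 u1 where e1: "expand1 1 (flags t1) tabs (cs0, strip t1) = (cs1, u1)" by fastforce
  obtain cs2 u2 where e2: "expand1 2 (flags t2) tabs (cs1, strip t2) = (cs2, u2)" by fastforce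
  show ?thesis
    using expand1_flags[OF assms, of 0 "flags t0" "(cs, strip t0)"]
      expand1_flags[OF assms, of 1 "flags t1" "(cs0, strip t1)"]
      expand1_flags[OF assms, of 2 "flags t2" "(cs1, strip t2)"]
    by (simp add: S e0 e1 e1[unfolded One_nat_def] e2 noflags_def)
qed

lemma halves_even:
  assumes "n + e + of_bool off = 2 * y"
  shows "\<not> halves off e A n"
proof
  assume "halves off e A n"
  then obtain z where "n + e + of_bool off = 2 * z + 1" by (auto simp: halves_def)
  then show False using assms by presburger
qed

lemma halves_odd: "n + e + of_bool off = 2 * y + 1 \<Longrightarrow> halves off e A n \<longleftrightarrow> A y"
  by (auto simp: halves_def)

lemma kids_sem:
  assumes "noflags S"
  shows "lsem off M (kids off b S) n \<longleftrightarrow> lsem off M S (2 * n + of_bool b)"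
proof -
  obtain cs t0 t1 t2 where S: "S = (cs, t0, t1, t2)" by (cases S)
  have fl: "flags t0 = []" "flags t1 = []" "flags t2 = []" using assms by (auto simp: S noflags_def)
  let ?N = "2 * n + of_bool b"
  have sem: "lsem off M S ?N \<longleftrightarrow> cmem cs ?N \<or>
     (halves off 0 (tsem off M (kid 0 t0)) ?N \<or> halves off 1 (tsem off M (kid 1 t0)) ?N \<or>
      halves off 2 (tsem off M (kid 2 t0)) ?N) \<or>
     (halves off 0 (tsem off M (kid 0 t1)) (?N + 1) \<or> halves off 1 (tsem off M (kid 1 t1)) (?N + 1) \<or>
      halves off 2 (tsem off M (kid 2 t1)) (?N + 1)) \<or>
     (halves off 0 (tsem off M (kid 0 t2)) (?N + 2) \<or> halves off 1 (tsem off M (kid 1 t2)) (?N + 2) \<or>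
      halves off 2 (tsem off M (kid 2 t2)) (?N + 2))"
    unfolding lsem_def S prod.case
    unfolding tsem_kid[OF fl(1), of off M ?N] tsem_kid[OF fl(2), of off M "?N + 1"] tsem_kid[OF fl(3), of off M "?N + 2"]
    by blast
  show ?thesis
  proof (cases "off = b")
    case False
    have "\<not> halves off 1 A ?N" "\<not> halves off 0 A (?N + 1)" "\<not> halves off 2 A (?N + 1)" "\<not> halves off 1 A (?N + 2)" for A
      by (rule halves_even[of _ _ _ "n + 1"] halves_even[of _ _ _ "n + 2"]; use False in auto)+
    moreover have "halves off 0 A ?N \<longleftrightarrow> A n" "halves off 2 A ?N \<longleftrightarrow> A (n + 1)"
      "halves off 1 A (?N + 1) \<longleftrightarrow> A (n + 1)" "halves off 0 A (?N + 2) \<longleftrightarrow> A (n + 1)"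
      "halves off 2 A (?N + 2) \<longleftrightarrow> A (n + 2)" for A
      by (rule halves_odd; use False in auto)+
    ultimately show ?thesis
      unfolding sem using False by (simp add: S lsem_def sel_cmem; blast)
  next
    case True
    show ?thesis
    proof (cases b)
      case b: True
      have "\<not> halves off 0 A ?N" "\<not> halves off 2 A ?N" "\<not> halves off 1 A (?N + 1)"
        "\<not> halves off 0 A (?N + 2)" "\<not> halves off 2 A (?N + 2)" for A
        by (rule halves_even[of _ _ _ "n + 1"] halves_even[of _ _ _ "n + 2"] halves_even[of _ _ _ "n + 3"];
            use True b in auto)+
      moreover have "halves off 1 A ?N \<longleftrightarrow> A (n + 1)" "halves off 0 A (?N + 1) \<longleftrightarrow> A (n + 1)"
        "halves off 2 A (?N + 1) \<longleftrightarrow> A (n + 2)" "halves off 1 A (?N + 2) \<longleftrightarrow> A (n + 2)" for A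
        by (rule halves_odd; use True b in auto)+
      ultimately show ?thesis
        unfolding sem using True b by (simp add: S lsem_def sel_cmem; blast)
    next
      case b: False
      have "\<not> halves off 0 A ?N" "\<not> halves off 2 A ?N" "\<not> halves off 1 A (?N + 1)"
        "\<not> halves off 0 A (?N + 2)" "\<not> halves off 2 A (?N + 2)" for A
        by (rule halves_even[of _ _ _ n] halves_even[of _ _ _ "n + 1"] halves_even[of _ _ _ "n + 2"];
            use True b in auto)+
      moreover have "halves off 1 A ?N \<longleftrightarrow> A n" "halves off 0 A (?N + 1) \<longleftrightarrow> A n"
        "halves off 2 A (?N + 1) \<longleftrightarrow> A (n + 1)" "halves off 1 A (?N + 2) \<longleftrightarrow> A (n + 1)" for A
        by (rule halves_odd; use True b in auto)+
      ultimately show ?thesis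
        unfolding sem using True b by (simp add: S lsem_def sel_cmem; blast)
    qed
  qed
qed

lemma lead_le: "cmem cs n \<Longrightarrow> lead cs \<le> n"
  by (induction cs arbitrary: n) (auto simp: cmem_Cons split: nat.splits)

lemma lowest_le: "cmem fs c \<Longrightarrow> c < length ls \<Longrightarrow> lowest ls fs \<le> ls ! c"
  by (induction ls fs arbitrary: c rule: lowest.induct) (auto simp: cmem_Cons min_le_iff_disj split: nat.splits)

lemma lb_le:
  assumes "\<And>c n. M c n \<Longrightarrow> c < length ls \<and> ls ! c \<le> n"
  shows "tsem off M t n \<Longrightarrow> lb off ls t \<le> n"
proof (induction t arbitrary: n)
  case (Node f t u v)
  from Node.prems consider c where "cmem f c" "M c n" | "halves off 0 (tsem off M t) n"
    | "halves off 1 (tsem off M u) n" | "halves off 2 (tsem off M v) n" by auto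
  then show ?case
  proof cases
    case 1
    then have "lowest ls f \<le> n" using assms lowest_le le_trans by blast
    then show ?thesis by simp
  next
    case 2
    then obtain y where "n + of_bool off = 2 * y + 1" "tsem off M t y" by (auto simp: halves_def)
    then have "2 * lb off ls t + 1 - of_bool off \<le> n" using Node.IH(1)[of y] by linarith
    then show ?thesis by (simp add: min_le_iff_disj)
  next
    case 3
    then obtain y where "n + 1 + of_bool off = 2 * y + 1" "tsem off M u y" by (auto simp: halves_def)
    then have "2 * lb off ls u - of_bool off \<le> n" using Node.IH(2)[of y] by linarith
    then show ?thesis by (simp add: min_le_iff_disj)
  next
    case 4
    then obtain y where "n + 2 + of_bool off = 2 * y + 1" "tsem off M v y" by (auto simp: halves_def)
    then have "2 * lb off ls v - 1 - of_bool off \<le> n" using Node.IH(3)[of y] by linarith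
    then show ?thesis by (simp add: min_le_iff_disj)
  qed
qed simp

text \<open>Each equation preserves the bounds, so they hold for the least solution.\<close>

lemma memb_ge:
  assumes "\<forall>t\<in>set tabs. lead (fst t) \<le> lb off (map (\<lambda>t. lead (fst t)) tabs) (snd t)"
  shows "memb off tabs i n \<Longrightarrow> i < length tabs \<and> lead (fst (tabs ! i)) \<le> n"
proof (induction rule: memb.induct)
  case (memb i n)
  let ?M = "\<lambda>i n. memb off tabs i n \<and> i < length tabs \<and> lead (fst (tabs ! i)) \<le> n"
  from memb.IH consider "cmem (fst (tabs ! i)) n" | "tsem off ?M (snd (tabs ! i)) n"
    by (auto simp: ssem_def)
  then show ?case
  proof cases
    case 1
    then show ?thesis using memb.hyps(1) lead_le by blast
  next
    case 2
    then have "lb off (map (\<lambda>t. lead (fst t)) tabs) (snd (tabs ! i)) \<le> n"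
      by (rule lb_le[rotated]) auto
    moreover have "lead (fst (tabs ! i)) \<le> lb off (map (\<lambda>t. lead (fst t)) tabs) (snd (tabs ! i))"
      using assms memb.hyps(1) by simp
    ultimately show ?thesis using memb.hyps(1) by simp
  qed
qed

lemma accepts_zero_correct:
  assumes "\<forall>t\<in>set tabs. lead (fst t) \<le> lb off (map (\<lambda>t. lead (fst t)) tabs) (snd t)"
    and "zero_ok off (map (\<lambda>t. lead (fst t)) tabs) S"
  shows "accepts_zero S \<longleftrightarrow> lsem off (memb off tabs) S 0"
proof -
  obtain cs t0 t1 t2 where S: "S = (cs, t0, t1, t2)" by (cases S)
  have le: "lb off (map (\<lambda>t. lead (fst t)) tabs) t \<le> n" if "tsem off (memb off tabs) t n" for t n
    using that by (rule lb_le[rotated]) (use memb_ge[OF assms(1)] in auto)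
  have "\<not> tsem off (memb off tabs) t0 0" "\<not> tsem off (memb off tabs) t1 1" "\<not> tsem off (memb off tabs) t2 2"
    using assms(2) le[of t0 0] le[of t1 1] le[of t2 2] unfolding S zero_ok.simps by linarith+
  then show ?thesis by (cases cs) (auto simp: S lsem_def cmem_def numeral_2_eq_2)
qed

fun lsd :: "table \<Rightarrow> bool list \<Rightarrow> nat \<Rightarrow> bool" where
  "lsd D p n = (if n = 0 then fst (look D p)
     else lsd D (if odd n then snd (snd (look D p)) else fst (snd (look D p))) (n div 2))"

declare lsd.simps [simp del]

lemma path_look: "path leq x X = Some p \<Longrightarrow> look X p = x"
  by (induction X arbitrary: p) (auto simp: leq_iff split: if_splits option.splits)

lemma all_some_look: "all_some t = Some u \<Longrightarrow> look t p = Some (look u p)"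
proof (induction t arbitrary: u p)
  case (Bin t1 t2)
  then show ?case by (cases p) (auto split: option.splits)
qed auto

lemma look_map_tree: "look (map_tree h t) p = h (look t p)"
  by (induction t p rule: look.induct) auto

lemma lsd_table_correct:
  assumes "lsd_table off tabs tot = Some (p, D)"
  shows "ssem off (memb off tabs) tot n \<longleftrightarrow> lsd D p n"
proof -
  let ?ls = "map (\<lambda>t. lead (fst t)) tabs" and ?M = "memb off tabs"
  define x where "x = expand tabs (fst tot, snd tot, Leaf, Leaf)"
  define X where "X = lsd_search (lsd_step off tabs) x"
  have "list_all (\<lambda>t. flags (snd t) = [] \<and> lead (fst t) \<le> lb off ?ls (snd t)) tabs"
    and check: "lsd_check (lsd_step off tabs) off ?ls x X = Some (p, D)"
    using assms by (auto simp: lsd_table_def lsd_start_def x_def X_def split: if_splits)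
  then have fl: "\<forall>t\<in>set tabs. flags (snd t) = []" and ld: "\<forall>t\<in>set tabs. lead (fst t) \<le> lb off ?ls (snd t)"
    by (auto simp: list_all_iff)
  have px: "look X p = x" and D: "all_some (map_tree (lsd_entry (lsd_step off tabs) off ?ls X) X) = Some D"
    using check by (auto simp: lsd_check_def dest: path_look split: option.splits)
  have entry: "lsd_entry (lsd_step off tabs) off ?ls X (look X q) = Some (look D q)" for q
    using all_some_look[OF D, of q] by (simp add: look_map_tree)
  \<comment> \<open>An expanded state has no colours at its roots, as \<open>kids_sem\<close>
    requires.\<close>
  have main: "lsd D q n \<longleftrightarrow> lsem off ?M (look X q) n" if "\<exists>S. look X q = expand tabs S" for q n
    using that
  proof (induction n arbitrary: q rule: less_induct)
    case (less n)
    obtain a q0 q1 where e: "look D q = (a, q0, q1)" by (cases "look D q")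
    have z: "zero_ok off ?ls (look X q)" "a = accepts_zero (look X q)"
      and q0: "look X q0 = lsd_step off tabs False (look X q)" and q1: "look X q1 = lsd_step off tabs True (look X q)"
      using entry[of q] unfolding e by (auto simp: lsd_entry_def dest: path_look split: if_splits option.splits)
    have nf: "noflags (look X q)" using less.prems expand_noflags[OF fl] by auto
    show ?case
    proof (cases "n = 0")
      case True
      then show ?thesis using accepts_zero_correct[OF ld z(1)] z(2) e by (simp add: lsd.simps[of D q 0])
    next
      case False
      define q' where "q' = (if odd n then q1 else q0)"
      have q': "look X q' = expand tabs (kids off (odd n) (look X q))"
        using q0 q1 by (auto simp: q'_def lsd_step_def)
      have "lsd D q n \<longleftrightarrow> lsd D q' (n div 2)"
        using False e by (subst lsd.simps) (simp add: q'_def)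
      also have "\<dots> \<longleftrightarrow> lsem off ?M (look X q') (n div 2)"
      proof (rule less.IH)
        show "n div 2 < n" using False by simp
        show "\<exists>S. look X q' = expand tabs S" using q' by blast
      qed
      also have "\<dots> \<longleftrightarrow> lsem off ?M (look X q) (2 * (n div 2) + of_bool (odd n))"
        unfolding q' expand_sem kids_sem[OF nf] ..
      also have "2 * (n div 2) + of_bool (odd n) = n" by simp
      finally show ?thesis .
    qed
  qed
  have "\<exists>S. look X p = expand tabs S" using px x_def by blast
  then have "lsd D p n \<longleftrightarrow> lsem off ?M x n" using main[of p n] unfolding px by blast
  also have "\<dots> \<longleftrightarrow> ssem off ?M tot n"
    unfolding x_def expand_sem by (simp add: lsem_def ssem_def)
  finally show ?thesis ..
qed

section \<open>Reversal into an automaton reading the most significant digit first\<close>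

definition represents :: "table \<Rightarrow> bool tree \<Rightarrow> nat \<Rightarrow> bool" where
  "represents D v n \<longleftrightarrow> (\<forall>p. look v p \<longleftrightarrow> lsd D p n)"

definition same_shape :: "'a tree \<Rightarrow> 'b tree \<Rightarrow> bool" where
  "same_shape t u \<longleftrightarrow> map_tree (\<lambda>_. ()) t = map_tree (\<lambda>_. ()) u"

lemma look_vec_step: "look (vec_step D b v) p = look v (if b then snd (snd (look D p)) else fst (snd (look D p)))"
  by (induction D p rule: look.induct) auto

lemma shape_vec_step [simp]: "same_shape (vec_step D b v) D"
  unfolding same_shape_def by (induction D) auto

lemma shape_map_tree [simp]: "same_shape (map_tree h D) D"
  unfolding same_shape_def by (induction D) auto

lemma represents_0: "represents D (map_tree fst D) 0"
  by (simp add: represents_def look_map_tree lsd.simps)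

text \<open>The value of \<open>n\<close> at \<open>p\<close> is that of \<open>n div 2\<close> at a
  successor of \<open>p\<close>, so appending a digit on the right acts on the whole vector.\<close>

lemma represents_step:
  assumes "represents D v (n div 2)" and "n > 0"
  shows "represents D (vec_step D (odd n) v) n"
  using assms by (simp add: represents_def look_vec_step lsd.simps[of D _ n])

text \<open>Flattening is injective on vectors of one shape, so flattened vectors can serve as
  keys.\<close>

lemma leaves_inj:
  "same_shape v w \<Longrightarrow> leaves v xs = leaves w ys \<Longrightarrow> v = w \<and> xs = ys"
proof (induction v arbitrary: w xs ys)
  case (Tip x)
  then show ?case by (cases w) (auto simp: same_shape_def)
next
  case (Bin v1 v2)
  obtain w1 w2 where w: "w = Bin w1 w2"
    using Bin.prems(1) by (cases w) (auto simp: same_shape_def)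
  have "v1 = w1 \<and> leaves v2 xs = leaves w2 ys"
    using Bin.prems by (intro Bin.IH(1)) (auto simp: w same_shape_def)
  moreover from this have "v2 = w2 \<and> xs = ys"
    using Bin.prems by (intro Bin.IH(2)) (auto simp: w same_shape_def)
  ultimately show ?case by (simp add: w)
qed

lemma not_alive: "\<not> alive v \<Longrightarrow> \<not> look v p"
  by (induction v p rule: look.induct) (auto split: if_splits)

lemma has_iff: "has w t \<longleftrightarrow> w \<in> words t"
  by (induction w t rule: has.induct) auto

lemma words_ins_subset: "words (ins w t) \<subseteq> insert w (words t)"
proof (induction w t rule: ins.induct)
  case (2 x w t u)
  then show ?case by (cases x) auto
next
  case ("3_1" x w)
  then show ?case by (cases x) auto
next
  case ("3_2" x w)
  then show ?case by (cases x) auto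
qed auto

lemma words_keys_of: "words (keys_of V) \<subseteq> (\<lambda>v. leaves v []) ` set V"
proof (induction V)
  case (Cons v V)
  then show ?case using words_ins_subset[of "leaves v []" "keys_of V"] by auto
qed simp

lemma msd_search_shape:
  "(\<And>v. v \<in> set todo \<union> set seen \<Longrightarrow> same_shape v D) \<Longrightarrow>
    w \<in> set (msd_search D n todo seen keys) \<Longrightarrow> same_shape w D"
proof (induction D n todo seen keys rule: msd_search.induct)
  case (3 D n v vs seen keys)
  show ?case
  proof (cases "has (leaves v []) keys")
    case True
    show ?thesis
    proof (rule "3.IH"(1)[OF True])
      show "same_shape x D" if "x \<in> set vs \<union> set seen" for x using "3.prems"(1)[of x] that by auto
      show "w \<in> set (msd_search D n vs seen keys)" using "3.prems"(2) True by simp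
    qed
  next
    case False
    show ?thesis
    proof (rule "3.IH"(2)[OF False])
      show "same_shape x D"
        if "x \<in> set (vec_step D False v # vec_step D True v # vs) \<union> set (v # seen)" for x
        using "3.prems"(1)[of x] that by auto
      show "w \<in> set (msd_search D n (vec_step D False v # vec_step D True v # vs) (v # seen) (ins (leaves v []) keys))"
        using "3.prems"(2) False by simp
    qed
  qed
qed auto

lemma msd_closed_iff: "msd_closed D keys V \<longleftrightarrow> (\<forall>v\<in>set V. \<forall>b. msd_entry keys (vec_step D b v))"
  by (induction V) (auto simp: all_bool_eq split: if_splits)

lemma run_append: "run A q (u @ w) = Option.bind (run A q u) (\<lambda>q'. run A q' w)"
  by (induction u arbitrary: q) (auto split: option.splits)

text \<open>States are indices into \<open>V\<close>, so their number is \<open>length V\<close>. An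
  undefined run means that the vector reached was \<open>False\<close> everywhere.\<close>

lemma dfa_exists:
  assumes V: "msd_states D = Some V"
  shows "\<exists>A :: (nat, nat) dfa. is_dfa {0, 1} A \<and> card (states A) = length V \<and>
    (\<forall>n. accepts A (base2 n) \<longleftrightarrow> lsd D p n)"
proof -
  let ?v0 = "map_tree fst D"
  define W where "W = filter alive (msd_search D 300 [?v0] [] Empty)"
  have "msd_check D ?v0 W (keys_of W) = Some V"
    using V by (simp only: msd_states_def msd_start_def W_def)
  then have V': "V = W"
    and init: "has (leaves ?v0 []) (keys_of V)" and closed: "msd_closed D (keys_of V) V"
    by (simp_all add: msd_check_def split: if_splits)
  have shape: "same_shape v D" if "v \<in> set V" for v
  proof -
    have "v \<in> set (msd_search D 300 [?v0] [] Empty)" using that unfolding V' W_def by simp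
    then show ?thesis by (rule msd_search_shape[rotated]) simp
  qed
  have in_V: "w \<in> set V" if "has (leaves w []) (keys_of V)" "same_shape w D" for w
  proof -
    have "leaves w [] \<in> (\<lambda>v. leaves v []) ` set V"
      using that(1) words_keys_of[of V] by (auto simp: has_iff)
    then obtain v where v: "v \<in> set V" "leaves w [] = leaves v []" by blast
    then show ?thesis using leaves_inj[of w v "[]" "[]"] shape that(2) by (auto simp: same_shape_def)
  qed
  define idx where "idx w = (SOME i. i < length V \<and> V ! i = w)" for w
  have idx: "idx w < length V" "V ! idx w = w" if "w \<in> set V" for w
    using that someI_ex[of "\<lambda>i. i < length V \<and> V ! i = w"] by (auto simp: idx_def in_set_conv_nth)
  define A :: "(nat, nat) dfa" where "A = \<lparr>states = {..<length V}, initial = idx ?v0,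
    accepting = {i. i < length V \<and> look (V ! i) p},
    step = (\<lambda>i a. let w = vec_step D (a = 1) (V ! i) in if w \<in> set V then Some (idx w) else None)\<rparr>"
  have v0: "?v0 \<in> set V" using init in_V by simp
  have "is_dfa {0, 1} A"
    using idx v0 by (auto simp: is_dfa_def A_def Let_def split: if_splits)
  moreover have "card (states A) = length V" by (simp add: A_def)
  moreover have run: "case run A (initial A) (base2 n) of
      None \<Rightarrow> (\<forall>p. \<not> lsd D p n) | Some i \<Rightarrow> i < length V \<and> represents D (V ! i) n" for n
  proof (induction n rule: less_induct)
    case (less n)
    show ?case
    proof (cases "n = 0")
      case True
      then show ?thesis using idx[OF v0] represents_0[of D] by (simp add: A_def base2.simps[of 0])
    next
      case False
      then have "n > 0" by simp
      have b: "base2 n = base2 (n div 2) @ [n mod 2]" using False by (simp add: base2.simps[of n])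
      have IH: "case run A (initial A) (base2 (n div 2)) of None \<Rightarrow> (\<forall>p. \<not> lsd D p (n div 2))
          | Some i \<Rightarrow> i < length V \<and> represents D (V ! i) (n div 2)"
        using False by (intro less.IH) simp
      show ?thesis
      proof (cases "run A (initial A) (base2 (n div 2))")
        case None
        then have "\<forall>p. \<not> lsd D p n" using IH False by (subst lsd.simps) simp
        then show ?thesis using None by (simp add: b run_append)
      next
        case (Some i)
        then have i: "i < length V" "represents D (V ! i) (n div 2)" using IH by simp_all
        define w where "w = vec_step D (odd n) (V ! i)"
        have rep: "represents D w n" unfolding w_def by (rule represents_step[OF i(2) \<open>n > 0\<close>])
        have r: "run A (initial A) (base2 n) = (if w \<in> set V then Some (idx w) else None)"
          using Some by (simp add: b run_append A_def w_def odd_iff_mod_2_eq_one)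
        show ?thesis
        proof (cases "w \<in> set V")
          case True
          then show ?thesis using r rep idx by simp
        next
          case False
          have "msd_entry (keys_of V) w" using closed i(1) unfolding msd_closed_iff w_def by simp
          then have "\<not> alive w" using False in_V[of w] by (auto simp: msd_entry_def w_def split: if_splits)
          then have "\<forall>p. \<not> lsd D p n" using rep not_alive by (auto simp: represents_def)
          then show ?thesis using r False by simp
        qed
      qed
    qed
  qed
  have "accepts A (base2 n) \<longleftrightarrow> lsd D p n" for n
  proof (cases "run A (initial A) (base2 n)")
    case None
    then show ?thesis using run[of n] by (simp add: accepts_def)
  next
    case (Some i)
    then have "i < length V" "represents D (V ! i) n" using run[of n] by simp_all
    then show ?thesis using Some by (auto simp: accepts_def A_def represents_def)
  qed
  ultimately show ?thesis by blast
qed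

section \<open>Solving the system of a sequence\<close>

fun pair_tree :: "wtree \<Rightarrow> wtree \<Rightarrow> bool \<Rightarrow> wtree" where
  "pair_tree t u b = (if b then u else t)"

fun scan_all :: "bool \<Rightarrow> nat \<Rightarrow> (bool \<Rightarrow> bool \<Rightarrow> bool list) \<Rightarrow> (cls \<Rightarrow> trie option) \<Rightarrow>
    (bool \<Rightarrow> wtree) \<Rightarrow> (cls \<times> nat) list \<Rightarrow> (nat \<times> sys option) list" where
  "scan_all par K blk fin T [] = []"
| "scan_all par K blk fin T ((k, i) # ks) = (i, scan par K blk fin T par k) # scan_all par K blk fin T ks"

fun select :: "(nat \<times> sys option) list \<Rightarrow> nat list \<Rightarrow> sys list option" where
  "select rs [] = Some []"
| "select rs (i # js) = (case map_of rs i of Some (Some x) \<Rightarrow> map_option ((#) x) (select rs js) | _ \<Rightarrow> None)"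

text \<open>Checks what the colours promise: classes of one colour have the same equation.\<close>

fun consistent :: "(nat \<times> sys option) list \<Rightarrow> sys list option \<Rightarrow> sys list option" where
  "consistent rs None = None"
| "consistent rs (Some tabs) =
    (if list_all (\<lambda>x. fst x < length tabs \<and> snd x = Some (tabs ! fst x)) rs then Some tabs else None)"

definition tables :: "(nat \<times> sys option) list \<Rightarrow> nat list \<Rightarrow> sys list option" where
  "tables rs colours = consistent rs (select rs colours)"

fun then_lsd :: "bool \<Rightarrow> sys list option \<Rightarrow> sys option \<Rightarrow> (bool list \<times> table) option" where
  "then_lsd off (Some tabs) (Some tot) = lsd_table off tabs tot"
| "then_lsd off _ _ = None"

definition solve :: "bool \<Rightarrow> bool \<Rightarrow> nat \<Rightarrow> nat \<Rightarrow> (bool \<Rightarrow> bool \<Rightarrow> bool list) \<Rightarrow> (cls \<Rightarrow> bool \<times> cls) \<Rightarrow>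
    (cls \<times> nat) list \<Rightarrow> nat list \<Rightarrow> (bool \<Rightarrow> wtree) \<Rightarrow> (bool list \<times> table) option" where
  "solve par off K K0 blk con col colours T = then_lsd off
     (tables (scan_all par K blk (desc 20 off K con col) T col) colours)
     (scan False K0 blk (desc 20 off K con col) T par (False, []))"

fun count_states :: "(bool list \<times> table) option \<Rightarrow> nat option" where
  "count_states None = None"
| "count_states (Some (p, D)) = map_option length (msd_states D)"

lemma set_scan_all:
  "set (scan_all par K blk fin T ks) = (\<lambda>(k, i). (i, scan par K blk fin T par k)) ` set ks"
  by (induction ks) auto

lemma (in desubstitution) solve_correct:
  assumes solve: "solve par off K K0 blk con col colours T = Some (p, D)"
    and col: "list_all (\<lambda>x. fst (fst x) \<longrightarrow> par) col"
    and blk: "\<And>P. blk (odd P) (s P) = fac s (8 * P) 8" "\<And>a x. length (blk a x) = 8"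
    and T: "\<And>a. words (T a) = {fac s P d | P. odd P = a}"
    and sync: "\<And>p q. par \<Longrightarrow> fac s p K0 = fac s q K0 \<Longrightarrow> odd p = odd q" and "K \<le> K0"
  shows "(\<exists>i. privileged (fac s i n)) \<longleftrightarrow> lsd D p n"
proof -
  define rs where "rs = scan_all par K blk (desc 20 off K con col) T col"
  obtain tabs tot where tabs: "tables rs colours = Some tabs"
    and tot: "scan False K0 blk (desc 20 off K con col) T par (False, []) = Some tot"
    and lsd: "lsd_table off tabs tot = Some (p, D)"
    using solve unfolding solve_def rs_def[symmetric]
    by (metis not_Some_eq option.distinct(1) then_lsd.elims)
  have "list_all (\<lambda>x. fst x < length tabs \<and> snd x = Some (tabs ! fst x)) rs"
    using tabs by (cases "select rs colours") (auto simp: tables_def split: if_splits)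
  then have rs: "i < length tabs \<and> x = Some (tabs ! i)" if "(i, x) \<in> set rs" for i x
    using that by (auto simp: list_all_iff)
  have "(\<exists>i. privileged (fac s i n)) \<longleftrightarrow> ssem off (memb off tabs) tot n"
  proof (rule privileged_length_iff[OF _ tot blk T sync \<open>K \<le> K0\<close>])
    fix k i assume ki: "(k, i) \<in> set col"
    then have "(i, scan par K blk (desc 20 off K con col) T par k) \<in> set rs"
      by (force simp: rs_def set_scan_all)
    then show "i < length tabs \<and> (fst k \<longrightarrow> par) \<and>
        scan par K blk (desc 20 off K con col) T par k = Some (tabs ! i)"
      using rs bspec[OF col[unfolded list_all_iff] ki] by simp
  qed
  then show ?thesis using lsd_table_correct[OF lsd] by simp
qed

text \<open>The 7 is the largest offset at which a factor can start inside its first block.\<close>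

lemma up_correct:
  assumes blk: "\<And>P. blk (odd P) (s P) = fac s (8 * P) 8"
    and L: "\<And>a. set (L a) = {fac s P m | P. odd P = a}" and n: "n + 7 \<le> 8 * m"
  shows "set (up blk n b L) = {fac s P n | P. odd P = b}"
proof -
  have window: "take n (drop r (blocks blk (odd P) (fac s P m))) = fac s (8 * P + r) n" if "r < 8" for r P
  proof -
    have "min n (8 * m - r) = n" using that n by linarith
    then show ?thesis by (simp add: blocks_fac[OF blk] drop_fac take_fac)
  qed
  define R where "R = (if b then [1, 3, 5, 7] else [0, 2, 4, 6 :: nat])"
  have R: "r \<in> set R \<longleftrightarrow> r < 8 \<and> odd r = b" for r
    unfolding R_def by (cases b) (simp, presburger)+
  have "set (up blk n b L) = {take n (drop r (blocks blk a xs)) | a xs r. xs \<in> set (L a) \<and> r \<in> set R}"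
    unfolding up_def R_def[symmetric] by (auto simp: image_iff) (metis (full_types))+
  also have "\<dots> = {fac s (8 * P + r) n | P r. r \<in> set R}"
    unfolding L by (auto simp: R window) (metis R window)+
  also have "\<dots> = {fac s P n | P. odd P = b}"
  proof (intro equalityI subsetI)
    fix w assume "w \<in> {fac s P n | P. odd P = b}"
    then obtain P where P: "w = fac s P n" "odd P = b" by blast
    then have "P mod 8 \<in> set R" unfolding R by (simp add: mod_mod_cancel even_iff_mod_2_eq_zero)
    moreover have "w = fac s (8 * (P div 8) + P mod 8) n" using P by simp
    ultimately show "w \<in> {fac s (8 * P + r) n | P r. r \<in> set R}" by blast
  qed (auto simp: R)
  finally show ?thesis .
qed

lemma up_base:
  assumes blk: "\<And>P. blk (odd P) (s P) = fac s (8 * P) 8"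
    and start: "fac s 0 2 = w"
    and sub: "list_all (\<lambda>a. list_all (\<lambda>v. v \<in> set (map (\<lambda>i. take 2 (drop i (blocks blk False w)))
        (if a then [1, 3, 5, 7, 9, 11, 13] else [0, 2, 4, 6, 8, 10, 12, 14]))) (L a)) [False, True]"
    and sup: "\<And>P. fac s P 2 \<in> set (L (odd P))"
  shows "set (L a) = {fac s P 2 | P. odd P = a}"
proof (intro equalityI subsetI)
  fix v assume v: "v \<in> set (L a)"
  have pre: "blocks blk False w = fac s 0 16"
    using blocks_fac[OF blk, of 0 2] start by simp
  from sub have "list_all (\<lambda>v. v \<in> set (map (\<lambda>i. take 2 (drop i (blocks blk False w)))
        (if a then [1, 3, 5, 7, 9, 11, 13] else [0, 2, 4, 6, 8, 10, 12, 14]))) (L a)"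
    by (cases a) simp_all
  then have "v \<in> (\<lambda>i. take 2 (drop i (fac s 0 16))) ` set (if a then [1, 3, 5, 7, 9, 11, 13] else [0, 2, 4, 6, 8, 10, 12, 14])"
    using v unfolding pre list_all_iff set_map by blast
  then obtain i where i: "v = take 2 (drop i (fac s 0 16))"
      "i \<in> set (if a then [1, 3, 5, 7, 9, 11, 13] else [0, 2, 4, 6, 8, 10, 12, 14])" by blast
  from i(2) have "i \<le> 14 \<and> odd i = a" by (cases a) auto
  then have min: "min 2 (16 - i) = 2" and odd: "odd i = a" by linarith+
  have "v = fac s i 2" unfolding i(1) drop_fac take_fac min by simp
  then show "v \<in> {fac s P 2 | P. odd P = a}" using odd by blast
qed (use sup in auto)

lemma words_tree_fac: "set L = {fac s P n | P. odd P = a} \<Longrightarrow> words (tree L) = {fac s P n | P. odd P = a}"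
  by (subst words_tree[where n = n]) auto

lemma evens_fac: "evens (fac s p m) = map (\<lambda>j. s (p + 2 * j)) [0..<(m + 1) div 2]"
proof (induction m arbitrary: p rule: induct_nat_012)
  case (ge2 m)
  have "(Suc (Suc m) + 1) div 2 = Suc ((m + 1) div 2)" by simp
  then have "map (\<lambda>j. s (p + 2 * j)) [0..<(Suc (Suc m) + 1) div 2] =
      s p # map (\<lambda>j. s (Suc (Suc p) + 2 * j)) [0..<(m + 1) div 2]"
    by (simp only: map_upt_Suc) simp
  then show ?case using ge2 by (simp add: fac_Suc)
qed (simp_all add: fac_Suc)

lemma div_2_add: "(p + j) div 2 = p div 2 + (of_bool (odd p) + j) div (2::nat)"
proof -
  have "p = 2 * (p div 2) + of_bool (odd p)" by simp
  then have "p + j = (of_bool (odd p) + j) + 2 * (p div 2)" by linarith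
  then show ?thesis using double_add_div_2[of "of_bool (odd p) + j" "p div 2"] by simp
qed

text \<open>Each letter is a function \<open>F\<close> of the parities and of the letter above it,
  and the window of length \<open>m\<close> lies below
  \<open>(of_bool (odd p) + m + 1) div 2\<close> letters.\<close>

lemma lift_all:
  assumes F: "\<And>n. s n = F (odd n) (par \<and> odd (n div 2)) (s (n div 2))"
    and odd: "odd p = odd q"
    and eq: "cl par s (p div 2) ((of_bool (odd p) + m + 1) div 2) = cl par s (q div 2) ((of_bool (odd p) + m + 1) div 2)"
  shows "cl par s p m = cl par s q m"
proof -
  have "s (p + j) = s (q + j)" if "j < m" for j
  proof -
    define t where "t = (of_bool (odd p) + j) div 2"
    have t: "(p + j) div 2 = p div 2 + t" "(q + j) div 2 = q div 2 + t"
      unfolding t_def by (rule div_2_add div_2_add[of q j, folded odd])+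
    have "(A + j) div 2 < (A + m + 1) div 2" for A :: nat using that by presburger
    then have t_less: "t < (of_bool (odd p) + m + 1) div 2" unfolding t_def .
    have "s (p div 2 + t) = s (q div 2 + t)" using eq t_less by (auto simp: cl_eq_iff fac_eq_iff)
    moreover have "par \<longrightarrow> odd (p div 2) = odd (q div 2)" using eq by (simp add: cl_eq_iff)
    ultimately show ?thesis using odd unfolding F[of "p + j"] F[of "q + j"] t by auto
  qed
  then show ?thesis using odd by (auto simp: cl_eq_iff fac_eq_iff)
qed

text \<open>At even positions \<open>F\<close> ignores the letter above, so a last letter there adds
  nothing to the preimage; hence no \<open>+ 1\<close> in its length.\<close>

lemma lift_odd:
  assumes F: "\<And>n. s n = F (odd n) (par \<and> odd (n div 2)) (odd n \<and> s (n div 2))"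
    and odd: "odd p = odd q"
    and eq: "cl par s (p div 2) ((of_bool (odd p) + m) div 2) = cl par s (q div 2) ((of_bool (odd p) + m) div 2)"
  shows "cl par s p m = cl par s q m"
proof -
  have "s (p + j) = s (q + j)" if "j < m" for j
  proof -
    define t where "t = (of_bool (odd p) + j) div 2"
    have t: "(p + j) div 2 = p div 2 + t" "(q + j) div 2 = q div 2 + t"
      unfolding t_def by (rule div_2_add div_2_add[of q j, folded odd])+
    have "odd (A + j) \<Longrightarrow> (A + j) div 2 < (A + m) div 2" for A :: nat using that by presburger
    moreover have "odd (p + j) \<longleftrightarrow> odd (of_bool (odd p) + j)" by simp
    ultimately have "t < (of_bool (odd p) + m) div 2" if "odd (p + j)" using that unfolding t_def by blast
    then have "odd (p + j) \<longrightarrow> s (p div 2 + t) = s (q div 2 + t)" using eq by (auto simp: cl_eq_iff fac_eq_iff)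
    moreover have "par \<longrightarrow> odd (p div 2) = odd (q div 2)" using eq by (simp add: cl_eq_iff)
    ultimately show ?thesis using odd unfolding F[of "p + j"] F[of "q + j"] t by auto
  qed
  then show ?thesis using odd by (auto simp: cl_eq_iff fac_eq_iff)
qed

lemma has_privileged_factor_iff:
  assumes "\<And>j. S !! j = of_bool (s j)"
  shows "has_privileged_factor S n \<longleftrightarrow> (\<exists>p. privileged (fac s p n))"
proof -
  have eq: "fac (\<lambda>j. S !! j) q m = fac (\<lambda>j. S !! j) p m \<longleftrightarrow> fac s q m = fac s p m" for p q m
    by (auto simp: fac_eq_iff assms)
  have "privileged (factor_at S p n) \<longleftrightarrow> privileged (fac s p n)" for p
    unfolding factor_at_eq_fac privileged_iff_chain
    by (rule chain_cong_class[where m0 = 0]) (simp_all add: eq)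
  then show ?thesis by (auto simp: has_privileged_factor_def privileged_factors_def)
qed

lemma fixed_point_unfold:
  assumes "\<And>b. h b \<noteq> []" "h a = a # u" "u \<noteq> []"
  shows "shd (fixed_point h a) = a" "flat (smap h (fixed_point h a)) = fixed_point h a"
  using theI'[OF fixed_point_ex1[of h a u, OF assms]] unfolding fixed_point_def by auto

lemma fixed_point_uniform:
  assumes len: "\<And>b. length (h b) = 2" and a: "hd (h a) = a"
  defines "x \<equiv> fixed_point h a"
  shows "x !! (2 * n) = h (x !! n) ! 0" "x !! (2 * n + 1) = h (x !! n) ! 1"
proof -
  have ne: "h b \<noteq> []" for b using len[of b] by auto
  have "h a = a # tl (h a)" "tl (h a) \<noteq> []" using a len[of a] by (cases "h a"; auto)+
  then have x: "flat (smap h x) = x" unfolding x_def using fixed_point_unfold ne by metis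
  have "length (concat (map h w)) = 2 * length w" for w
    by (induction w) (simp_all add: len)
  then have l: "length (concat (map h (stake n x))) = 2 * n" by simp
  have "x = concat (map h (stake n x)) @- flat (smap h (sdrop n x))"
    using flat_smap_stake_sdrop[of h x n] ne x by simp
  also have "flat (smap h (sdrop n x)) = h (x !! n) @- flat (smap h (stl (sdrop n x)))"
    using ne by (subst flat_unfold) (auto simp: sdrop_simps(1))
  finally have e: "x = concat (map h (stake n x)) @- h (x !! n) @- flat (smap h (stl (sdrop n x)))" .
  have *: "(u @- v @- r) !! (length u + i) = v ! i" if "i < length v" for u v r and i :: nat
    using that by (simp add: shift_snth_ge shift_snth_less)
  show "x !! (2 * n) = h (x !! n) ! 0" "x !! (2 * n + 1) = h (x !! n) ! 1"
    using *[of 0 "h (x !! n)" "concat (map h (stake n x))" "flat (smap h (stl (sdrop n x)))"]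
      *[of 1 "h (x !! n)" "concat (map h (stake n x))" "flat (smap h (stl (sdrop n x)))"]
    unfolding e[symmetric] l by (simp_all only: len add_0_right zero_less_numeral one_less_numeral_iff semiring_norm simp_thms)
qed

lemma (in desubstitution) automaton:
  assumes count: "count_states (solve par off K K0 blk con col colours T) = Some N"
    and col: "list_all (\<lambda>x. fst (fst x) \<longrightarrow> par) col"
    and blk: "\<And>P. blk (odd P) (s P) = fac s (8 * P) 8" "\<And>a x. length (blk a x) = 8"
    and T: "\<And>a. words (T a) = {fac s P d | P. odd P = a}"
    and sync: "\<And>p q. par \<Longrightarrow> fac s p K0 = fac s q K0 \<Longrightarrow> odd p = odd q" and "K \<le> K0"
  shows "\<exists>A :: (nat, nat) dfa. is_dfa {0, 1} A \<and> card (states A) = N \<and>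
    (\<forall>n. accepts A (base2 n) \<longleftrightarrow> (\<exists>i. privileged (fac s i n)))"
proof (cases "solve par off K K0 blk con col colours T")
  case (Some pD)
  obtain p D where pD: "pD = (p, D)" by (cases pD)
  obtain V where V: "msd_states D = Some V" "length V = N"
    using count by (auto simp: Some pD)
  from solve_correct[OF Some[unfolded pD] col blk T sync \<open>K \<le> K0\<close>] dfa_exists[OF V(1), of p] V(2)
  show ?thesis by simp
qed (use count in simp)

definition pairs :: "bool list list" where
  "pairs = [[False, False], [False, True], [True, False], [True, True]]"

lemma fac_2: "fac s P 2 = [s P, s (P + 1)]"
  by (simp add: numeral_2_eq_2 fac_Suc)

lemma fac_8: "fac s P 8 = [s P, s (P + 1), s (P + 2), s (P + 3), s (P + 4), s (P + 5), s (P + 6), s (P + 7)]"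
  by (simp add: numeral_eq_Suc fac_Suc)

lemma tl_fac: "tl (fac s p m) = fac s (p + 1) (m - 1)"
  by (cases m) (simp_all add: fac_Suc)

lemma evens_fac_eq:
  assumes "\<And>j. s (p + 2 * j) = t (q + j)"
  shows "evens (fac s p m) = fac t q ((m + 1) div 2)"
  unfolding evens_fac by (simp add: fac_def assms)

lemma octal_div_2:
  fixes P :: nat
  shows "(8 * P + 3) div 2 = 4 * P + 1" "(8 * P + 5) div 2 = 4 * P + 2" "(8 * P + 7) div 2 = 4 * P + 3"
    "(4 * P + 3) div 2 = 2 * P + 1"
  by presburger+

lemma fac_2_in_pairs: "fac s P 2 \<in> set pairs"
  by (auto simp: fac_2 pairs_def)

lemma words_pair_tree:
  assumes "\<And>a. set (L a) = {fac s P n | P. odd P = a}"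
  shows "words (pair_tree (tree (L False)) (tree (L True)) a) = {fac s P n | P. odd P = a}"
  using words_tree_fac[OF assms] by (cases a) auto

text \<open>The factors at even and at odd positions are enumerated and found disjoint. The bound is
  \<open>9 + 7 = 16\<close>, the length of two blocks.\<close>

lemma sync_by_base:
  assumes blk: "\<And>P. blk (odd P) (s P) = fac s (8 * P) 8"
    and base: "\<And>a. set (L a) = {fac s P 2 | P. odd P = a}" and n: "n \<le> 9"
    and disj: "list_all (\<lambda>w. w \<notin> set (up blk n True L)) (up blk n False L)"
    and eq: "fac s p n = fac s q n"
  shows "odd p = odd q"
proof (rule ccontr)
  have up: "set (up blk n b L) = {fac s P n | P. odd P = b}" for b
    using n by (intro up_correct[OF blk base]) simp
  have "\<not> (even p' \<and> odd q')" if "fac s p' n = fac s q' n" for p' q'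
    using disj that unfolding list_all_iff up by blast
  moreover assume "odd p \<noteq> odd q"
  ultimately show False using eq by metis
qed

section \<open>The Thue--Morse sequence\<close>

definition tm :: "nat \<Rightarrow> bool" where
  "tm n \<longleftrightarrow> thue_morse !! n = 1"

lemma thue_morse_nth:
  "thue_morse !! (2 * n) = (if thue_morse !! n = 0 then 0 else 1)"
  "thue_morse !! (2 * n + 1) = (if thue_morse !! n = 0 then 1 else 0)"
  using fixed_point_uniform[of "\<lambda>a::nat. if a = 0 then [0, 1] else [1, 0]" 0 n]
  unfolding thue_morse_def by simp_all

lemma thue_morse_div_2:
  "thue_morse !! n = (if (thue_morse !! (n div 2) = 0) = even n then 0 else 1)"
proof (cases "even n")
  case True
  then have "thue_morse !! n = thue_morse !! (2 * (n div 2))" by simp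
  then show ?thesis unfolding thue_morse_nth(1) using True by simp
next
  case False
  then have "thue_morse !! n = thue_morse !! (2 * (n div 2) + 1)" by (metis odd_two_times_div_two_succ)
  then show ?thesis unfolding thue_morse_nth(2) using False by simp
qed

lemma thue_morse_eq: "thue_morse !! n = of_bool (tm n)"
  unfolding tm_def using thue_morse_div_2[of n] by (simp split: if_splits)

lemma tm_rec: "tm n \<longleftrightarrow> tm (n div 2) \<noteq> odd n"
  using thue_morse_div_2[of n] unfolding thue_morse_eq
  by (cases "tm n"; cases "tm (n div 2)"; cases "even n"; simp)

lemma tm_even: "tm (2 * n) = tm n" and tm_odd: "tm (2 * n + 1) = (\<not> tm n)"
  using tm_rec[of "2 * n"] tm_rec[of "2 * n + 1"] by simp_all

text \<open>The two letters of a block differ, so equal neighbours straddle a boundary. Four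
  alternating letters at an odd position would lie below three equal consecutive letters, which do
  not occur.\<close>

fun par_tm :: "bool list \<Rightarrow> bool" where
  "par_tm w = (if w ! 0 = w ! 1 then True else if w ! 1 = w ! 2 then False else w ! 2 = w ! 3)"

fun con_tm :: "cls \<Rightarrow> bool \<times> cls" where
  "con_tm (a, w) = (par_tm w, False, if par_tm w then (\<not> w ! 0) # evens (tl w) else evens w)"

definition blk_tm :: "bool \<Rightarrow> bool \<Rightarrow> bool list" where
  "blk_tm a x = [x, \<not> x, \<not> x, x, \<not> x, x, x, \<not> x]"

text \<open>The factors of lengths 2 and 3, coloured up to complement and reversal;
  \<open>consistent\<close> confirms that this is legitimate.\<close>

definition col_tm :: "(cls \<times> nat) list" where
  "col_tm = [((False, [False, False]), 0), ((False, [False, False, True]), 1), ((False, [False, True]), 2),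
     ((False, [False, True, False]), 3), ((False, [False, True, True]), 1), ((False, [True, False]), 2),
     ((False, [True, False, False]), 1), ((False, [True, False, True]), 3), ((False, [True, True]), 0),
     ((False, [True, True, False]), 1)]"

definition base_tm :: "bool \<Rightarrow> bool list list" where
  "base_tm a = (if a then pairs else [[False, True], [True, False]])"

text \<open>Windows of three blocks; were they too short for some scan, the evaluation would return
  \<open>None\<close>.\<close>

definition trees_tm :: "bool \<Rightarrow> wtree" where
  "trees_tm = pair_tree (tree (up blk_tm 3 False base_tm)) (tree (up blk_tm 3 True base_tm))"

lemma count_tm: "count_states (solve False True 4 4 blk_tm con_tm col_tm [0, 1, 2, 3] trees_tm) = Some 46"
  by code_simp

lemma par_tm_correct:
  assumes "4 \<le> m"
  shows "par_tm (fac tm p m) = odd p"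
proof (cases "even p")
  case True
  then obtain i where p: "p = 2 * i" by blast
  have "tm (p + 1) = (\<not> tm p)" "tm (p + 3) = (\<not> tm (p + 2))"
    using tm_even[of i] tm_odd[of i] tm_even[of "i + 1"] tm_odd[of "i + 1"]
    by (simp_all add: p algebra_simps numeral_eq_Suc)
  then show ?thesis using assms True by auto
next
  case False
  then obtain i where p: "p = 2 * i + 1" by (rule oddE)
  have v: "tm p = (\<not> tm i)" "tm (p + 1) = tm (i + 1)" "tm (p + 2) = (\<not> tm (i + 1))" "tm (p + 3) = tm (i + 2)"
    using tm_odd[of i] tm_even[of "i + 1"] tm_odd[of "i + 1"] tm_even[of "i + 2"]
    by (simp_all add: p algebra_simps numeral_eq_Suc)
  \<comment> \<open>Of two neighbouring pairs one is a block and has distinct letters.\<close>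
  have "\<not> (tm i = tm (i + 1) \<and> tm (i + 1) = tm (i + 2))"
  proof (cases "even i")
    case True
    then obtain k where "i = 2 * k" by blast
    then show ?thesis using tm_even[of k] tm_odd[of k] by simp
  next
    case False
    then obtain k where "i = 2 * k + 1" by (rule oddE)
    then show ?thesis using tm_even[of "k + 1"] tm_odd[of "k + 1"] by (simp add: algebra_simps)
  qed
  then show ?thesis using assms False v by auto
qed

interpretation tm: desubstitution tm False True 4 con_tm
proof
  show "2 + of_bool True \<le> (4::nat)" by simp
  show "con_tm (cl False tm p m) =
      (odd p, cl False tm (p div 2) ((of_bool (odd p) + m + of_bool True) div 2))" if m: "4 \<le> m" for m p
  proof (cases "even p")
    case True
    then obtain i where p: "p = 2 * i" by blast
    have "evens (fac tm p m) = fac tm i ((m + 1) div 2)"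
      unfolding p using tm_even[of "i + _"] by (intro evens_fac_eq) (simp only: distrib_left)
    then show ?thesis using par_tm_correct[OF m, of p] True p by (simp add: cl_def del: par_tm.simps)
  next
    case False
    then obtain i where p: "p = 2 * i + 1" by (rule oddE)
    have "evens (tl (fac tm p m)) = fac tm (i + 1) (m div 2)"
    proof -
      have "tm (2 * i + 1 + 1 + 2 * j) = tm (i + 1 + j)" for j
        using tm_even[of "i + 1 + j"] by (simp add: algebra_simps)
      then have "evens (fac tm (2 * i + 1 + 1) (m - 1)) = fac tm (i + 1) ((m - 1 + 1) div 2)"
        by (rule evens_fac_eq)
      then show ?thesis using m by (simp add: tl_fac p)
    qed
    moreover have "(1 + m + 1) div 2 = Suc (m div 2)" by simp
    moreover have "fac tm p m ! 0 = (\<not> tm i)" using m tm_odd[of i] by (simp add: p)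
    ultimately show ?thesis using par_tm_correct[OF m, of p] False p
      by (simp add: cl_def fac_Suc del: par_tm.simps)
  qed
  show "cl False tm p m = cl False tm q m"
    if "4 \<le> m" "odd p = odd q" "cl False tm (p div 2) ((of_bool (odd p) + m + of_bool True) div 2) =
      cl False tm (q div 2) ((of_bool (odd p) + m + of_bool True) div 2)" for m p q
    by (rule lift_all[where F = "\<lambda>d _ x. x \<noteq> d", OF tm_rec that(2)]) (use that(3) in simp)
qed

lemma blk_tm: "blk_tm (odd P) (tm P) = fac tm (8 * P) 8" "length (blk_tm a x) = 8"
proof -
  show "blk_tm (odd P) (tm P) = fac tm (8 * P) 8"
    unfolding blk_tm_def fac_8
    using tm_rec[of "8 * P"] tm_rec[of "8 * P + 1"] tm_rec[of "8 * P + 2"] tm_rec[of "8 * P + 3"]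
      tm_rec[of "8 * P + 4"] tm_rec[of "8 * P + 5"] tm_rec[of "8 * P + 6"] tm_rec[of "8 * P + 7"]
      tm_rec[of "4 * P"] tm_rec[of "4 * P + 1"] tm_rec[of "4 * P + 2"] tm_rec[of "4 * P + 3"]
      tm_rec[of "2 * P"] tm_rec[of "2 * P + 1"] by (simp add: octal_div_2)
qed (simp add: blk_tm_def)

lemma tm_start: "fac tm 0 2 = [False, True]"
  using thue_morse_nth[of 0] fixed_point_unfold(1)[of "\<lambda>a::nat. if a = 0 then [0, 1] else [1, 0]" 0 "[1]"]
  by (simp add: fac_2 tm_def thue_morse_def)

lemma base_tm: "set (base_tm a) = {fac tm P 2 | P. odd P = a}"
proof (rule up_base[OF blk_tm(1) tm_start])
  show "fac tm P 2 \<in> set (base_tm (odd P))" for P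
    using fac_2_in_pairs[of tm P] tm_rec[of P] tm_rec[of "P + 1"] by (auto simp: base_tm_def fac_2)
qed code_simp

lemma trees_tm: "words (trees_tm a) = {fac tm P 3 | P. odd P = a}"
  unfolding trees_tm_def
  by (intro words_pair_tree[where L = "\<lambda>a. up blk_tm 3 a base_tm"] up_correct[where m = 2])
    (simp_all add: base_tm blk_tm)

lemma thue_morse_automaton:
  "\<exists>A :: (nat, nat) dfa. is_dfa {0, 1} A \<and> card (states A) = 46 \<and>
    (\<forall>n. accepts A (base2 n) \<longleftrightarrow> has_privileged_factor thue_morse n)"
  unfolding has_privileged_factor_iff[of thue_morse tm, OF thue_morse_eq]
  by (rule tm.automaton[OF count_tm _ blk_tm trees_tm]) (simp_all add: col_tm_def)

section \<open>The Rudin--Shapiro sequence\<close>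

abbreviation "rs_morphism \<equiv> (\<lambda>a::nat. if a = 0 then [0, 1] else if a = 1 then [0, 2] else if a = 2 then [3, 1] else [3, 2])"

definition rs_state :: "nat \<Rightarrow> nat" where
  "rs_state n = fixed_point rs_morphism 0 !! n"

definition rs :: "nat \<Rightarrow> bool" where
  "rs n \<longleftrightarrow> 2 \<le> rs_state n"

lemma rs_state_double:
  "rs_state (2 * n) = (if rs_state n < 2 then 0 else 3)"
  "rs_state (2 * n + 1) = (if rs_state n = 0 \<or> rs_state n = 2 then 1 else 2)"
  using fixed_point_uniform[of rs_morphism 0 n] unfolding rs_state_def[symmetric]
  by (simp_all add: less_2_cases_iff)

lemma rs_state_div_2:
  "rs_state n = (if even n then if rs_state (n div 2) < 2 then 0 else 3
     else if rs_state (n div 2) = 0 \<or> rs_state (n div 2) = 2 then 1 else 2)"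
proof (cases "even n")
  case True
  then have "rs_state n = rs_state (2 * (n div 2))" by simp
  then show ?thesis unfolding rs_state_double(1) using True by simp
next
  case False
  then have "rs_state n = rs_state (2 * (n div 2) + 1)" by (metis odd_two_times_div_two_succ)
  then show ?thesis unfolding rs_state_double(2) using False by simp
qed

text \<open>A letter of the fixed point records the coded bit and the parity of its index, which
  allows a recurrence for the bits alone.\<close>

lemma rs_state_eq: "rs_state n = 2 * of_bool (rs n) + of_bool (rs n \<noteq> odd n)"
  unfolding rs_def using rs_state_div_2[of n] by (cases "even n") (simp_all split: if_splits)

lemma rs_rec: "rs n \<longleftrightarrow> rs (n div 2) \<noteq> (odd n \<and> odd (n div 2))"
proof -
  have "rs n \<longleftrightarrow> (if even n then 2 \<le> rs_state (n div 2) else \<not> (rs_state (n div 2) = 0 \<or> rs_state (n div 2) = 2))"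
    unfolding rs_def using rs_state_div_2[of n] by (cases "even n") (simp_all split: if_splits)
  then show ?thesis
    unfolding rs_state_eq[of "n div 2"]
    by (cases "even n"; cases "rs (n div 2)"; cases "even (n div 2)"; simp)
qed

lemma rs_even: "rs (2 * n) = rs n" and rs_odd: "rs (2 * n + 1) \<longleftrightarrow> rs n \<noteq> odd n"
  using rs_rec[of "2 * n"] rs_rec[of "2 * n + 1"] by simp_all

lemma rudin_shapiro_eq: "rudin_shapiro !! n = of_bool (rs n)"
  unfolding rudin_shapiro_def using rs_state_eq[of n] by (simp add: snth_smap rs_state_def)

text \<open>\<open>rs (2 * i)\<close> and \<open>rs (2 * i + 1)\<close> differ exactly for odd
  \<open>i\<close>, which reveals the parity one level up. At an odd position the first complete
  pair belongs to \<open>i + 1\<close>, hence the opposite test.\<close>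

fun con_rs :: "cls \<Rightarrow> bool \<times> cls" where
  "con_rs (a, w) = (a, if a then ((w ! 1 = w ! 2), (w ! 0 \<noteq> (w ! 1 = w ! 2)) # evens (tl w))
     else ((w ! 0 \<noteq> w ! 1), evens w))"

definition blk_rs :: "bool \<Rightarrow> bool \<Rightarrow> bool list" where
  "blk_rs a x = [x, x, x, \<not> x, x \<noteq> a, x \<noteq> a, x = a, x \<noteq> a]"

text \<open>Among the pairs of letters the set of lengths depends on the parity of the position
  only.\<close>

definition col_rs :: "(cls \<times> nat) list" where
  "col_rs = map (\<lambda>w. ((False, w), 0)) pairs @ map (\<lambda>w. ((True, w), 1)) pairs"

definition base_rs :: "bool \<Rightarrow> bool list list" where
  "base_rs a = pairs"

definition trees_rs :: "bool \<Rightarrow> wtree" where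
  "trees_rs = pair_tree (tree (up blk_rs 20 False (\<lambda>b. remdups (up blk_rs 4 b base_rs))))
     (tree (up blk_rs 20 True (\<lambda>b. remdups (up blk_rs 4 b base_rs))))"

text \<open>The initial scan runs to length 8, where \<open>sync_rs\<close> makes the parity a
  function of the word.\<close>

lemma count_rs: "count_states (solve True True 3 8 blk_rs con_rs col_rs [0, 1] trees_rs) = Some 84"
  by code_simp

interpretation rs: desubstitution rs True True 3 con_rs
proof
  show "2 + of_bool True \<le> (3::nat)" by simp
  show "con_rs (cl True rs p m) =
      (odd p, cl True rs (p div 2) ((of_bool (odd p) + m + of_bool True) div 2))" if m: "3 \<le> m" for m p
  proof (cases "even p")
    case True
    then obtain i where p: "p = 2 * i" by blast
    have "evens (fac rs p m) = fac rs i ((m + 1) div 2)"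
      unfolding p using rs_even[of "i + _"] by (intro evens_fac_eq) (simp only: distrib_left)
    moreover have "fac rs p m ! 0 \<noteq> fac rs p m ! 1 \<longleftrightarrow> odd i"
      using m rs_even[of i] rs_odd[of i] by (cases "rs i") (simp_all add: p)
    ultimately show ?thesis using True p by (simp add: cl_def)
  next
    case False
    then obtain i where p: "p = 2 * i + 1" by (rule oddE)
    have "evens (tl (fac rs p m)) = fac rs (i + 1) (m div 2)"
    proof -
      have "rs (2 * i + 1 + 1 + 2 * j) = rs (i + 1 + j)" for j
        using rs_even[of "i + 1 + j"] by (simp add: algebra_simps)
      then have "evens (fac rs (2 * i + 1 + 1) (m - 1)) = fac rs (i + 1) ((m - 1 + 1) div 2)"
        by (rule evens_fac_eq)
      then show ?thesis using m by (simp add: tl_fac p)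
    qed
    moreover have "(1 + m + 1) div 2 = Suc (m div 2)" by simp
    moreover have "fac rs p m ! 0 \<longleftrightarrow> rs i \<noteq> odd i" using m rs_odd[of i] by (simp add: p)
    moreover have "fac rs p m ! 1 = fac rs p m ! 2 \<longleftrightarrow> odd i"
    proof -
      have "p + 1 = 2 * (i + 1)" "p + 2 = 2 * (i + 1) + 1" by (simp_all add: p)
      then have "rs (p + 1) = rs (i + 1)" "rs (p + 2) = (rs (i + 1) \<noteq> odd (i + 1))"
        using rs_even[of "i + 1"] rs_odd[of "i + 1"] by (simp_all only:)
      then show ?thesis using m by (cases "rs (i + 1)") simp_all
    qed
    ultimately show ?thesis using False p by (simp add: cl_def fac_Suc) blast
  qed
  show "cl True rs p m = cl True rs q m"
    if "3 \<le> m" "odd p = odd q" "cl True rs (p div 2) ((of_bool (odd p) + m + of_bool True) div 2) =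
      cl True rs (q div 2) ((of_bool (odd p) + m + of_bool True) div 2)" for m p q
  proof -
    have "rs n = (rs (n div 2) \<noteq> (odd n \<and> (True \<and> odd (n div 2))))" for n using rs_rec[of n] by blast
    from lift_all[where F = "\<lambda>d e x. x \<noteq> (d \<and> e)", OF this that(2)] show ?thesis using that(3) by simp
  qed
qed

lemma blk_rs: "blk_rs (odd P) (rs P) = fac rs (8 * P) 8" "length (blk_rs a x) = 8"
proof -
  show "blk_rs (odd P) (rs P) = fac rs (8 * P) 8"
    unfolding blk_rs_def fac_8
    using rs_rec[of "8 * P"] rs_rec[of "8 * P + 1"] rs_rec[of "8 * P + 2"] rs_rec[of "8 * P + 3"] rs_rec[of "8 * P + 4"] rs_rec[of "8 * P + 5"] rs_rec[of "8 * P + 6"] rs_rec[of "8 * P + 7"]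
      rs_rec[of "4 * P"] rs_rec[of "4 * P + 1"] rs_rec[of "4 * P + 2"] rs_rec[of "4 * P + 3"]
      rs_rec[of "2 * P"] rs_rec[of "2 * P + 1"]
    by (simp add: octal_div_2)
qed (simp add: blk_rs_def)

lemma rs_start: "fac rs 0 2 = [False, False]"
  using rs_even[of 0] rs_odd[of 0] fixed_point_unfold(1)[of rs_morphism 0 "[1]"]
  by (simp add: fac_2 rs_def rs_state_def)

lemma base_rs: "set (base_rs a) = {fac rs P 2 | P. odd P = a}"
proof (rule up_base[OF blk_rs(1) rs_start])
  show "fac rs P 2 \<in> set (base_rs (odd P))" for P
    unfolding base_rs_def by (rule fac_2_in_pairs)
qed code_simp

lemma trees_rs: "words (trees_rs a) = {fac rs P 20 | P. odd P = a}"
proof -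
  have "set (remdups (up blk_rs 4 b base_rs)) = {fac rs P 4 | P. odd P = b}" for b
    unfolding set_remdups by (rule up_correct[OF blk_rs(1) base_rs]) simp
  then show ?thesis
    unfolding trees_rs_def
    by (intro words_pair_tree[where L = "\<lambda>a. up blk_rs 20 a (\<lambda>b. remdups (up blk_rs 4 b base_rs))"]
        up_correct[where m = 4] blk_rs) simp_all
qed

lemma disjoint_rs: "list_all (\<lambda>w. w \<notin> set (up blk_rs 8 True base_rs)) (up blk_rs 8 False base_rs)"
  by code_simp

lemma sync_rs: "fac rs p 8 = fac rs q 8 \<Longrightarrow> odd p = odd q"
  by (rule sync_by_base[OF blk_rs(1) base_rs _ disjoint_rs]) simp_all

lemma rudin_shapiro_automaton:
  "\<exists>A :: (nat, nat) dfa. is_dfa {0, 1} A \<and> card (states A) = 84 \<and>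
    (\<forall>n. accepts A (base2 n) \<longleftrightarrow> has_privileged_factor rudin_shapiro n)"
  unfolding has_privileged_factor_iff[of rudin_shapiro rs, OF rudin_shapiro_eq]
  by (rule rs.automaton[OF count_rs _ blk_rs trees_rs sync_rs]) (simp_all add: col_rs_def pairs_def)

section \<open>The ordinary paperfolding sequence\<close>

definition pf :: "nat \<Rightarrow> bool" where
  "pf n \<longleftrightarrow> paperfolding_nth n = 1"

lemma pf_odd: "pf (2 * n + 1) = pf n" and pf_even: "pf (2 * n) = odd n"
proof -
  show "pf (2 * n + 1) = pf n" by (simp only: pf_def paperfolding_nth.simps)
  show "pf (2 * n) = odd n"
  proof (cases "even n")
    case True
    then obtain k where "n = 2 * k" by blast
    then have "paperfolding_nth (2 * n) = 0" using paperfolding_nth.simps(2)[of k] by simp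
    then show ?thesis using True by (simp add: pf_def)
  next
    case False
    then obtain k where "n = 2 * k + 1" by (rule oddE)
    then have "2 * n = 4 * k + 2" by simp
    then have "paperfolding_nth (2 * n) = 1" by (simp only: paperfolding_nth.simps)
    then show ?thesis using False by (simp add: pf_def)
  qed
qed

lemma pf_rec: "pf n \<longleftrightarrow> (if odd n then pf (n div 2) else odd (n div 2))"
proof (cases "even n")
  case True
  then show ?thesis using pf_even[of "n div 2"] by simp
next
  case False
  then have "pf n = pf (2 * (n div 2) + 1)" by (metis odd_two_times_div_two_succ)
  then show ?thesis unfolding pf_odd using False by simp
qed

lemma paperfolding_eq: "paperfolding !! n = of_bool (pf n)"
proof -
  have "paperfolding_nth n \<le> 1"
  proof (induction n rule: paperfolding_nth.induct)
    case (1 n)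
    then show ?case unfolding paperfolding_nth.simps(1) .
  next
    case (2 n)
    show ?case unfolding paperfolding_nth.simps(2) by simp
  next
    case (3 n)
    show ?case unfolding paperfolding_nth.simps(3) by simp
  qed
  then show ?thesis by (auto simp: paperfolding_def pf_def snth_smap)
qed

text \<open>A letter at \<open>2 * i\<close> shows the parity of \<open>i\<close>, a letter at
  \<open>2 * i + 1\<close> the letter above. From an odd position the next even one belongs to
  \<open>i + 1\<close>, hence the negation.\<close>

fun con_pf :: "cls \<Rightarrow> bool \<times> cls" where
  "con_pf (a, w) = (a, if a then (\<not> w ! 1, evens w) else (w ! 0, evens (tl w)))"

definition blk_pf :: "bool \<Rightarrow> bool \<Rightarrow> bool list" where
  "blk_pf a x = [False, False, True, a, False, True, True, x]"

definition col_pf :: "(cls \<times> nat) list" where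
  "col_pf = [((False, [False]), 0), ((False, [True]), 0), ((True, [False]), 1), ((True, [True]), 1)]"

definition base_pf :: "bool \<Rightarrow> bool list list" where
  "base_pf a = pairs"

definition trees_pf :: "bool \<Rightarrow> wtree" where
  "trees_pf = pair_tree (tree (up blk_pf 6 False base_pf)) (tree (up blk_pf 6 True base_pf))"

lemma count_pf: "count_states (solve True False 2 7 blk_pf con_pf col_pf [0, 1] trees_pf) = Some 47"
  by code_simp

interpretation pf: desubstitution pf True False 2 con_pf
proof
  show "2 + of_bool False \<le> (2::nat)" by simp
  show "con_pf (cl True pf p m) =
      (odd p, cl True pf (p div 2) ((of_bool (odd p) + m + of_bool False) div 2))" if m: "2 \<le> m" for m p
  proof (cases "even p")
    case True
    then obtain i where p: "p = 2 * i" by blast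
    have "pf (2 * i + 1 + 2 * j) = pf (i + j)" for j
      using pf_odd[of "i + j"] by (simp add: algebra_simps)
    then have "evens (fac pf (2 * i + 1) (m - 1)) = fac pf i ((m - 1 + 1) div 2)"
      by (rule evens_fac_eq)
    then have "evens (tl (fac pf p m)) = fac pf i (m div 2)" using m by (simp add: tl_fac p)
    then show ?thesis using True m pf_even[of i] by (simp add: cl_def p)
  next
    case False
    then obtain i where p: "p = 2 * i + 1" by (rule oddE)
    have "pf (2 * i + 1 + 2 * j) = pf (i + j)" for j
      using pf_odd[of "i + j"] by (simp add: algebra_simps)
    then have "evens (fac pf p m) = fac pf i ((m + 1) div 2)" unfolding p by (rule evens_fac_eq)
    moreover have "pf (p + 1) = even i" using pf_even[of "i + 1"] by (simp add: p)
    ultimately show ?thesis using False m by (simp add: cl_def p)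
  qed
  show "cl True pf p m = cl True pf q m"
    if "2 \<le> m" "odd p = odd q" "cl True pf (p div 2) ((of_bool (odd p) + m + of_bool False) div 2) =
      cl True pf (q div 2) ((of_bool (odd p) + m + of_bool False) div 2)" for m p q
  proof -
    \<comment> \<open>Guarding the letter above by \<open>odd n\<close> exhibits that even positions
      ignore it, as \<open>lift_odd\<close> demands.\<close>
    have "pf n = (if odd n then odd n \<and> pf (n div 2) else True \<and> odd (n div 2))" for n
      using pf_rec[of n] by (cases "odd n") simp_all
    from lift_odd[where F = "\<lambda>d e x. if d then x else e", OF this that(2)] show ?thesis using that(3) by simp
  qed
qed

lemma blk_pf: "blk_pf (odd P) (pf P) = fac pf (8 * P) 8" "length (blk_pf a x) = 8"
proof -
  show "blk_pf (odd P) (pf P) = fac pf (8 * P) 8"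
    unfolding blk_pf_def fac_8
    using pf_rec[of "8 * P"] pf_rec[of "8 * P + 1"] pf_rec[of "8 * P + 2"] pf_rec[of "8 * P + 3"] pf_rec[of "8 * P + 4"] pf_rec[of "8 * P + 5"] pf_rec[of "8 * P + 6"] pf_rec[of "8 * P + 7"]
      pf_rec[of "4 * P"] pf_rec[of "4 * P + 1"] pf_rec[of "4 * P + 2"] pf_rec[of "4 * P + 3"]
      pf_rec[of "2 * P"] pf_rec[of "2 * P + 1"]
    by (simp add: octal_div_2)
qed (simp add: blk_pf_def)

lemma pf_start: "fac pf 0 2 = [False, False]"
  using pf_even[of 0] pf_odd[of 0] by (simp add: fac_2)

lemma base_pf: "set (base_pf a) = {fac pf P 2 | P. odd P = a}"
proof (rule up_base[OF blk_pf(1) pf_start])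
  show "fac pf P 2 \<in> set (base_pf (odd P))" for P
    unfolding base_pf_def by (rule fac_2_in_pairs)
qed code_simp

lemma trees_pf: "words (trees_pf a) = {fac pf P 6 | P. odd P = a}"
  unfolding trees_pf_def
  by (intro words_pair_tree[where L = "\<lambda>a. up blk_pf 6 a base_pf"] up_correct[where m = 2])
    (simp_all add: base_pf blk_pf)

lemma disjoint_pf: "list_all (\<lambda>w. w \<notin> set (up blk_pf 7 True base_pf)) (up blk_pf 7 False base_pf)"
  by code_simp

lemma sync_pf: "fac pf p 7 = fac pf q 7 \<Longrightarrow> odd p = odd q"
  by (rule sync_by_base[OF blk_pf(1) base_pf _ disjoint_pf]) simp_all

lemma paperfolding_automaton:
  "\<exists>A :: (nat, nat) dfa. is_dfa {0, 1} A \<and> card (states A) = 47 \<and>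
    (\<forall>n. accepts A (base2 n) \<longleftrightarrow> has_privileged_factor paperfolding n)"
  unfolding has_privileged_factor_iff[of paperfolding pf, OF paperfolding_eq]
  by (rule pf.automaton[OF count_pf _ blk_pf trees_pf sync_pf]) (simp_all add: col_pf_def)

section \<open>The period-doubling sequence\<close>

definition pd :: "nat \<Rightarrow> bool" where
  "pd n \<longleftrightarrow> period_doubling !! n = 1"

lemma period_doubling_nth:
  "period_doubling !! (2 * n) = 1"
  "period_doubling !! (2 * n + 1) = (if period_doubling !! n = 1 then 0 else 1)"
  using fixed_point_uniform[of "\<lambda>a::nat. if a = 1 then [1, 0] else [1, 1]" 1 n]
  unfolding period_doubling_def by simp_all

lemma period_doubling_div_2:
  "period_doubling !! n = (if odd n \<and> period_doubling !! (n div 2) = 1 then 0 else 1)"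
proof (cases "even n")
  case True
  then have "period_doubling !! n = period_doubling !! (2 * (n div 2))" by simp
  then show ?thesis unfolding period_doubling_nth(1) using True by simp
next
  case False
  then have "period_doubling !! n = period_doubling !! (2 * (n div 2) + 1)" by (metis odd_two_times_div_two_succ)
  then show ?thesis unfolding period_doubling_nth(2) using False by simp
qed

lemma period_doubling_eq: "period_doubling !! n = of_bool (pd n)"
  unfolding pd_def using period_doubling_div_2[of n] by (simp split: if_splits)

lemma pd_rec: "pd n \<longleftrightarrow> (odd n \<longrightarrow> \<not> pd (n div 2))"
  using period_doubling_div_2[of n] unfolding pd_def by (simp split: if_splits)

lemma pd_even: "pd (2 * n)" and pd_odd: "pd (2 * n + 1) = (\<not> pd n)"
  using pd_rec[of "2 * n"] pd_rec[of "2 * n + 1"] by simp_all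

text \<open>Even positions carry \<open>True\<close>. At odd positions, \<open>True\<close> at
  distance two would come from adjacent \<open>False\<close> letters above, which do not
  occur.\<close>

definition par_pd :: "bool list \<Rightarrow> bool" where
  "par_pd w \<longleftrightarrow> \<not> (w ! 0 \<and> w ! 2)"

fun con_pd :: "cls \<Rightarrow> bool \<times> cls" where
  "con_pd (a, w) = (par_pd w, False, map Not (evens (if par_pd w then w else tl w)))"

definition blk_pd :: "bool \<Rightarrow> bool \<Rightarrow> bool list" where
  "blk_pd a x = [True, False, True, True, True, False, True, \<not> x]"

text \<open>The only base classes that the search reaches; an unlisted one would make
  \<open>desc\<close> fail.\<close>

definition col_pd :: "(cls \<times> nat) list" where
  "col_pd = [((False, [False]), 0), ((False, [True]), 1), ((False, [True, True]), 2)]"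

definition base_pd :: "bool \<Rightarrow> bool list list" where
  "base_pd a = (if a then [[False, True], [True, True]] else [[True, False], [True, True]])"

definition trees_pd :: "bool \<Rightarrow> wtree" where
  "trees_pd = pair_tree (tree (up blk_pd 3 False base_pd)) (tree (up blk_pd 3 True base_pd))"

lemma par_pd_correct:
  assumes "3 \<le> m"
  shows "par_pd (fac pd p m) = odd p"
proof (cases "even p")
  case True
  then obtain i where p: "p = 2 * i" by blast
  have "pd p" "pd (p + 2)" using pd_even[of i] pd_even[of "i + 1"] by (simp_all add: p)
  then show ?thesis using assms True by (simp add: par_pd_def)
next
  case False
  then obtain i where p: "p = 2 * i + 1" by (rule oddE)
  have "pd p = (\<not> pd i)" "pd (p + 2) = (\<not> pd (i + 1))"
    using pd_odd[of i] pd_odd[of "i + 1"] by (simp_all add: p)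
  moreover have "pd i \<or> pd (i + 1)"
    using pd_rec[of i] pd_rec[of "i + 1"] by auto
  ultimately show ?thesis using assms False by (simp add: par_pd_def)
qed

interpretation pd: desubstitution pd False False 3 con_pd
proof
  show "2 + of_bool False \<le> (3::nat)" by simp
  show "con_pd (cl False pd p m) =
      (odd p, cl False pd (p div 2) ((of_bool (odd p) + m + of_bool False) div 2))" if m: "3 \<le> m" for m p
  proof (cases "even p")
    case True
    then obtain i where p: "p = 2 * i" by blast
    have "pd (2 * i + 1 + 2 * j) = (\<not> pd (i + j))" for j
      using pd_odd[of "i + j"] by (simp add: algebra_simps)
    then have "evens (fac pd (2 * i + 1) (m - 1)) = fac (\<lambda>n. \<not> pd n) i ((m - 1 + 1) div 2)"
      by (rule evens_fac_eq)
    then have "map Not (evens (tl (fac pd p m))) = fac pd i (m div 2)"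
      using m by (simp add: tl_fac p) (simp add: fac_def)
    then show ?thesis using par_pd_correct[OF m, of p] True by (simp add: cl_def p)
  next
    case False
    then obtain i where p: "p = 2 * i + 1" by (rule oddE)
    have "pd (2 * i + 1 + 2 * j) = (\<not> pd (i + j))" for j
      using pd_odd[of "i + j"] by (simp add: algebra_simps)
    then have "evens (fac pd p m) = fac (\<lambda>n. \<not> pd n) i ((m + 1) div 2)" unfolding p by (rule evens_fac_eq)
    then have "map Not (evens (fac pd p m)) = fac pd i ((m + 1) div 2)" by (simp add: fac_def)
    then show ?thesis using par_pd_correct[OF m, of p] False by (simp add: cl_def p)
  qed
  show "cl False pd p m = cl False pd q m"
    if "3 \<le> m" "odd p = odd q" "cl False pd (p div 2) ((of_bool (odd p) + m + of_bool False) div 2) =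
      cl False pd (q div 2) ((of_bool (odd p) + m + of_bool False) div 2)" for m p q
  proof -
    have "pd n = (odd n \<longrightarrow> \<not> (odd n \<and> pd (n div 2)))" for n using pd_rec[of n] by blast
    from lift_odd[where F = "\<lambda>d _ x. d \<longrightarrow> \<not> x", OF this that(2)] show ?thesis using that(3) by simp
  qed
qed

lemma blk_pd: "blk_pd (odd P) (pd P) = fac pd (8 * P) 8" "length (blk_pd a x) = 8"
proof -
  show "blk_pd (odd P) (pd P) = fac pd (8 * P) 8"
    unfolding blk_pd_def fac_8
    using pd_rec[of "8 * P"] pd_rec[of "8 * P + 1"] pd_rec[of "8 * P + 2"] pd_rec[of "8 * P + 3"] pd_rec[of "8 * P + 4"] pd_rec[of "8 * P + 5"] pd_rec[of "8 * P + 6"] pd_rec[of "8 * P + 7"]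
      pd_rec[of "4 * P"] pd_rec[of "4 * P + 1"] pd_rec[of "4 * P + 2"] pd_rec[of "4 * P + 3"]
      pd_rec[of "2 * P"] pd_rec[of "2 * P + 1"]
    by (simp add: octal_div_2)
qed (simp add: blk_pd_def)

lemma pd_start: "fac pd 0 2 = [True, False]"
  using pd_even[of 0] pd_odd[of 0] by (simp add: fac_2)

lemma base_pd: "set (base_pd a) = {fac pd P 2 | P. odd P = a}"
proof (rule up_base[OF blk_pd(1) pd_start])
  show "fac pd P 2 \<in> set (base_pd (odd P))" for P
    using pd_rec[of P] pd_rec[of "P + 1"] by (auto simp: base_pd_def fac_2)
qed code_simp

lemma trees_pd: "words (trees_pd a) = {fac pd P 3 | P. odd P = a}"
  unfolding trees_pd_def
  by (intro words_pair_tree[where L = "\<lambda>a. up blk_pd 3 a base_pd"] up_correct[where m = 2])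
    (simp_all add: base_pd blk_pd)


text \<open>The path \<open>[False, False, True]\<close> names the state for all numbers,
  \<open>[False, True]\<close> for 0 only, \<open>[True, False]\<close> for 0 and 1,
  \<open>[True, True]\<close> for none; \<open>[False, False, False]\<close> is the start.\<close>

definition table_pd :: table where
  "table_pd = Bin
     (Bin (Bin (Tip (True, [True, False], [False, False, True]))
               (Tip (True, [False, False, True], [False, False, True])))
          (Tip (True, [False, True], [True, True])))
     (Bin (Tip (True, [False, True], [False, True])) (Tip (False, [True, True], [True, True])))"

lemma solve_pd:
  "solve False False 3 3 blk_pd con_pd col_pd [0, 1, 2] trees_pd = Some ([False, False, False], table_pd)"
  by code_simp

lemma count_pd: "count_states (solve False False 3 3 blk_pd con_pd col_pd [0, 1, 2] trees_pd) = Some 4"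
  unfolding solve_pd by code_simp

lemma privileged_lengths_period_doubling:
  "has_privileged_factor period_doubling n \<longleftrightarrow> n = 0 \<or> n = 2 \<or> odd n"
proof -
  have all: "lsd table_pd [False, False, True] n" for n
  proof (induction n rule: less_induct)
    case (less n)
    then show ?case by (subst lsd.simps) (simp add: table_pd_def)
  qed
  have none: "\<not> lsd table_pd [True, True] n" for n
  proof (induction n rule: less_induct)
    case (less n)
    then show ?case by (subst lsd.simps) (simp add: table_pd_def)
  qed
  have zero: "lsd table_pd [False, True] n \<longleftrightarrow> n = 0" for n
  proof (induction n rule: less_induct)
    case (less n)
    show ?case
    proof (cases "n = 0")
      case False
      then show ?thesis using less[of "n div 2"] none[of "n div 2"]
        by (subst lsd.simps) (auto simp: table_pd_def elim!: evenE)
    qed (subst lsd.simps, simp add: table_pd_def)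
  qed
  have one: "lsd table_pd [True, False] n \<longleftrightarrow> n \<le> 1" for n
    using zero[of "n div 2"] by (subst lsd.simps) (auto simp: table_pd_def)
  have "lsd table_pd [False, False, False] n \<longleftrightarrow> n = 0 \<or> n = 2 \<or> odd n"
  proof (cases "even n")
    case True
    then obtain k where "n = 2 * k" by blast
    then show ?thesis using one[of k] by (subst lsd.simps) (auto simp: table_pd_def)
  next
    case False
    then show ?thesis using all[of "n div 2"] by (subst lsd.simps) (simp add: table_pd_def)
  qed
  moreover have "has_privileged_factor period_doubling n \<longleftrightarrow> lsd table_pd [False, False, False] n"
    unfolding has_privileged_factor_iff[of period_doubling pd, OF period_doubling_eq]
    by (rule pd.solve_correct[OF solve_pd _ blk_pd trees_pd]) (simp_all add: col_pd_def)
  ultimately show ?thesis by simp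
qed

lemma period_doubling_automaton:
  "\<exists>A :: (nat, nat) dfa. is_dfa {0, 1} A \<and> card (states A) = 4 \<and>
    (\<forall>n. accepts A (base2 n) \<longleftrightarrow> has_privileged_factor period_doubling n)"
  unfolding has_privileged_factor_iff[of period_doubling pd, OF period_doubling_eq]
  by (rule pd.automaton[OF count_pd _ blk_pd trees_pd]) (simp_all add: col_pd_def)

section \<open>The Fibonacci word\<close>

definition fw :: "nat \<Rightarrow> bool" where
  "fw n \<longleftrightarrow> fibonacci_word !! n = 1"

text \<open>The length of the image of the prefix of length \<open>n\<close> under the Fibonacci morphism.\<close>

primrec phi :: "nat \<Rightarrow> nat" where
  "phi 0 = 0"
| "phi (Suc n) = phi n + (if fibonacci_word !! n = 0 then 2 else 1)"

lemma fibonacci_word_blocks: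
  "fibonacci_word !! phi n = 0" "fibonacci_word !! n = 0 \<Longrightarrow> fibonacci_word !! (phi n + 1) = 1"
proof -
  let ?h = "\<lambda>a::nat. if a = 0 then [0, 1] else [0::nat]" and ?x = fibonacci_word
  have ne: "\<And>b. ?h b \<noteq> []" by simp
  have x: "flat (smap ?h ?x) = ?x"
    using fixed_point_unfold(2)[of ?h 0 "[1]", OF ne] unfolding fibonacci_word_def by simp
  have l: "length (concat (map ?h (stake n ?x))) = phi n" for n
    by (induction n) (simp_all add: stake_Suc del: stake.simps(2))
  have "?x = concat (map ?h (stake n ?x)) @- flat (smap ?h (sdrop n ?x))"
    using flat_smap_stake_sdrop[of ?h ?x n, OF ne] unfolding x .
  also have "flat (smap ?h (sdrop n ?x)) = ?h (?x !! n) @- flat (smap ?h (stl (sdrop n ?x)))"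
    by (subst flat_unfold) (auto simp: sdrop_simps(1))
  finally have e: "?x = concat (map ?h (stake n ?x)) @- ?h (?x !! n) @- flat (smap ?h (stl (sdrop n ?x)))" .
  have *: "(u @- v @- r) !! (length u + i) = v ! i" if "i < length v" for u v :: "nat list" and r and i :: nat
    using that by (simp add: shift_snth_ge shift_snth_less)
  have g: "?x !! (phi n + i) = ?h (?x !! n) ! i" if "i < length (?h (?x !! n))" for i
    using *[OF that, of "concat (map ?h (stake n ?x))" "flat (smap ?h (stl (sdrop n ?x)))"]
    unfolding e[symmetric] l .
  show "?x !! phi n = 0" using g[of 0] by (simp split: if_splits)
  show "?x !! (phi n + 1) = 1" if "?x !! n = 0" using g[of 1] that by simp
qed

lemma phi_cover: "\<exists>k. j = phi k \<or> j = phi k + 1 \<and> fibonacci_word !! k = 0"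
proof (induction j)
  case 0
  show ?case by (intro exI[of _ 0]) simp
next
  case (Suc j)
  then obtain k where "j = phi k \<or> j = phi k + 1 \<and> fibonacci_word !! k = 0" by blast
  then show ?case
  proof (elim disjE conjE)
    assume j: "j = phi k"
    show ?thesis
    proof (cases "fibonacci_word !! k = 0")
      case True
      then show ?thesis using j by (intro exI[of _ k]) simp
    next
      case False
      then show ?thesis using j by (intro exI[of _ "Suc k"]) simp
    qed
  next
    assume "j = phi k + 1" "fibonacci_word !! k = 0"
    then show ?thesis by (intro exI[of _ "Suc k"]) simp
  qed
qed

lemma fibonacci_word_eq: "fibonacci_word !! n = of_bool (fw n)"
proof -
  obtain k where "n = phi k \<or> n = phi k + 1 \<and> fibonacci_word !! k = 0" using phi_cover by blast
  then have "fibonacci_word !! n = 0 \<or> fibonacci_word !! n = 1"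
    using fibonacci_word_blocks[of k] by metis
  then show ?thesis by (auto simp: fw_def)
qed

lemma phi_Suc: "phi (Suc n) = phi n + (if fw n then 1 else 2)"
  by (simp add: fibonacci_word_eq)

declare phi.simps(2) [simp del]

lemma strict_mono_phi: "strict_mono phi"
  by (simp add: strict_mono_Suc_iff phi_Suc)

lemma phi_less_iff [simp]: "phi m < phi n \<longleftrightarrow> m < n"
  using strict_mono_phi by (rule strict_mono_less)

lemma phi_eq_iff [simp]: "phi m = phi n \<longleftrightarrow> m = n"
  using strict_mono_phi by (rule strict_mono_eq)

lemma not_fw_phi [simp]: "\<not> fw (phi k)"
  using fibonacci_word_blocks(1)[of k] by (simp add: fw_def)

lemma fw_phi_1 [simp]: "fw (Suc (phi k)) \<longleftrightarrow> \<not> fw k"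
proof (cases "fw k")
  case True
  then have "Suc (phi k) = phi (Suc k)" by (simp add: phi_Suc)
  then show ?thesis using True not_fw_phi[of "Suc k"] by simp
next
  case False
  then have "fibonacci_word !! k = 0" by (simp add: fibonacci_word_eq)
  then have "fibonacci_word !! (phi k + 1) = 1" by (rule fibonacci_word_blocks(2))
  then have "fw (phi k + 1)" unfolding fw_def .
  then show ?thesis using False by simp
qed

text \<open>Every block contains exactly one 0, as its first letter, so zeros mark the block
  boundaries.\<close>

lemma not_fw_cases: "\<not> fw j \<longleftrightarrow> (\<exists>k. j = phi k)"
  and fw_cases: "fw j \<longleftrightarrow> (\<exists>k. j = Suc (phi k) \<and> \<not> fw k)"
proof -
  obtain k where "j = phi k \<or> j = phi k + 1 \<and> fibonacci_word !! k = 0" using phi_cover by blast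
  then have k: "j = phi k \<or> j = Suc (phi k) \<and> \<not> fw k" by (auto simp: fibonacci_word_eq)
  show "\<not> fw j \<longleftrightarrow> (\<exists>k. j = phi k)"
  proof
    assume "\<not> fw j"
    then have "j = phi k" using k by auto
    then show "\<exists>k. j = phi k" by blast
  next
    assume "\<exists>k. j = phi k"
    then show "\<not> fw j" by auto
  qed
  show "fw j \<longleftrightarrow> (\<exists>k. j = Suc (phi k) \<and> \<not> fw k)"
  proof
    assume "fw j"
    then have "j = Suc (phi k) \<and> \<not> fw k" using k by auto
    then show "\<exists>k. j = Suc (phi k) \<and> \<not> fw k" by blast
  next
    assume "\<exists>k. j = Suc (phi k) \<and> \<not> fw k"
    then show "fw j" by auto
  qed
qed

lemma no_two_ones:
  assumes "fw j"
  shows "\<not> fw (Suc j)"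
proof -
  obtain k where "j = Suc (phi k)" "\<not> fw k" using assms fw_cases by blast
  then have "Suc j = phi (Suc k)" by (simp add: phi_Suc)
  then show ?thesis by simp
qed

text \<open>By letters: the second images of 0 and 1 have lengths \<open>3 = 2 + 1\<close> and
  \<open>2 = 1 + 1\<close>.\<close>

lemma phi_phi: "phi (phi k) = phi k + k"
proof (induction k)
  case (Suc k)
  show ?case
  proof (cases "fw k")
    case True
    then show ?thesis using Suc phi_Suc[of "phi k"] by (simp add: phi_Suc[of k])
  next
    case False
    then show ?thesis using Suc phi_Suc[of "phi k"] phi_Suc[of "Suc (phi k)"] by (simp add: phi_Suc[of k])
  qed
qed simp

lemma phi_phi_1: "phi (Suc (phi k)) = phi k + k + 2"
  by (simp add: phi_Suc[of "phi k"] phi_phi)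

text \<open>The length of the image of the factor of length \<open>m\<close> at
  \<open>k\<close>.\<close>

definition blen :: "nat \<Rightarrow> nat \<Rightarrow> nat" where
  "blen k m = phi (k + m) - phi k"

lemma phi_add: "phi (k + m) = phi k + blen k m"
proof -
  have "phi k \<le> phi (k + m)" using strict_mono_phi by (simp add: strict_mono_less_eq)
  then show ?thesis by (simp add: blen_def)
qed

lemma blen_0 [simp]: "blen k 0 = 0"
  by (simp add: blen_def)

lemma blen_Suc: "blen k (Suc m) = blen k m + (if fw (k + m) then 1 else 2)"
  using phi_add[of k "Suc m"] phi_add[of k m] phi_Suc[of "k + m"] by simp

lemma blen_cong: "fac fw k' m = fac fw k m \<Longrightarrow> blen k' m = blen k m"
proof (induction m)
  case (Suc m)
  then have "fac fw k' m = fac fw k m" "fw (k' + m) = fw (k + m)" by (auto simp: fac_eq_iff)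
  then show ?case using Suc.IH by (simp add: blen_Suc)
qed simp

lemma fac_Suc_eq_iff: "fac s p (Suc m) = fac s q (Suc m) \<longleftrightarrow> fac s p m = fac s q m \<and> s (p + m) = s (q + m)"
  by (auto simp: fac_eq_iff less_Suc_eq)

text \<open>The words \<open>h(y)0\<close>: the final 0 opens a new block and so shows whether the
  block before it was \<open>0\<close> or \<open>01\<close>.\<close>

lemma occurrence_0:
  "fac fw q (Suc (blen k m)) = fac fw (phi k) (Suc (blen k m)) \<longleftrightarrow> (\<exists>k'. q = phi k' \<and> fac fw k' m = fac fw k m)"
proof (induction m arbitrary: q)
  case 0
  show ?case by (simp add: fac_Suc not_fw_cases)
next
  case (Suc m)
  have step: "fac fw (phi k') (Suc (blen k (Suc m))) = fac fw (phi k) (Suc (blen k (Suc m))) \<longleftrightarrow> fw (k' + m) = fw (k + m)"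
    if eq: "fac fw k' m = fac fw k m" for k'
  proof -
    have pre: "fac fw (phi k') (Suc (blen k m)) = fac fw (phi k) (Suc (blen k m))" using Suc.IH[of "phi k'"] eq by blast
    have p': "phi k' + blen k m = phi (k' + m)" using blen_cong[OF eq] phi_add[of k' m] by simp
    have p: "phi k + blen k m = phi (k + m)" using phi_add[of k m] by simp
    have s1: "fw (phi k' + Suc (blen k m)) = (\<not> fw (k' + m))" "fw (phi k + Suc (blen k m)) = (\<not> fw (k + m))"
      using fw_phi_1[of "k' + m"] fw_phi_1[of "k + m"] unfolding p[symmetric] p'[symmetric] by simp_all
    show ?thesis
    proof (cases "fw (k + m)")
      case True
      then show ?thesis using pre s1 by (simp add: blen_Suc fac_Suc_eq_iff)
    next
      case False
      have "\<not> fw (k' + m) \<Longrightarrow> \<not> fw (phi k' + Suc (Suc (blen k m)))"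
        using no_two_ones[of "phi k' + Suc (blen k m)"] s1(1) by simp
      moreover have "\<not> fw (phi k + Suc (Suc (blen k m)))"
        using no_two_ones[of "phi k + Suc (blen k m)"] s1(2) False by simp
      ultimately show ?thesis using False pre s1 by (auto simp: blen_Suc fac_Suc_eq_iff)
    qed
  qed
  show ?case
  proof
    assume eq: "fac fw q (Suc (blen k (Suc m))) = fac fw (phi k) (Suc (blen k (Suc m)))"
    then have "fac fw q (Suc (blen k m)) = fac fw (phi k) (Suc (blen k m))"
      by (auto simp: fac_eq_iff blen_Suc)
    then obtain k' where "q = phi k'" "fac fw k' m = fac fw k m" using Suc.IH[of q] by blast
    then show "\<exists>k'. q = phi k' \<and> fac fw k' (Suc m) = fac fw k (Suc m)"
      using step[of k'] eq by (auto simp: fac_Suc_eq_iff)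
  next
    assume "\<exists>k'. q = phi k' \<and> fac fw k' (Suc m) = fac fw k (Suc m)"
    then show "fac fw q (Suc (blen k (Suc m))) = fac fw (phi k) (Suc (blen k (Suc m)))"
      using step by (auto simp: fac_Suc_eq_iff[of fw _ m])
  qed
qed

lemma blen_ge: "m \<le> blen k m"
  by (induction m) (auto simp: blen_Suc)

text \<open>The image of a word \<open>y\<close> that begins and ends with 0, without its first
  letter, begins and ends with 1. As \<open>11\<close> does not occur, zeros surround it everywhere,
  so it occurs one position after the occurrences of \<open>h(y)0\<close>.\<close>

lemma occurrence_1:
  assumes k: "\<not> fw k" and m: "1 \<le> m" "\<not> fw (k + m - 1)"
  shows "fac fw q (blen k m - 1) = fac fw (Suc (phi k)) (blen k m - 1) \<longleftrightarrow>
    (\<exists>k'. q = Suc (phi k') \<and> fac fw k' m = fac fw k m)"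
proof -
  obtain m' where m': "m = Suc m'" using m(1) by (cases m) auto
  define l where "l = blen k m'"
  have bl: "blen k m = Suc (Suc l)" using m(2) by (simp add: m' l_def blen_Suc)
  have p: "phi k + l = phi (k + m')" using phi_add[of k m'] by (simp add: l_def)
  have last: "fw (Suc (phi k + l))" "\<not> fw (Suc (Suc (phi k + l)))"
    using m(2) no_two_ones[of "Suc (phi k + l)"] unfolding p by (simp_all add: m')
  have first: "fw (Suc (phi k))" using k by simp
  show ?thesis
  proof
    assume eq: "fac fw q (blen k m - 1) = fac fw (Suc (phi k)) (blen k m - 1)"
    then have e: "fw (q + i) = fw (Suc (phi k) + i)" if "i \<le> l" for i
      using that by (simp add: bl fac_eq_iff less_Suc_eq_le)
    have "fw q" using e[of 0] first by simp
    then obtain k' where q: "q = Suc (phi k')" "\<not> fw k'" using fw_cases by blast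
    have "fw (phi k' + i) = fw (phi k + i)" if "i \<le> Suc (Suc l)" for i
    proof (cases i)
      case (Suc j)
      show ?thesis
      proof (cases "j \<le> l")
        case True
        then show ?thesis using e[of j] by (simp add: q Suc)
      next
        case False
        then have j: "j = Suc l" using that Suc by simp
        have "fw (Suc (phi k' + l))" using e[of l] last by (simp add: q)
        then have "\<not> fw (Suc (Suc (phi k' + l)))" by (rule no_two_ones)
        then show ?thesis using last(2) by (simp add: Suc j)
      qed
    qed simp
    then have "fac fw (phi k') (Suc (blen k m)) = fac fw (phi k) (Suc (blen k m))"
      by (simp add: fac_eq_iff bl less_Suc_eq_le)
    then have "fac fw k' m = fac fw k m" using occurrence_0[of "phi k'" k m] by auto
    then show "\<exists>k'. q = Suc (phi k') \<and> fac fw k' m = fac fw k m" using q(1) by blast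
  next
    assume "\<exists>k'. q = Suc (phi k') \<and> fac fw k' m = fac fw k m"
    then obtain k' where q: "q = Suc (phi k')" "fac fw k' m = fac fw k m" by blast
    then have "fac fw (phi k') (Suc (blen k m)) = fac fw (phi k) (Suc (blen k m))"
      using occurrence_0[of "phi k'" k m] by blast
    then have e: "fw (phi k' + i) = fw (phi k + i)" if "i < Suc (blen k m)" for i
      using that by (simp add: fac_eq_iff)
    show "fac fw q (blen k m - 1) = fac fw (Suc (phi k)) (blen k m - 1)"
      unfolding fac_eq_iff q(1)
    proof (intro allI impI)
      fix i assume "i < blen k m - 1"
      then show "fw (Suc (phi k') + i) = fw (Suc (phi k) + i)" using e[of "Suc i"] by simp
    qed
  qed
qed

abbreviation "fpriv \<equiv> \<lambda>i n. chain (fac fw) i 0 n"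

lemma chain_from_0: "chain (fac s) i 0 n \<longleftrightarrow> n = 0 \<or> chain (fac s) i 1 n"
proof -
  have "nxt (fac s) i 0 (Suc i)" by (simp add: nxt_def)
  from chain_unfold[OF this] show ?thesis by simp
qed

lemma blen_shift:
  assumes "k < q" "fac fw q m = fac fw k m"
  shows "phi q - phi k + blen k m = blen k (q - k + m)"
proof -
  have "phi (q + m) = phi q + blen k m" using phi_add[of q m] blen_cong[OF assms(2)] by simp
  moreover have "phi (q + m) = phi k + blen k (q - k + m)" using phi_add[of k "q - k + m"] assms(1) by simp
  moreover have "phi k < phi q" using assms(1) by simp
  ultimately show ?thesis by linarith
qed

text \<open>The chain of \<open>y\<close> from length 0 becomes the chain of \<open>h(y)0\<close>
  from length 1; length 0 is added separately.\<close>

lemma fpriv_0: "fpriv (phi k) n \<longleftrightarrow> n = 0 \<or> (\<exists>m. n = blen k m + 1 \<and> fpriv k m)"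
proof -
  have "chain (fac fw) (phi k) (blen k 0 + 1) n \<longleftrightarrow> (\<exists>m. n = blen k m + 1 \<and> chain (fac fw) k 0 m)"
  proof (rule chain_transport_on[where g = phi and Q = "\<lambda>_. True" and l = "\<lambda>m. blen k m + 1"])
    show "fac fw q (blen k m + 1) = fac fw (phi k) (blen k m + 1) \<longleftrightarrow>
        (\<exists>q'. q = phi q' \<and> fac fw q' m = fac fw k m)" for m q
      using occurrence_0[of q k m] by simp
    show "phi q' - phi k + (blen k m + 1) = blen k (q' - k + m) + 1"
      if "k < q'" "fac fw q' m = fac fw k m" for m q'
      using blen_shift[OF that] by simp
  qed (simp_all add: strict_mono_phi)
  then show ?thesis using chain_from_0[of fw "phi k" n] by simp
qed

text \<open>The chain starts with \<open>y = 0\<close>, whose shortened image is the letter 1.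
  \<open>Q\<close> records that \<open>y\<close> ends with 0; steps preserve this because a complete
  return ends with the old word.\<close>

lemma fpriv_1:
  assumes k: "\<not> fw k"
  shows "fpriv (Suc (phi k)) n \<longleftrightarrow> n = 0 \<or> (\<exists>m\<ge>1. n + 1 = blen k m \<and> fpriv k m)"
proof -
  have b1: "blen k 1 - 1 = 1" using k blen_Suc[of k 0] by simp
  have "chain (fac fw) (Suc (phi k)) (blen k 1 - 1) n \<longleftrightarrow> (\<exists>m. n = blen k m - 1 \<and> chain (fac fw) k 1 m)"
  proof (rule chain_transport_on[where g = "\<lambda>q. Suc (phi q)" and Q = "\<lambda>m. 1 \<le> m \<and> \<not> fw (k + m - 1)"
        and l = "\<lambda>m. blen k m - 1"])
    show "strict_mono (\<lambda>q. Suc (phi q))" by (simp add: strict_mono_def)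
    show "fac fw q (blen k m - 1) = fac fw (Suc (phi k)) (blen k m - 1) \<longleftrightarrow>
        (\<exists>q'. q = Suc (phi q') \<and> fac fw q' m = fac fw k m)" if "1 \<le> m \<and> \<not> fw (k + m - 1)" for m q
      using occurrence_1[OF k] that by blast
    fix m q' assume m: "1 \<le> m \<and> \<not> fw (k + m - 1)" and q': "k < q'" "fac fw q' m = fac fw k m"
    have "1 \<le> blen k m" using blen_ge[of m k] m by linarith
    then show "Suc (phi q') - Suc (phi k) + (blen k m - 1) = blen k (q' - k + m) - 1"
      using blen_shift[OF q'] by simp
    have "m - 1 < m" using m by simp
    then have "fw (q' + (m - 1)) = fw (k + (m - 1))" using q'(2) unfolding fac_eq_iff by blast
    moreover have "k + (q' - k + m) - 1 = q' + (m - 1)" using q'(1) m by simp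
    ultimately show "1 \<le> q' - k + m \<and> \<not> fw (k + (q' - k + m) - 1)" using m by simp
  qed (use k in simp_all)
  moreover have "n = blen k m - 1 \<longleftrightarrow> n + 1 = blen k m" if "1 \<le> m" for m
    using blen_ge[of m k] that by linarith
  moreover have "chain (fac fw) k 1 m \<longleftrightarrow> 1 \<le> m \<and> fpriv k m" for m
    using chain_from_0[of fw k m] chain_le[of "fac fw" k 1 m] by auto
  ultimately show ?thesis using chain_from_0[of fw "Suc (phi k)" n] b1 by auto
qed

section \<open>Privileged factors of the Fibonacci word without positions\<close>

fun blocks_of :: "bool list \<Rightarrow> bool list" where
  "blocks_of [] = []"
| "blocks_of (True # w) = False # blocks_of w"
| "blocks_of (False # w) = False # True # blocks_of w"

lemma blocks_of_append [simp]: "blocks_of (u @ v) = blocks_of u @ blocks_of v"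
  by (induction u rule: blocks_of.induct) auto

lemma blocks_of_neq_True [simp]: "blocks_of w \<noteq> True # v"
  by (cases w rule: blocks_of.cases) auto

lemmas True_neq_blocks_of [simp] = blocks_of_neq_True[symmetric]

lemma blocks_of_inj: "blocks_of u = blocks_of v \<Longrightarrow> u = v"
proof (induction u arbitrary: v rule: blocks_of.induct)
  case 1
  then show ?case by (cases v rule: blocks_of.cases) auto
next
  case (2 w)
  then show ?case by (cases v rule: blocks_of.cases) (auto dest: sym)
next
  case (3 w)
  then show ?case by (cases v rule: blocks_of.cases) auto
qed

lemma fac_phi: "fac fw (phi k) (blen k m) = blocks_of (fac fw k m)"
proof (induction m)
  case (Suc m)
  have p: "phi k + blen k m = phi (k + m)" using phi_add[of k m] by simp
  have "fac fw (phi (k + m)) (if fw (k + m) then 1 else 2) = blocks_of [fw (k + m)]"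
    by (cases "fw (k + m)") (simp_all add: fac_Suc numeral_2_eq_2)
  moreover have "fac fw k (Suc m) = fac fw k m @ [fw (k + m)]" by (simp add: fac_def)
  ultimately show ?case using Suc by (simp add: blen_Suc fac_add p)
qed simp

inductive pword :: "bool list \<Rightarrow> bool" where
  Nil: "pword []"
| zero: "pword y \<Longrightarrow> pword (blocks_of y @ [False])"
| one: "pword (False # y) \<Longrightarrow> pword (True # blocks_of y)"

lemma fac_phi_Suc: "fac fw (phi k) (blen k m + 1) = blocks_of (fac fw k m) @ [False]"
proof -
  have "fac fw (phi (k + m)) 1 = [False]" by (simp add: fac_Suc)
  then show ?thesis unfolding fac_add fac_phi by (simp add: phi_add)
qed

lemma fac_Suc_phi:
  assumes "\<not> fw k" "n + 1 = blen k m" "1 \<le> m"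
  shows "\<exists>y. fac fw k m = False # y \<and> fac fw (Suc (phi k)) n = True # blocks_of y"
proof -
  obtain m' where m': "m = Suc m'" using assms(3) by (cases m) auto
  have y: "fac fw k m = False # fac fw (Suc k) m'" using assms(1) by (simp add: m' fac_Suc)
  have "fac fw (phi k) (Suc n) = blocks_of (fac fw k m)" using fac_phi[of k m] assms(2) by simp
  then show ?thesis unfolding y by (simp add: fac_Suc)
qed

lemma fpriv_pword: "fpriv i n \<Longrightarrow> pword (fac fw i n)"
\<comment> \<open>The measure is the end position: a nonempty factor ends strictly later than its
  preimage.\<close>
proof (induction "i + n" arbitrary: i n rule: less_induct)
  case less
  show ?case
  proof (cases "n = 0")
    case True
    then show ?thesis by (simp add: pword.Nil)
  next
    case False
    have ge: "j \<le> phi j" for j using strict_mono_phi by (rule strict_mono_imp_increasing)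
    show ?thesis
    proof (cases "fw i")
      case True
      then obtain k where i: "i = Suc (phi k)" "\<not> fw k" using fw_cases by blast
      then obtain m where m: "1 \<le> m" "n + 1 = blen k m" "fpriv k m"
        using less.prems fpriv_1[of k n] False by auto
      have "blen k 1 \<le> blen k m" using m(1) strict_mono_phi by (simp add: blen_def strict_mono_less_eq diff_le_mono)
      then have "i + n = phi k + blen k m" using i m(2) by simp
      also have "\<dots> = phi (k + m)" by (simp add: phi_add)
      finally have "i + n = phi (k + m)" .
      moreover have "k + m < phi (k + m)"
      proof -
        obtain j where j: "k + m = Suc j" using m(1) by (cases "k + m") auto
        have "\<not> fw 0" using not_fw_phi[of 0] by simp
        then have "phi 1 = 2" using phi_Suc[of 0] by simp
        have "Suc j < phi (Suc j)" for j
        proof (induction j)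
          case (Suc j)
          then show ?case using phi_Suc[of "Suc j"] by (simp split: if_splits)
        qed (use \<open>phi 1 = 2\<close> in simp)
        then show ?thesis by (simp add: j)
      qed
      ultimately have "pword (fac fw k m)" using less.hyps m(3) by metis
      then show ?thesis using fac_Suc_phi[OF i(2) m(2,1)] pword.one i(1) by metis
    next
      case False
      then obtain k where i: "i = phi k" using not_fw_cases by blast
      then obtain m where m: "n = blen k m + 1" "fpriv k m"
        using less.prems fpriv_0[of k n] \<open>n \<noteq> 0\<close> by auto
      have "k + m < i + n" using ge[of "k + m"] phi_add[of k m] by (simp add: i m(1))
      then have "pword (fac fw k m)" using less.hyps m(2) by blast
      then show ?thesis unfolding i m(1) fac_phi_Suc by (rule pword.zero)
    qed
  qed
qed

lemma pword_fpriv: "pword w \<Longrightarrow> \<exists>i. w = fac fw i (length w) \<and> fpriv i (length w)"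
proof (induction rule: pword.induct)
  case Nil
  show ?case by (simp add: chain.refl)
next
  case (zero y)
  then obtain k where k: "y = fac fw k (length y)" "fpriv k (length y)" by blast
  have "fpriv (phi k) (blen k (length y) + 1)" using k(2) fpriv_0 by blast
  moreover have w: "blocks_of y @ [False] = fac fw (phi k) (blen k (length y) + 1)"
    using fac_phi_Suc[of k "length y"] k(1) by simp
  moreover from w have "length (blocks_of y @ [False]) = blen k (length y) + 1" by (metis length_fac)
  ultimately show ?case by metis
next
  case (one y)
  then obtain k where k: "False # y = fac fw k (Suc (length y))" "fpriv k (Suc (length y))" by auto
  have nf: "\<not> fw k" using k(1) by (simp add: fac_Suc)
  define n where "n = blen k (Suc (length y)) - 1"
  have n: "n + 1 = blen k (Suc (length y))" using blen_ge[of "Suc (length y)" k] by (simp add: n_def)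
  have "fpriv (Suc (phi k)) n" using fpriv_1[OF nf, of n] k(2) n by auto
  moreover have w: "True # blocks_of y = fac fw (Suc (phi k)) n"
    using fac_Suc_phi[OF nf n] k(1) by auto
  moreover from w have "length (True # blocks_of y) = n" by (metis length_fac)
  ultimately show ?case by metis
qed

lemma pword_False: "pword (False # w) \<longleftrightarrow> (\<exists>y. pword y \<and> False # w = blocks_of y @ [False])"
proof
  assume "pword (False # w)"
  then show "\<exists>y. pword y \<and> False # w = blocks_of y @ [False]"
    by (cases rule: pword.cases) auto
next
  assume "\<exists>y. pword y \<and> False # w = blocks_of y @ [False]"
  then obtain y where "pword y" "False # w = blocks_of y @ [False]" by blast
  then show "pword (False # w)" using pword.zero[of y] by simp
qed

lemma pword_True: "pword (True # w) \<longleftrightarrow> (\<exists>y. pword (False # y) \<and> w = blocks_of y)"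
proof
  assume "pword (True # w)"
  then show "\<exists>y. pword (False # y) \<and> w = blocks_of y"
  proof (cases rule: pword.cases)
    case (zero y)
    then show ?thesis by (cases y rule: blocks_of.cases) auto
  qed auto
qed (use pword.one in blast)

lemma pword_single [simp]: "pword [a]"
proof -
  have "pword [False]" using pword.zero[OF pword.Nil] by simp
  moreover from pword.one[OF this] have "pword [True]" by simp
  ultimately show ?thesis by (cases a) simp_all
qed

text \<open>If the inner word has the form \<open>a v a\<close>, the middle of its image arises by
  one of the two rules from \<open>v\<close> or from the inner word itself.\<close>

lemma pword_middle: "pword w \<Longrightarrow> length w \<le> 1 \<or> (\<exists>a v. pword v \<and> w = a # v @ [a])"
proof (induction rule: pword.induct)
  case (zero y)
  from zero.IH show ?case
  proof (elim disjE exE conjE)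
    assume "length y \<le> 1"
    then consider "y = []" | "y = [False]" | "y = [True]" by (cases y) auto
    then show ?thesis
    proof cases
      case 2
      then show ?thesis by (intro disjI2 exI[of _ False] exI[of _ "[True]"]) simp
    next
      case 3
      then show ?thesis by (intro disjI2 exI[of _ False] exI[of _ "[]"]) (simp add: pword.Nil)
    qed simp
  next
    fix a v assume y: "pword v" "y = a # v @ [a]"
    show ?thesis
    proof (cases a)
      case True
      then show ?thesis using y pword.zero[OF y(1)]
        by (intro disjI2 exI[of _ False] exI[of _ "blocks_of v @ [False]"]) simp
    next
      case False
      then have "pword (True # blocks_of (v @ [False]))" using zero.hyps y(2) by (intro pword.one) simp
      then show ?thesis using False y(2)
        by (intro disjI2 exI[of _ False] exI[of _ "True # blocks_of (v @ [False])"]) simp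
    qed
  qed
next
  case (one y)
  from one.IH show ?case
  proof (elim disjE exE conjE)
    fix a v assume y: "pword v" "False # y = a # v @ [a]"
    then show ?thesis using pword.zero[OF y(1)]
      by (intro disjI2 exI[of _ True] exI[of _ "blocks_of v @ [False]"]) auto
  qed simp
qed simp

lemma ex1_bool: "(\<exists>!a. P a) \<longleftrightarrow> P False \<noteq> P True"
  by (cases "P False"; cases "P True") (auto simp: Ex1_def all_bool_eq ex_bool_eq)

text \<open>Extending \<open>blocks_of y @ [False]\<close> by 0 or 1 corresponds to extending
  \<open>y\<close> by 1 or 0. A word beginning with 1 extends by 0 only, as \<open>11\<close> is
  impossible.\<close>

lemma pword_extend: "pword v \<Longrightarrow> \<exists>!a. pword (a # v @ [a])"
proof (induction rule: pword.induct)
  case Nil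
  have "pword [False, False]" using pword.zero[of "[True]"] by simp
  moreover have "\<not> pword [True, True]" by (auto simp: pword_True)
  ultimately show ?case by (simp add: ex1_bool)
next
  case (zero y)
  have "pword (False # (blocks_of y @ [False]) @ [False]) \<longleftrightarrow> pword (True # y @ [True])"
  proof
    assume "pword (False # (blocks_of y @ [False]) @ [False])"
    then obtain z where z: "pword z" "blocks_of (True # y @ [True]) @ [False] = blocks_of z @ [False]"
      unfolding pword_False by auto
    then have "blocks_of (True # y @ [True]) = blocks_of z" by (simp only: append1_eq_conv)
    then show "pword (True # y @ [True])" using z(1) blocks_of_inj by metis
  qed (use pword.zero[of "True # y @ [True]"] in simp)
  moreover have "pword (True # (blocks_of y @ [False]) @ [True]) \<longleftrightarrow> pword (False # y @ [False])"
  proof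
    assume "pword (True # (blocks_of y @ [False]) @ [True])"
    then obtain z where z: "pword (False # z)" "blocks_of (y @ [False]) = blocks_of z"
      unfolding pword_True by auto
    then show "pword (False # y @ [False])" using blocks_of_inj by metis
  qed (use pword.one[of "y @ [False]"] in simp)
  ultimately show ?case using zero.IH unfolding ex1_bool by blast
next
  case (one y)
  have "pword (False # (True # blocks_of y) @ [False])"
    using pword.zero[OF one.hyps] by simp
  moreover have "\<not> pword (True # (True # blocks_of y) @ [True])"
    by (auto simp: pword_True dest: sym)
  ultimately show ?case unfolding ex1_bool by blast
qed

text \<open>Unique extension and removal of the end letters are inverse bijections between the
  lengths \<open>n\<close> and \<open>n + 2\<close>.\<close>

lemma card_pword: "card {w. pword w \<and> length w = n} = (if even n then 1 else 2)"
proof (induction n rule: induct_nat_012)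
  case 0
  have "{w. pword w \<and> length w = 0} = {[]}" by (auto simp: pword.Nil)
  then show ?case by simp
next
  case 1
  have "{w. pword w \<and> length w = Suc 0} = {[False], [True]}"
    by (auto simp: length_Suc_conv)
  then show ?case by simp
next
  case (ge2 n)
  define e where "e v = (THE a. pword (a # v @ [a])) # v @ [THE a. pword (a # v @ [a])]" for v
  have e: "pword (e v)" if "pword v" for v
    unfolding e_def by (rule theI'[OF pword_extend[OF that]])
  have "{w. pword w \<and> length w = Suc (Suc n)} = e ` {w. pword w \<and> length w = n}"
  proof (intro equalityI subsetI)
    fix w assume w: "w \<in> {w. pword w \<and> length w = Suc (Suc n)}"
    then obtain a v where v: "pword v" "w = a # v @ [a]" using pword_middle[of w] by auto
    have "(THE a. pword (a # v @ [a])) = a"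
      using w v pword_extend[OF v(1)] by (intro the1_equality) auto
    then have "w = e v" using v(2) by (simp add: e_def)
    moreover have "length v = n" using w v(2) by simp
    ultimately show "w \<in> e ` {w. pword w \<and> length w = n}" using v(1) by blast
  qed (use e in \<open>auto simp: e_def\<close>)
  moreover have "inj_on e A" for A by (auto simp: inj_on_def e_def)
  ultimately show ?case using ge2 by (simp add: card_image)
qed

lemma privileged_fibonacci_iff: "privileged (factor_at fibonacci_word i n) \<longleftrightarrow> fpriv i n"
proof -
  have "fac (\<lambda>j. fibonacci_word !! j) q m = fac (\<lambda>j. fibonacci_word !! j) i m \<longleftrightarrow> fac fw q m = fac fw i m" for q m
    by (auto simp: fac_eq_iff fibonacci_word_eq)
  then show ?thesis
    unfolding factor_at_eq_fac privileged_iff_chain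
    using chain_transport[of "\<lambda>q. q" i i 0 "fac (\<lambda>j. fibonacci_word !! j)" "\<lambda>m. m" "fac fw" 0 n]
    by (auto simp: strict_mono_def)
qed

lemma privileged_factors_fibonacci:
  "privileged_factors fibonacci_word n = map of_bool ` {w. pword w \<and> length w = n}"
proof -
  have f: "factor_at fibonacci_word i n = map of_bool (fac fw i n)" for i
    unfolding factor_at_eq_fac by (rule nth_equalityI) (simp_all add: fibonacci_word_eq)
  show ?thesis
  proof (intro equalityI subsetI)
    fix x assume "x \<in> privileged_factors fibonacci_word n"
    then obtain i where "x = factor_at fibonacci_word i n" "fpriv i n"
      by (auto simp: privileged_factors_def privileged_fibonacci_iff)
    then show "x \<in> map of_bool ` {w. pword w \<and> length w = n}"
      using fpriv_pword f by auto
  next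
    fix x :: "nat list" assume "x \<in> map of_bool ` {w. pword w \<and> length w = n}"
    then obtain w where w: "x = map of_bool w" "pword w" "length w = n" by blast
    then obtain i where i: "w = fac fw i n" "fpriv i n" using pword_fpriv by blast
    then have "x = factor_at fibonacci_word i n" using f[of i] w(1) by simp
    moreover from this have "privileged x" using i(2) privileged_fibonacci_iff[of i n] by simp
    ultimately show "x \<in> privileged_factors fibonacci_word n" unfolding privileged_factors_def by blast
  qed
qed

lemma card_privileged_factors_fibonacci:
  "card (privileged_factors fibonacci_word n) = (if even n then 1 else 2)"
proof -
  have "inj (of_bool :: bool \<Rightarrow> nat)" by (auto simp: inj_def)
  then have "inj_on (map (of_bool :: bool \<Rightarrow> nat)) A" for A by (metis inj_mapI inj_on_subset subset_UNIV)
  then show ?thesis unfolding privileged_factors_fibonacci by (simp add: card_image card_pword)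
qed

section \<open>An automaton for the Fibonacci word\<close>

definition zval :: "nat list \<Rightarrow> nat" where
  "zval w = (\<Sum>j<length w. rev w ! j * fib (j + 2))"

text \<open>All weights move down by one Fibonacci index, so \<open>zval w + zval' w\<close> is the
  value after appending 0.\<close>

definition zval' :: "nat list \<Rightarrow> nat" where
  "zval' w = (\<Sum>j<length w. rev w ! j * fib (j + 1))"

lemma zval_snoc: "zval (w @ [b]) = zval w + zval' w + b"
  by (simp add: zval_def zval'_def sum.lessThan_Suc_shift sum.distrib[symmetric] algebra_simps del: sum.lessThan_Suc)

lemma zval'_snoc: "zval' (w @ [b]) = zval w + b"
  by (simp add: zval_def zval'_def sum.lessThan_Suc_shift del: sum.lessThan_Suc)

definition legal :: "nat list \<Rightarrow> bool" where
  "legal w \<longleftrightarrow> set w \<subseteq> {0, 1} \<and> successively (\<lambda>a b. \<not> (a = 1 \<and> b = 1)) w"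

lemma legal_snoc: "legal (w @ [b]) \<longleftrightarrow> legal w \<and> b \<in> {0, 1} \<and> \<not> (w \<noteq> [] \<and> last w = 1 \<and> b = 1)"
  by (auto simp: legal_def successively_append_iff)

text \<open>Appending 0 shifts the weights just as the morphism lengthens prefixes, and the last
  digit is the letter of the Fibonacci word at that index.\<close>

lemma zval_phi:
  "legal w \<Longrightarrow> fw (zval w) = (w \<noteq> [] \<and> last w = 1) \<and> phi (zval w) = zval w + zval' w"
proof (induction w rule: rev_induct)
  case Nil
  have "\<not> fw 0" using not_fw_phi[of 0] by simp
  then show ?case by (simp add: zval_def zval'_def)
next
  case (snoc b w)
  then have w: "fw (zval w) = (w \<noteq> [] \<and> last w = 1)" "phi (zval w) = zval w + zval' w"
    and b: "b \<in> {0, 1}" "\<not> (w \<noteq> [] \<and> last w = 1 \<and> b = 1)" by (simp_all add: legal_snoc)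
  have z: "zval (w @ [b]) = phi (zval w) + b" by (simp add: zval_snoc w(2))
  show ?case
  proof (cases "b = 0")
    case True
    then show ?thesis using z by (simp add: phi_phi zval'_snoc)
  next
    case False
    then have "b = 1" using b by simp
    then show ?thesis using z b(2) w(1) by (simp add: phi_phi_1 zval'_snoc)
  qed
qed

type_synonym entry = "(int \<times> bool) option"
text \<open>Entries for the offsets -2 to 2, \<open>m\<close> capped at 2, and the letters at
  \<open>k\<close> and \<open>m\<close>, which are the last digits read.\<close>

type_synonym info = "entry list \<times> nat \<times> bool \<times> bool"

text \<open>\<open>B\<close> locates the end of the image relative to \<open>phi k + phi m\<close>;
  it may be negative, hence integers. \<open>None\<close> stands for unknown and is always
  valid.\<close>

definition is_entry :: "nat \<Rightarrow> nat \<Rightarrow> int \<Rightarrow> entry \<Rightarrow> bool" where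
  "is_entry k m d e \<longleftrightarrow> (\<forall>B A. e = Some (B, A) \<longrightarrow>
     (\<exists>t. int t = int m + d \<and> int (phi (k + t)) = int (phi k) + int (phi m) + B \<and> A = fpriv k t))"

primrec are_entries :: "nat \<Rightarrow> nat \<Rightarrow> int \<Rightarrow> entry list \<Rightarrow> bool" where
  "are_entries k m d [] = True"
| "are_entries k m d (e # es) = (is_entry k m d e \<and> are_entries k m (d + 1) es)"

fun next_gap :: "int \<Rightarrow> int \<Rightarrow> entry list \<Rightarrow> bool" where
  "next_gap g B (Some (B', A) # es) = (B' = B + g)"
| "next_gap g B es = False"

text \<open>Appending digits turns \<open>(k, m)\<close> into \<open>(phi k + a, phi m + b)\<close>. The end of the new factor is \<open>phi (k + t)\<close> or
  \<open>phi (k + t) + 1\<close>, and \<open>t\<close> is located by comparing \<open>X\<close> with the known gaps. Two branches avoid looking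
  outside the window: a gap 1 is never preceded by another gap 1, and a factor that begins with 0 and
  ends with 1 is not privileged.\<close>

fun search :: "bool \<Rightarrow> bool \<Rightarrow> bool \<Rightarrow> int \<Rightarrow> int \<Rightarrow> entry \<Rightarrow> entry list \<Rightarrow> entry" where
  "search a b z X d prev [] = None"
| "search a b z X d prev (None # es) = search a b z X (d + 1) None es"
| "search a b z X d prev (Some (B, A) # es) =
    (if B = X then
       (if z then Some (B + d - 2 * of_bool a - 2 * of_bool b, True)
        else if a then Some (B + d - 2 * of_bool a - 2 * of_bool b, A)
        else case prev of
            None \<Rightarrow> if next_gap 1 B es then Some (B + d - 2 * of_bool a - 2 * of_bool b, False) else None
          | Some (B', A') \<Rightarrow> Some (B + d - 2 * of_bool a - 2 * of_bool b, if B' = B - 1 then A' else False))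
     else if if B + 1 = X then if a then True else next_gap 2 B es else False
       then Some (B + d + 2 - 2 * of_bool a - 2 * of_bool b, z \<or> \<not> a \<and> A)
     else search a b z X (d + 1) (Some (B, A)) es)"

text \<open>The cap suffices to recognise a new length that is negative or 0, since
  \<open>phi m\<close> is 0, 2 or at least 3.\<close>

definition fib_entry :: "bool \<Rightarrow> bool \<Rightarrow> nat \<Rightarrow> entry list \<Rightarrow> int \<Rightarrow> entry" where
  "fib_entry a b mm es d =
    (if mm = 0 \<and> of_bool b + d < 0 then None
     else search a b (mm = 0 \<and> of_bool b + d = 0 \<or> mm = 1 \<and> of_bool b + d = -2) (of_bool a + of_bool b + d) (-2) None es)"

fun fib_step :: "info \<Rightarrow> bool \<Rightarrow> bool \<Rightarrow> info option" where
  "fib_step (es, mm, fk, fm) a b =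
    (if a \<and> fk \<or> b \<and> fm then None
     else Some ([fib_entry a b mm es (-2), fib_entry a b mm es (-1), fib_entry a b mm es 0,
       fib_entry a b mm es 1, fib_entry a b mm es 2], if mm = 0 then of_bool b else 2, a, b))"

fun is_info :: "info \<Rightarrow> nat \<Rightarrow> nat \<Rightarrow> bool" where
  "is_info (es, mm, fk, fm) k m \<longleftrightarrow> length es = 5 \<and> are_entries k m (-2) es \<and> mm = min m 2 \<and> fk = fw k \<and> fm = fw m"

lemma phi_digit: "phi (phi k + of_bool a) = phi k + k + 2 * of_bool a"
  by (cases a) (simp_all add: phi_phi phi_phi_1)

lemma blen_less_iff: "blen k m < blen k n \<longleftrightarrow> m < n"
proof -
  have "phi (k + m) < phi (k + n) \<longleftrightarrow> m < n" by simp
  then show ?thesis by (simp only: phi_add add_less_cancel_left)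
qed

lemma blen_eq_iff: "blen k m = blen k n \<longleftrightarrow> m = n"
  using blen_less_iff[of k m n] blen_less_iff[of k n m] by (metis less_irrefl linorder_neqE_nat)

lemma fpriv_ends: "fpriv k (Suc t) \<Longrightarrow> fw (k + t) = fw k"
proof -
  assume "fpriv k (Suc t)"
  then consider "length (fac fw k (Suc t)) \<le> 1" | a v where "fac fw k (Suc t) = a # v @ [a]"
    using pword_middle fpriv_pword by blast
  then show ?thesis
  proof cases
    case 2
    then have "length (a # v @ [a]) = Suc t" by (metis length_fac)
    then have "fac fw k (Suc t) ! 0 = a" "fac fw k (Suc t) ! t = a"
      unfolding 2 by (simp_all add: nth_append nth_Cons split: nat.split)
    then show ?thesis by simp
  qed simp
qed

text \<open>The new end lies at \<open>phi k + phi m + X\<close>. Once its block is known,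
  \<open>phi_phi\<close> or \<open>phi_phi_1\<close> gives the new \<open>B'\<close>, and
  \<open>fpriv_0\<close> or \<open>fpriv_1\<close> the new \<open>A'\<close>.\<close>

lemma search_correct:
  assumes a: "a \<longrightarrow> \<not> fw k" and n: "int n = int (phi m) + of_bool b + d1" and z: "z \<longleftrightarrow> n = 0"
    and X: "X = of_bool a + of_bool b + d1"
  shows "search a b z X d prev es = Some (B', A') \<Longrightarrow>
    is_entry k m (d - 1) prev \<Longrightarrow> are_entries k m d es \<Longrightarrow>
    int (phi (phi k + of_bool a + n)) = int (phi (phi k + of_bool a)) + int (phi (phi m + of_bool b)) + B' \<and>
    A' = fpriv (phi k + of_bool a) n"
proof (induction es arbitrary: d prev)
  case (Cons e es)
  have P: "int (phi k + of_bool a + n) = int (phi k) + int (phi m) + X" using n X by simp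
  show ?case
  proof (cases e)
    case None
    then show ?thesis using Cons.prems by (intro Cons.IH[of "d + 1" None]) (simp_all add: is_entry_def)
  next
    case (Some BA)
    obtain B A where BA: "BA = (B, A)" by (cases BA)
    obtain t where t: "int t = int m + d" "int (phi (k + t)) = int (phi k) + int (phi m) + B" "A = fpriv k t"
      using Cons.prems(3) by (auto simp: Some BA is_entry_def)
    consider "B = X" | "B \<noteq> X" "B + 1 = X" "a \<or> next_gap 2 B es"
      | "B \<noteq> X" "\<not> (B + 1 = X \<and> (a \<or> next_gap 2 B es))" by blast
    then show ?thesis
    proof cases
      case 1
      have "int (phi k + of_bool a + n) = int (phi (k + t))" using P t(2) 1 by simp
      then have pos: "phi k + of_bool a + n = phi (k + t)" by (simp only: of_nat_eq_iff)
      then have bl: "of_bool a + n = blen k t" using phi_add[of k t] by simp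
      have "int (phi (phi k + of_bool a + n)) =
          int (phi (phi k + of_bool a)) + int (phi (phi m + of_bool b)) + (B + d - 2 * of_bool a - 2 * of_bool b)"
        unfolding pos phi_digit using t(1,2) by (simp add: phi_phi)
      moreover have "B' = B + d - 2 * of_bool a - 2 * of_bool b"
        using Cons.prems(1) 1 by (auto simp: Some BA split: if_splits option.splits)
      moreover have "A' = fpriv (phi k + of_bool a) n"
      proof (cases z)
        case True
        then show ?thesis using Cons.prems(1) 1 z by (auto simp: Some BA chain.refl)
      next
        case nz: False
        show ?thesis
        proof (cases a)
          case True
          have "A' = A" using Cons.prems(1) 1 nz True by (simp add: Some BA)
          moreover have "fpriv (Suc (phi k)) n \<longleftrightarrow> fpriv k t"
          proof -
            have nk: "\<not> fw k" using a True by simp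
            have bn: "n + 1 = blen k t" using bl True by simp
            have "1 \<le> t" using bn by (cases t) auto
            then show ?thesis using fpriv_1[OF nk, of n] nz z bn blen_eq_iff by auto
          qed
          ultimately show ?thesis using t(3) True by simp
        next
          case na: False
          have bn: "n = blen k t" using bl na by simp
          show ?thesis
          proof (cases prev)
            \<comment> \<open>The gap before \<open>t\<close> is unknown, but the one after it is 1;
              as ones are never adjacent, the former is not 1.\<close>
            case None
            then have A': "\<not> A'" and gap: "next_gap 1 B es"
              using Cons.prems(1) 1 nz na by (auto simp: Some BA split: if_splits)
            then obtain A2 es' where es: "es = Some (B + 1, A2) # es'"
              by (cases "(1::int, B, es)" rule: next_gap.cases) auto
            obtain t2 where t2: "int t2 = int m + (d + 1)" "int (phi (k + t2)) = int (phi k) + int (phi m) + (B + 1)"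
              using Cons.prems(3) by (auto simp: es is_entry_def)
            have tt: "t2 = Suc t" using t(1) t2(1) by linarith
            have "blen k (Suc t) = blen k t + 1"
              using t(2) t2(2) phi_add[of k t] phi_add[of k t2] unfolding tt by linarith
            then have ft: "fw (k + t)" by (simp add: blen_Suc split: if_splits)
            have "n \<noteq> blen k m' + 1" for m'
            proof
              assume e: "n = blen k m' + 1"
              then have "\<not> Suc m' < t" "m' < t"
                using bn blen_less_iff[of k m' t] blen_less_iff[of k m' "Suc m'"] blen_less_iff[of k "Suc m'" t]
                by linarith+
              then have "t = Suc m'" by simp
              moreover from this have "fw (k + m')" using e bn by (simp add: blen_Suc split: if_splits)
              ultimately show False using no_two_ones[of "k + m'"] ft by simp
            qed
            then show ?thesis using A' fpriv_0[of k n] nz z na by auto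
          next
            case prevSome: (Some BA1)
            obtain B1 A1 where "BA1 = (B1, A1)" by (cases BA1)
            then have prev: "prev = Some (B1, A1)" "A' = (if B1 = B - 1 then A1 else False)"
              using Cons.prems(1) 1 nz na prevSome by (auto simp: Some BA)
          obtain t1 where t1: "int t1 = int m + (d - 1)" "int (phi (k + t1)) = int (phi k) + int (phi m) + B1"
            "A1 = fpriv k t1"
            using Cons.prems(2) by (auto simp: prev is_entry_def)
          have tt: "t = Suc t1" using t(1) t1(1) by linarith
          have gap: "B1 = B - 1 \<longleftrightarrow> blen k t = blen k t1 + 1"
            using t(2) t1(2) phi_add[of k t] phi_add[of k t1] by linarith
          have "n = blen k m' + 1 \<longleftrightarrow> B1 = B - 1 \<and> m' = t1" for m'
          proof
            assume e: "n = blen k m' + 1"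
            then have "m' < t" using bn blen_less_iff[of k m' t] by simp
            moreover have "\<not> m' < t1"
            proof
              assume "m' < t1"
              then have "blen k m' < blen k t1" "blen k t1 < blen k t" using tt by (simp_all add: blen_less_iff)
              then show False using e bn by simp
            qed
            ultimately have "m' = t1" using tt by simp
            then show "B1 = B - 1 \<and> m' = t1" using e bn gap by simp
          qed (use bn gap in simp)
          then have "fpriv (phi k) n \<longleftrightarrow> B1 = B - 1 \<and> fpriv k t1"
            using fpriv_0[of k n] nz z by auto
          then show ?thesis using prev(2) t1(3) na by simp
          qed
        qed
      qed
      ultimately show ?thesis by simp
    next
      case 2
      have r: "B' = B + d + 2 - 2 * of_bool a - 2 * of_bool b \<and> A' = (z \<or> \<not> a \<and> A)"
        using Cons.prems(1) 2 by (auto simp: Some BA)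
      show ?thesis
      proof (cases "fw (k + t)")
        case False
        then have gap: "blen k (Suc t) = blen k t + 2" by (simp add: blen_Suc)
        have "int (phi k + of_bool a + n) = int (Suc (phi (k + t)))" using P t(2) 2(2) by simp
        then have pos: "phi k + of_bool a + n = Suc (phi (k + t))" by (simp only: of_nat_eq_iff)
        then have bl: "of_bool a + n = blen k t + 1" using phi_add[of k t] by simp
        have "int (phi (phi k + of_bool a + n)) =
            int (phi (phi k + of_bool a)) + int (phi (phi m + of_bool b)) + (B + d + 2 - 2 * of_bool a - 2 * of_bool b)"
          unfolding pos phi_digit phi_phi_1 using t(1,2) by simp
        moreover note r
        moreover have "(z \<or> \<not> a \<and> A) = fpriv (phi k + of_bool a) n"
        proof (cases z)
          case True
          then show ?thesis using z by (simp add: chain.refl)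
        next
          case nz: False
          show ?thesis
          proof (cases a)
            case True
            have nk: "\<not> fw k" using a True by simp
            have "n + 1 \<noteq> blen k m'" for m'
            proof
              assume e: "n + 1 = blen k m'"
              then have "blen k t < blen k m'" "blen k m' < blen k (Suc t)" using bl gap True by simp_all
              then show False by (simp add: blen_less_iff)
            qed
            then show ?thesis using fpriv_1[OF nk, of n] nz z True by simp
          next
            case False
            then have "n = blen k t + 1" using bl by simp
            then show ?thesis using fpriv_0[of k n] nz z False t(3) blen_eq_iff by auto
          qed
        qed
        ultimately show ?thesis by simp
      next
        \<comment> \<open>The block at \<open>k + t\<close> is a single letter, so the end is also
          \<open>phi (k + Suc t)\<close>. The preimage then begins with 0 and ends with 1.\<close>
        case True
        have "\<not> next_gap 2 B es"
        proof
          assume "next_gap 2 B es"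
          then obtain A2 es' where es: "es = Some (B + 2, A2) # es'"
            by (cases "(2::int, B, es)" rule: next_gap.cases) auto
          obtain t2 where t2: "int t2 = int m + (d + 1)" "int (phi (k + t2)) = int (phi k) + int (phi m) + (B + 2)"
            using Cons.prems(3) by (auto simp: es is_entry_def)
          have tt: "t2 = Suc t" using t(1) t2(1) by linarith
          have "blen k (Suc t) = blen k t + 2"
            using t(2) t2(2) phi_add[of k t] phi_add[of k t2] unfolding tt by linarith
          then show False using True by (simp add: blen_Suc)
        qed
        then have a': a using 2(3) by blast
        have nk: "\<not> fw k" using a a' by simp
        have S: "phi (k + Suc t) = Suc (phi (k + t))" using True phi_Suc[of "k + t"] by simp
        have "int (phi k + of_bool a + n) = int (phi (k + Suc t))" using P t(2) 2(2) unfolding S by simp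
        then have pos: "phi k + of_bool a + n = phi (k + Suc t)" by (simp only: of_nat_eq_iff)
        then have bl: "n + 1 = blen k (Suc t)" using phi_add[of k "Suc t"] a' by simp
        have "phi (phi (k + Suc t)) = phi (k + t) + k + t + 2" unfolding S phi_phi_1 by simp
        then have "int (phi (phi k + of_bool a + n)) =
            int (phi (phi k + of_bool a)) + int (phi (phi m + of_bool b)) + (B + d + 2 - 2 * of_bool a - 2 * of_bool b)"
          unfolding pos phi_digit using t(1,2) by simp
        moreover note r
        moreover have "z = fpriv (phi k + of_bool a) n"
        proof
          assume z
          then show "fpriv (phi k + of_bool a) n" using z by (simp add: chain.refl)
        next
          assume "fpriv (phi k + of_bool a) n"
          then have "n = 0 \<or> fpriv k (Suc t)" using fpriv_1[OF nk, of n] a' bl blen_eq_iff by auto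
          then show z using fpriv_ends[of k t] True nk z by blast
        qed
        ultimately show ?thesis using a' by simp
      qed
    next
      case 3
      then have "search a b z X (d + 1) e es = Some (B', A')"
        using Cons.prems(1) by (auto simp: Some BA split: if_splits)
      then show ?thesis using Cons.prems(3) by (intro Cons.IH[of "d + 1" e]) simp_all
    qed
  qed
qed simp

lemma phi_1 [simp]: "phi (Suc 0) = 2"
  using phi_Suc[of 0] not_fw_phi[of 0] by simp

lemma phi_ge: "1 \<le> m \<Longrightarrow> m + 1 \<le> phi m"
proof (induction m rule: dec_induct)
  case (step m)
  then show ?case using phi_Suc[of m] by (simp split: if_splits)
qed simp

lemma fib_entry_correct:
  assumes es: "are_entries k m (-2) es" and mm: "mm = min m 2" and a: "a \<longrightarrow> \<not> fw k" and d: "-2 \<le> d1"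
  shows "is_entry (phi k + of_bool a) (phi m + of_bool b) d1 (fib_entry a b mm es d1)"
  unfolding is_entry_def
proof (intro allI impI)
  fix B' A' assume e: "fib_entry a b mm es d1 = Some (B', A')"
  define z where "z \<longleftrightarrow> mm = 0 \<and> of_bool b + d1 = 0 \<or> mm = 1 \<and> of_bool b + d1 = -2"
  have nn: "\<not> (mm = 0 \<and> of_bool b + d1 < 0)" and s: "search a b z (of_bool a + of_bool b + d1) (-2) None es = Some (B', A')"
    using e by (auto simp: fib_entry_def z_def split: if_splits)
  have bd: "-2 \<le> of_bool b + d1" using d by simp
  have m: "m = 0 \<and> mm = 0 \<and> phi m = 0 \<or> m = 1 \<and> mm = 1 \<and> phi m = 2 \<or> mm = 2 \<and> 3 \<le> phi m"
  proof -
    consider "m = 0" | "m = 1" | "2 \<le> m" by linarith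
    then show ?thesis
    proof cases
      case 3
      then show ?thesis using phi_ge[of m] mm by simp
    qed (simp_all add: mm)
  qed
  have nonneg: "0 \<le> int (phi m) + of_bool b + d1" using m nn bd by auto
  define n where "n = nat (int (phi m) + of_bool b + d1)"
  have n: "int n = int (phi m) + of_bool b + d1" using nonneg by (simp add: n_def)
  have z: "z \<longleftrightarrow> n = 0" using m n bd nn unfolding z_def by auto
  have "is_entry k m (- 2 - 1) None" by (simp add: is_entry_def)
  from search_correct[OF a n z HOL.refl s this es]
  show "\<exists>t. int t = int (phi m + of_bool b) + d1 \<and>
      int (phi (phi k + of_bool a + t)) = int (phi (phi k + of_bool a)) + int (phi (phi m + of_bool b)) + B' \<and>
      A' = fpriv (phi k + of_bool a) t"
    using n by (intro exI[of _ n]) simp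
qed

lemma fw_digit: "b \<longrightarrow> \<not> fw k \<Longrightarrow> fw (phi k + of_bool b) = b"
  by (cases b) simp_all

lemma is_info_step:
  assumes x: "is_info x k m" and y: "fib_step x a b = Some y"
  shows "is_info y (phi k + of_bool a) (phi m + of_bool b)"
proof -
  obtain es mm fk fm where xe: "x = (es, mm, fk, fm)" by (cases x)
  have es: "are_entries k m (-2) es" and mm: "mm = min m 2" and f: "fk = fw k" "fm = fw m"
    using x by (simp_all add: xe)
  have ab: "a \<longrightarrow> \<not> fw k" "b \<longrightarrow> \<not> fw m" and ye: "y = ([fib_entry a b mm es (-2), fib_entry a b mm es (-1),
      fib_entry a b mm es 0, fib_entry a b mm es 1, fib_entry a b mm es 2], if mm = 0 then of_bool b else 2, a, b)"
    using y f by (auto simp: xe split: if_splits)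
  have "(if mm = 0 then of_bool b else 2) = min (phi m + of_bool b) 2"
  proof (cases "m = 0")
    case False
    then show ?thesis using phi_ge[of m] mm by simp
  qed (use mm in \<open>cases b; simp\<close>)
  moreover have "is_entry (phi k + of_bool a) (phi m + of_bool b) d (fib_entry a b mm es d)" if "-2 \<le> d" for d
    using fib_entry_correct[OF es mm ab(1) that] .
  ultimately show ?thesis
    unfolding ye is_info.simps using fw_digit[OF ab(1)] fw_digit[OF ab(2)] by simp
qed

text \<open>\<open>phi\<close> takes the values 0, 2, 3 at 0, 1, 2, and the prefix \<open>01\<close>
  is not privileged.\<close>

definition fib_start :: info where
  "fib_start = ([None, None, Some (0, True), Some (2, True), Some (3, False)], 0, False, False)"

lemma fib_start: "is_info fib_start 0 0"
proof -
  have fw: "\<not> fw 0" "fw 1" using not_fw_phi[of 0] fw_phi_1[of 0] by simp_all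
  have phi: "phi 1 = 2" "phi 2 = 3" using fw phi_Suc[of 0] phi_Suc[of 1] by (simp_all add: numeral_2_eq_2)
  have blen: "blen 0 m = phi m" for m by (simp add: blen_def)
  have f1: "fpriv 0 1" using chain_from_0[of fw 0 1] chain.refl by simp
  have "phi m \<noteq> 1" for m
  proof (cases m)
    case (Suc j)
    have "phi 1 \<le> phi m" using strict_mono_less_eq[OF strict_mono_phi, of 1 m] Suc by simp
    then show ?thesis using phi by simp
  qed simp
  then have f2: "\<not> fpriv 0 2" using fpriv_0[of 0 2] by (auto simp: blen)
  show ?thesis
    unfolding fib_start_def is_info.simps are_entries.simps is_entry_def
    using fw phi f1 f2 chain.refl[of "fac fw" 0 0] by (auto intro!: exI[of _ 0] exI[of _ "Suc 0"] exI[of _ "2::nat"])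
qed

text \<open>Successors are listed for the digit pairs (0,0), (0,1), (1,0), (1,1), the digit of the
  position first.\<close>

definition fib_table :: "(bool \<times> nat option list) list" where
  "fib_table =
    [(True, [Some 0, Some 1, Some 2, Some 3]),
     (True, [Some 4, None, Some 5, None]),
     (True, [Some 0, Some 1, None, None]),
     (True, [Some 6, None, None, None]),
     (False, [Some 7, Some 5, None, Some 8]),
     (False, [Some 9, None, None, None]),
     (True, [Some 7, Some 10, Some 11, Some 12]),
     (True, [Some 13, Some 14, Some 5, None]),
     (True, [Some 15, None, None, None]),
     (False, [Some 7, Some 5, None, None]),
     (False, [Some 9, None, Some 16, None]),
     (True, [Some 15, Some 17, None, None]),
     (False, [Some 18, None, None, None]),
     (False, [None, None, None, Some 8]),
     (True, [Some 13, None, Some 5, None]),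
     (True, [None, Some 19, Some 11, Some 12]),
     (True, [Some 13, Some 14, None, None]),
     (False, [Some 7, None, None, None]),
     (False, [Some 5, None, None, None]),
     (False, [None, None, Some 16, None])]"

fun fib_accept :: "nat option \<Rightarrow> bool" where
  "fib_accept None = False"
| "fib_accept (Some q) = fst (fib_table ! q)"

fun fib_trans :: "nat option \<Rightarrow> bool \<Rightarrow> bool \<Rightarrow> nat option" where
  "fib_trans None a b = None"
| "fib_trans (Some q) a b = snd (fib_table ! q) ! (if a then if b then 3 else 2 else if b then 1 else 0)"

text \<open>A window paired with the state reached by the automaton, \<open>None\<close> after a
  missing transition. A closed set of pairs satisfying \<open>sim_ok\<close> proves the automaton
  right.\<close>

type_synonym sim = "info \<times> nat option"

fun entries_eq :: "entry list \<Rightarrow> entry list \<Rightarrow> bool" where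
  "entries_eq [] [] = True"
| "entries_eq (None # es) (None # fs) = entries_eq es fs"
| "entries_eq (Some (B, A) # es) (Some (B', A') # fs) =
    (if A = A' then if B = B' then entries_eq es fs else False else False)"
| "entries_eq _ _ = False"

fun sim_eq :: "sim \<Rightarrow> sim \<Rightarrow> bool" where
  "sim_eq ((es, mm, fk, fm), r) ((es', mm', fk', fm'), r') =
    (if fk = fk' then if fm = fm' then if entries_eq es es' then mm = mm' \<and> r = r' else False else False else False)"

fun sim_pair :: "nat option \<Rightarrow> info option \<Rightarrow> sim list" where
  "sim_pair r None = []"
| "sim_pair r (Some y) = [(y, r)]"

fun sim_step :: "sim \<Rightarrow> bool \<Rightarrow> bool \<Rightarrow> sim list" where
  "sim_step (x, r) a b = sim_pair (fib_trans r a b) (fib_step x a b)"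

fun sim_search :: "nat \<Rightarrow> sim list \<Rightarrow> sim list \<Rightarrow> sim list" where
  "sim_search 0 todo seen = seen"
| "sim_search (Suc n) [] seen = seen"
| "sim_search (Suc n) (s # todo) seen = (if elem sim_eq s seen then sim_search n todo seen
     else sim_search n (sim_step s False False @ sim_step s False True @ sim_step s True False @
       sim_step s True True @ todo) (s # seen))"

text \<open>Index 2 is offset 0, the length \<open>m\<close> itself; this entry has to be
  known.\<close>

fun sim_ok :: "sim \<Rightarrow> bool" where
  "sim_ok ((es, mm, fk, fm), r) = (case es ! 2 of None \<Rightarrow> False | Some (B, A) \<Rightarrow> A = fib_accept r)"

fun sim_mem :: "sim list \<Rightarrow> sim list \<Rightarrow> bool" where
  "sim_mem S [] = True"
| "sim_mem S (s # ss) = (if elem sim_eq s S then sim_mem S ss else False)"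

fun sim_closed :: "sim list \<Rightarrow> sim list \<Rightarrow> bool" where
  "sim_closed S [] = True"
| "sim_closed S (s # ss) = (if sim_ok s then if sim_mem S (sim_step s False False) then
     if sim_mem S (sim_step s False True) then if sim_mem S (sim_step s True False) then
     if sim_mem S (sim_step s True True) then sim_closed S ss
     else False else False else False else False else False)"

fun sim_check :: "sim list \<Rightarrow> bool" where
  "sim_check S = (if elem sim_eq (fib_start, Some 0) S then sim_closed S S else False)"

lemma sim_checked: "sim_check (sim_search 600 [(fib_start, Some 0)] [])"
  by code_simp

lemma entries_eqD: "entries_eq es fs \<Longrightarrow> es = fs"
  by (induction es fs rule: entries_eq.induct) (auto split: if_splits)

lemma sim_eqD: "sim_eq s t \<Longrightarrow> s = t"
  by (induction s t rule: sim_eq.induct) (auto split: if_splits dest: entries_eqD)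

lemma elem_sim: "elem sim_eq s S \<Longrightarrow> s \<in> set S"
  by (induction S) (auto split: if_splits dest: sim_eqD)

lemma sim_mem: "sim_mem S T \<Longrightarrow> set T \<subseteq> set S"
  by (induction T) (auto split: if_splits dest: elem_sim)

lemma sim_closed:
  "sim_closed S T \<Longrightarrow> s \<in> set T \<Longrightarrow> sim_ok s \<and> set (sim_step s a b) \<subseteq> set S"
proof (induction T)
  case (Cons t T)
  show ?case
  proof (cases "s = t")
    case True
    have "set (sim_step t False False) \<subseteq> set S" "set (sim_step t False True) \<subseteq> set S"
      "set (sim_step t True False) \<subseteq> set S" "set (sim_step t True True) \<subseteq> set S" "sim_ok t"
      using Cons.prems(1) by (auto split: if_splits dest: sim_mem)
    then show ?thesis unfolding True by (cases a; cases b) simp_all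
  qed (use Cons in \<open>auto split: if_splits\<close>)
qed simp

lemma fib_table_range:
  assumes "q < 20" and eq: "fib_trans (Some q) a b = Some q'"
  shows "q' < 20"
proof -
  define i :: nat where "i = (if a then if b then 3 else 2 else if b then 1 else 0)"
  have "list_all (\<lambda>r. length (snd r) = 4 \<and> list_all (\<lambda>x. x = None \<or> the x < 20) (snd r)) fib_table"
    and "length fib_table = 20" by code_simp+
  then have "length (snd (fib_table ! q)) = 4 \<and> list_all (\<lambda>x. x = None \<or> the x < 20) (snd (fib_table ! q))"
    using \<open>q < 20\<close> by (simp add: list_all_length)
  then have "\<forall>j<4. snd (fib_table ! q) ! j = None \<or> the (snd (fib_table ! q) ! j) < 20"
    by (simp add: list_all_length)
  moreover have "i < 4" by (simp add: i_def)
  ultimately have "snd (fib_table ! q) ! i = None \<or> the (snd (fib_table ! q) ! i) < 20" by blast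
  moreover have "snd (fib_table ! q) ! i = Some q'" using eq unfolding fib_trans.simps i_def .
  ultimately show ?thesis by simp
qed

lemma fibonacci_automaton:
  "\<exists>A :: (nat, nat \<times> nat) dfa. is_dfa ({0, 1} \<times> {0, 1}) A \<and> card (states A) = 20 \<and>
    (\<forall>i n. accepts A (zeckendorf_pair i n) \<longleftrightarrow> privileged (factor_at fibonacci_word i n))"
proof -
  define S where "S = sim_search 600 [(fib_start, Some 0)] []"
  have init: "(fib_start, Some 0) \<in> set S" and closed: "sim_closed S S"
    using sim_checked elem_sim unfolding S_def[symmetric] by (auto split: if_splits)
  define A :: "(nat, nat \<times> nat) dfa" where "A = \<lparr>states = {..<20}, initial = 0,
    accepting = {q. q < 20 \<and> fib_accept (Some q)}, step = (\<lambda>q (a, b). fib_trans (Some q) (a = 1) (b = 1))\<rparr>"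
  have dfa: "is_dfa ({0, 1} \<times> {0, 1}) A"
    by (auto simp: is_dfa_def A_def simp del: fib_trans.simps dest: fib_table_range[rotated])
  have run: "\<exists>x. (x, run A 0 ps) \<in> set S \<and> is_info x (zval (map fst ps)) (zval (map snd ps)) \<and>
      (\<forall>q. run A 0 ps = Some q \<longrightarrow> q < 20)"
    if "legal (map fst ps)" "legal (map snd ps)" for ps
    using that
  proof (induction ps rule: rev_induct)
    case Nil
    have "zval (map fst []) = 0" "zval (map snd []) = 0" by (simp_all add: zval_def)
    then have "(fib_start, run A 0 []) \<in> set S \<and> is_info fib_start (zval (map fst [])) (zval (map snd [])) \<and>
        (\<forall>q. run A 0 [] = Some q \<longrightarrow> q < 20)"
      using init fib_start by (simp del: is_info.simps)
    then show ?case by (rule exI)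
  next
    case (snoc p ps)
    obtain a b where p: "p = (a, b)" by (cases p)
    from snoc.prems have l: "legal (map fst ps)" "legal (map snd ps)" and ab: "a \<in> {0, 1}" "b \<in> {0, 1}"
      and nn: "\<not> (map fst ps \<noteq> [] \<and> last (map fst ps) = 1 \<and> a = 1)"
        "\<not> (map snd ps \<noteq> [] \<and> last (map snd ps) = 1 \<and> b = 1)"
      by (simp_all add: p legal_snoc)
    obtain x where x: "(x, run A 0 ps) \<in> set S" "is_info x (zval (map fst ps)) (zval (map snd ps))"
      and q: "\<And>q. run A 0 ps = Some q \<Longrightarrow> q < 20"
      using snoc.IH l by blast
    obtain es mm fk fm where xe: "x = (es, mm, fk, fm)" by (cases x)
    have "\<not> (a = 1 \<and> fk \<or> b = 1 \<and> fm)"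
      using x(2) nn zval_phi[OF l(1)] zval_phi[OF l(2)] by (auto simp: xe)
    then obtain y where y: "fib_step x (a = 1) (b = 1) = Some y" by (auto simp: xe)
    have r: "run A 0 (ps @ [p]) = fib_trans (run A 0 ps) (a = 1) (b = 1)"
      by (cases "run A 0 ps") (auto simp: run_append p A_def split: option.splits)
    have "set (sim_step (x, run A 0 ps) (a = 1) (b = 1)) \<subseteq> set S"
      using sim_closed[OF closed x(1)] by blast
    then have "(y, run A 0 (ps @ [p])) \<in> set S" unfolding r sim_step.simps y by simp
    moreover have "is_info y (phi (zval (map fst ps)) + of_bool (a = 1)) (phi (zval (map snd ps)) + of_bool (b = 1))"
      using is_info_step[OF x(2) y] .
    moreover have "phi (zval (map fst ps)) + of_bool (a = 1) = zval (map fst (ps @ [p]))"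
      "phi (zval (map snd ps)) + of_bool (b = 1) = zval (map snd (ps @ [p]))"
      using ab zval_phi[OF l(1)] zval_phi[OF l(2)] by (auto simp: p zval_snoc)
    moreover have "\<forall>q. run A 0 (ps @ [p]) = Some q \<longrightarrow> q < 20"
    proof (cases "run A 0 ps")
      case (Some q0)
      then show ?thesis using fib_table_range[OF q[OF Some]] unfolding r Some by blast
    qed (simp add: r)
    ultimately show ?case by metis
  qed
  have acc: "accepts A ps \<longleftrightarrow> fpriv (zval (map fst ps)) (zval (map snd ps))"
    if legal: "legal (map fst ps)" "legal (map snd ps)" for ps
  proof -
    obtain x where x: "(x, run A 0 ps) \<in> set S" "is_info x (zval (map fst ps)) (zval (map snd ps))"
      and q: "\<And>q. run A 0 ps = Some q \<Longrightarrow> q < 20"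
      using run[OF legal] by blast
    obtain es mm fk fm where xe: "x = (es, mm, fk, fm)" by (cases x)
    have "sim_ok ((es, mm, fk, fm), run A 0 ps)"
      using sim_closed[OF closed x(1)] unfolding xe by blast
    then obtain B C where e: "es ! 2 = Some (B, C)" "C = fib_accept (run A 0 ps)"
      by (auto split: option.splits prod.splits)
    have "C = fpriv (zval (map fst ps)) (zval (map snd ps))"
    proof -
      have "is_entry k m (d + int j) (es ! j)" if "are_entries k m d es" "j < length es" for k m d j and es :: "entry list"
        using that
      proof (induction es arbitrary: d j)
        case (Cons e es)
        show ?case
        proof (cases j)
          case (Suc i)
          then have "is_entry k m (d + 1 + int i) (es ! i)" using Cons.prems by (intro Cons.IH) simp_all
          then show ?thesis by (simp add: Suc add.assoc)
        qed (use Cons.prems in simp)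
      qed simp
      moreover have "2 < length es" using x(2) by (simp add: xe)
      ultimately have "is_entry (zval (map fst ps)) (zval (map snd ps)) (-2 + int 2) (es ! 2)"
        using x(2) unfolding xe is_info.simps by blast
      then show ?thesis using e(1) by (auto simp: is_entry_def)
    qed
    moreover have "accepts A ps \<longleftrightarrow> fib_accept (run A 0 ps)"
    proof -
      have "initial A = 0" "accepting A = {q. q < 20 \<and> fib_accept (Some q)}" by (simp_all add: A_def)
      then show ?thesis using q by (cases "run A 0 ps") (auto simp: accepts_def)
    qed
    ultimately show ?thesis using e(2) by simp
  qed
  have legal_pad: "legal (pad l w)" if "legal w" for l w
  proof -
    have "legal (replicate j 0 @ w)" for j
    proof (induction j)
      case (Suc j)
      then show ?case by (auto simp: legal_def successively_Cons)
    qed (use that in simp)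
    then show ?thesis by (simp add: pad_def)
  qed
  have zval_pad: "zval (pad l w) = zval w" for l w
  proof -
    have "zval (replicate j 0 @ w) = zval w" for j
    proof (induction j)
      case (Suc j)
      then show ?case using zeckendorf_sum_Cons[of 0 "replicate j 0 @ w"] by (simp add: zval_def)
    qed simp
    then show ?thesis by (simp add: pad_def)
  qed
  have zeck: "legal (zeckendorf n)" "zval (zeckendorf n) = n" for n
    using theI'[OF zeckendorf_ex1[of n]] unfolding zeckendorf_def[symmetric]
    by (auto simp: is_zeckendorf_def legal_def zval_def)
  have "accepts A (zeckendorf_pair i n) \<longleftrightarrow> privileged (factor_at fibonacci_word i n)" for i n
  proof -
    define l where "l = max (length (zeckendorf i)) (length (zeckendorf n))"
    have "length (pad l (zeckendorf i)) = length (pad l (zeckendorf n))"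
      by (simp add: pad_def l_def)
    moreover have "zeckendorf_pair i n = zip (pad l (zeckendorf i)) (pad l (zeckendorf n))"
      by (simp add: zeckendorf_pair_def l_def Let_def)
    ultimately have maps: "map fst (zeckendorf_pair i n) = pad l (zeckendorf i)"
      "map snd (zeckendorf_pair i n) = pad l (zeckendorf n)" by simp_all
    show ?thesis
      using acc[of "zeckendorf_pair i n"] legal_pad[OF zeck(1)]
      unfolding maps zval_pad zeck(2) privileged_fibonacci_iff by blast
  qed
  moreover have "card (states A) = 20" by (simp add: A_def)
  ultimately show ?thesis using dfa by blast
qed


theorem theorem9:
  shows
    "(\<exists>A :: (nat, nat) dfa. is_dfa {0, 1} A \<and> card (states A) = 46 \<and>
        (\<forall>n. accepts A (base2 n) \<longleftrightarrow> has_privileged_factor thue_morse n)) \<and>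
     (\<exists>A :: (nat, nat) dfa. is_dfa {0, 1} A \<and> card (states A) = 84 \<and>
        (\<forall>n. accepts A (base2 n) \<longleftrightarrow> has_privileged_factor rudin_shapiro n)) \<and>
     (\<exists>A :: (nat, nat) dfa. is_dfa {0, 1} A \<and> card (states A) = 47 \<and>
        (\<forall>n. accepts A (base2 n) \<longleftrightarrow> has_privileged_factor paperfolding n)) \<and>
     ({n. has_privileged_factor period_doubling n} = {0, 2} \<union> {2 * n + 1 | n. n \<ge> 0}) \<and>
     (\<exists>A :: (nat, nat) dfa. is_dfa {0, 1} A \<and> card (states A) = 4 \<and>
        (\<forall>n. accepts A (base2 n) \<longleftrightarrow> has_privileged_factor period_doubling n)) \<and>
     (\<exists>A :: (nat, nat \<times> nat) dfa. is_dfa ({0, 1} \<times> {0, 1}) A \<and> card (states A) = 20 \<and>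
        (\<forall>i n. accepts A (zeckendorf_pair i n) \<longleftrightarrow> privileged (factor_at fibonacci_word i n))) \<and>
     (\<forall>n. has_privileged_factor fibonacci_word n) \<and>
     (\<forall>n. even n \<longrightarrow> card (privileged_factors fibonacci_word n) = 1) \<and>
     (\<forall>n. odd n \<longrightarrow> card (privileged_factors fibonacci_word n) = 2)"
proof (intro conjI allI impI)
  show "{n. has_privileged_factor period_doubling n} = {0, 2} \<union> {2 * n + 1 | n. n \<ge> 0}"
    by (auto simp: privileged_lengths_period_doubling elim: oddE)
  show "has_privileged_factor fibonacci_word n" for n
  proof -
    have "card (privileged_factors fibonacci_word n) \<noteq> 0"
      by (simp add: card_privileged_factors_fibonacci)
    then have "privileged_factors fibonacci_word n \<noteq> {}" by (metis card.empty)
    then show ?thesis by (auto simp: privileged_factors_def has_privileged_factor_def)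
  qed
qed (rule thue_morse_automaton rudin_shapiro_automaton paperfolding_automaton
    period_doubling_automaton fibonacci_automaton | simp add: card_privileged_factors_fibonacci)+

end
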